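(* Let $F=(\tilde H,G)\colon U\to\mathbb R^2$ be a $C^\infty$ integrable two-degree of freedom Hamiltonian system on a symplectic $4$-manifold $(U,\omega)$ with a parabolic orbit $\beta\subset U$ along which $dG\neq 0$. Let $P\in\beta$, let $(x,y,\lambda,\varphi)$ be local coordinates on a neighbourhood $D^4$ of $P$, centred at $P$, in which $$H:=H(\tilde H,G)=x^2-y^3+\lambda y,\qquad G=\lambda,$$ $$\omega=g(x,y,\lambda)\,dx\wedge dy+d\lambda\wedge\big(d\varphi+A(x,y,\lambda)\,dx+B(x,y,\lambda)\,dy\big),$$ with $g,A,B$ smooth, and let $\mu$ be the first return map of the Hamiltonian flow of $G$ to the cross-section $D^3=\{\varphi=0\}$ near $\beta$. Then, in a neighbourhood of the origin in $D^3$, the map $\mu$ can be written as the time-$1$ map of a smooth Hamiltonian vector field with respect to the symplectic structure $g(x,y,\lambda)\,dx\wedge dy$, where $\lambda$ is regarded as a parameter. That is, there is a $C^\infty$ function $K=K(x,y,\lambda)$ near the origin such that $\mu$ is the time-$1$ map of the vector field which is tangent to the slices $\{\lambda=\mathrm{const}\}$ and on each slice equals the Hamiltonian vector field of $K(\cdot,\cdot,\lambda)$ with respect to $g(\cdot,\cdot,\lambda)\,dx\wedge dy$.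
   Context: "Smooth" means $C^\infty$; all Hamiltonians, first integrals and symplectic forms are smooth. Integrable system: a smooth map $F=(\tilde H,G)\colon U\to\mathbb R^2$ on a symplectic $4$-manifold $(U,\omega)$ whose components Poisson-commute and are functionally independent on an open dense set. Parabolic point: let $P\in U$ be a point with $\operatorname{rank} dF(P)=1$, and assume (interchanging the components if necessary) that $dG(P)\ne0$. Let $\tilde H_0$ be the restriction of $\tilde H$ to the hypersurface $\{G=G(P)\}$, so that $P$ is a critical point of $\tilde H_0$, and let $k\in\mathbb R$ be determined by $d\tilde H(P)=k\,dG(P)$. The point $P$ is parabolic if (i) the Hessian $d^2\tilde H_0(P)$ has rank $1$; (ii) there is $v\in\ker d^2\tilde H_0(P)$ such that the third derivative of $\tilde H_0$ at $P$ along $v$ is non-zero; (iii) the Hessian $d^2(\tilde H-kG)(P)$ has rank $3$. Parabolic orbit: a closed one-dimensional orbit (a circle) of the (local) Hamiltonian $\mathbb R^2$-action generated by $\tilde H$ and $G$, consisting of parabolic points. Local coordinates: it is known that near each point $P\in\beta$ there are (in general non-canonical) coordinates of the form used in the claim; here $H(\tilde H,G)$ denotes a smooth function of $\tilde H$ and $G$ with $\partial H/\partial\tilde H\neq0$, $\varphi$ is only a local coordinate, and $\beta\cap D^4=\{x=y=\lambda=0\}$. First return map: $\beta$ is a periodic orbit of the Hamiltonian vector field $X_G$, which is transversal to $D^3=\{\varphi=0\}$ at $P$. The map $\mu$ sends a point of $D^3$ near the origin to the point of $D^3$ obtained by following the flow of $X_G$ once around near $\beta$ until it first returns to $D^3$.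 It is a smooth diffeomorphism from a neighbourhood of the origin in $D^3$ (with coordinates $(x,y,\lambda)$) onto its image, fixing the origin and preserving $H$ and $\lambda$. *)

theory Defs
  imports "HOL-Analysis.Analysis"
begin

section \<open>Smooth maps between open subsets of normed spaces\<close>

text \<open>Meant for open \<open>S\<close>: the derivatives are taken at interior points.\<close>

primrec Ck_on :: "nat \<Rightarrow> 'a::real_normed_vector set \<Rightarrow> ('a \<Rightarrow> 'b::real_normed_vector) \<Rightarrow> bool" where
  "Ck_on 0 S f \<longleftrightarrow> continuous_on S f"
| "Ck_on (Suc k) S f \<longleftrightarrow>
     (\<forall>x\<in>S. f differentiable (at x)) \<and> (\<forall>v. Ck_on k S (\<lambda>x. frechet_derivative f (at x) v))"

definition smooth_on :: "'a::real_normed_vector set \<Rightarrow> ('a \<Rightarrow> 'b::real_normed_vector) \<Rightarrow> bool" where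
  "smooth_on S f \<longleftrightarrow> (\<forall>k. Ck_on k S f)"

text \<open>\<open>hessian f p u v\<close> is the second derivative of \<open>f\<close> at \<open>p\<close> as a bilinear form.\<close>

definition hessian :: "('a::real_normed_vector \<Rightarrow> real) \<Rightarrow> 'a \<Rightarrow> 'a \<Rightarrow> 'a \<Rightarrow> real" where
  "hessian f p u v = frechet_derivative (\<lambda>z. frechet_derivative f (at z) u) (at p) v"

text \<open>The rank of the Gram matrix of \<open>B\<close> in the standard (orthonormal) basis.\<close>

definition form_rank :: "('a::euclidean_space \<Rightarrow> 'a \<Rightarrow> real) \<Rightarrow> nat" where
  "form_rank B = dim (range (\<lambda>v. \<Sum>b\<in>Basis. B v b *\<^sub>R b))"


section \<open>Smooth 4-manifolds\<close>

type_synonym R3 = "real \<times> real \<times> real"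
type_synonym R4 = "real \<times> real \<times> real \<times> real"

text \<open>A chart is a pair of its domain and its coordinate map; the values of the coordinate
  map outside the domain are irrelevant.\<close>

type_synonym 'm chart = "'m set \<times> ('m \<Rightarrow> R4)"

abbreviation cdom :: "'m chart \<Rightarrow> 'm set" where "cdom \<kappa> \<equiv> fst \<kappa>"
abbreviation cmap :: "'m chart \<Rightarrow> 'm \<Rightarrow> R4" where "cmap \<kappa> \<equiv> snd \<kappa>"
abbreviation cimg :: "'m chart \<Rightarrow> R4 set" where "cimg \<kappa> \<equiv> cmap \<kappa> ` cdom \<kappa>"
abbreviation cinv :: "'m chart \<Rightarrow> R4 \<Rightarrow> 'm" where "cinv \<kappa> \<equiv> inv_into (cdom \<kappa>) (cmap \<kappa>)"

definition is_chart :: "'m::topological_space chart \<Rightarrow> bool" where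
  "is_chart \<kappa> \<longleftrightarrow> open (cdom \<kappa>) \<and> open (cimg \<kappa>) \<and>
     homeomorphism (cdom \<kappa>) (cimg \<kappa>) (cmap \<kappa>) (cinv \<kappa>)"

definition transition :: "'m chart \<Rightarrow> 'm chart \<Rightarrow> R4 \<Rightarrow> R4" where
  "transition \<kappa> \<kappa>' = cmap \<kappa>' \<circ> cinv \<kappa>"

definition compatible :: "'m chart \<Rightarrow> 'm chart \<Rightarrow> bool" where
  "compatible \<kappa> \<kappa>' \<longleftrightarrow>
     smooth_on (cmap \<kappa> ` (cdom \<kappa> \<inter> cdom \<kappa>')) (transition \<kappa> \<kappa>') \<and>
     smooth_on (cmap \<kappa>' ` (cdom \<kappa> \<inter> cdom \<kappa>')) (transition \<kappa>' \<kappa>)"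

text \<open>\<open>\<A>\<close> is a maximal smooth atlas on \<open>U\<close>, so that the members of \<open>\<A>\<close> are exactly the
  smooth local coordinate systems. \<open>U\<close> is an open subset of its ambient type, which is
  Hausdorff and second countable.\<close>

definition smooth_4manifold ::
    "'m::{t2_space,second_countable_topology} set \<Rightarrow> 'm chart set \<Rightarrow> bool" where
  "smooth_4manifold U \<A> \<longleftrightarrow>
     (\<forall>\<kappa>\<in>\<A>. is_chart \<kappa>) \<and> (\<Union>\<kappa>\<in>\<A>. cdom \<kappa>) = U \<and>
     (\<forall>\<kappa>\<in>\<A>. \<forall>\<kappa>'\<in>\<A>. compatible \<kappa> \<kappa>') \<and>
     (\<forall>\<kappa>. is_chart \<kappa> \<and> cdom \<kappa> \<subseteq> U \<and> (\<forall>\<kappa>'\<in>\<A>. compatible \<kappa> \<kappa>') \<longrightarrow> \<kappa> \<in> \<A>)"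

definition smooth_fun :: "'m chart set \<Rightarrow> ('m \<Rightarrow> real) \<Rightarrow> bool" where
  "smooth_fun \<A> f \<longleftrightarrow> (\<forall>\<kappa>\<in>\<A>. smooth_on (cimg \<kappa>) (f \<circ> cinv \<kappa>))"

text \<open>The differential of \<open>f\<close> in the chart \<open>\<kappa>\<close> at the point with coordinates \<open>z\<close>.\<close>

definition dchart :: "'m chart \<Rightarrow> ('m \<Rightarrow> 'b::real_normed_vector) \<Rightarrow> R4 \<Rightarrow> R4 \<Rightarrow> 'b" where
  "dchart \<kappa> f z = frechet_derivative (f \<circ> cinv \<kappa>) (at z)"


section \<open>Symplectic forms and Hamiltonian vector fields\<close>

text \<open>A 2-form is given by its coordinate expressions: \<open>\<omega> \<kappa> z v w\<close> is the value at the point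
  with \<open>\<kappa>\<close>-coordinates \<open>z\<close> on the tangent vectors with \<open>\<kappa>\<close>-components \<open>v\<close> and \<open>w\<close>. The
  expressions in different charts are pullbacks of each other under the transition maps.\<close>

type_synonym 'm two_form = "'m chart \<Rightarrow> R4 \<Rightarrow> R4 \<Rightarrow> R4 \<Rightarrow> real"

definition smooth_two_form :: "'m chart set \<Rightarrow> 'm two_form \<Rightarrow> bool" where
  "smooth_two_form \<A> \<omega> \<longleftrightarrow>
     (\<forall>\<kappa>\<in>\<A>.
        (\<forall>z\<in>cimg \<kappa>. bilinear (\<omega> \<kappa> z) \<and> (\<forall>v. \<omega> \<kappa> z v v = 0)) \<and>
        (\<forall>v w. smooth_on (cimg \<kappa>) (\<lambda>z. \<omega> \<kappa> z v w)) \<and>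
        (\<forall>\<kappa>'\<in>\<A>. \<forall>z\<in>cmap \<kappa> ` (cdom \<kappa> \<inter> cdom \<kappa>'). \<forall>v w.
           \<omega> \<kappa> z v w =
             \<omega> \<kappa>' (transition \<kappa> \<kappa>' z)
               (frechet_derivative (transition \<kappa> \<kappa>') (at z) v)
               (frechet_derivative (transition \<kappa> \<kappa>') (at z) w)))"

text \<open>In coordinates, \<open>d\<omega>(u,v,w)\<close> on constant fields is the cyclic sum of the directional
  derivatives.\<close>

definition closed_form :: "'m chart set \<Rightarrow> 'm two_form \<Rightarrow> bool" where
  "closed_form \<A> \<omega> \<longleftrightarrow>
     (\<forall>\<kappa>\<in>\<A>. \<forall>z\<in>cimg \<kappa>. \<forall>u v w.
        frechet_derivative (\<lambda>y. \<omega> \<kappa> y v w) (at z) u +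
        frechet_derivative (\<lambda>y. \<omega> \<kappa> y w u) (at z) v +
        frechet_derivative (\<lambda>y. \<omega> \<kappa> y u v) (at z) w = 0)"

definition symplectic_form :: "'m chart set \<Rightarrow> 'm two_form \<Rightarrow> bool" where
  "symplectic_form \<A> \<omega> \<longleftrightarrow> smooth_two_form \<A> \<omega> \<and> closed_form \<A> \<omega> \<and>
     (\<forall>\<kappa>\<in>\<A>. \<forall>z\<in>cimg \<kappa>. \<forall>v. v \<noteq> 0 \<longrightarrow> (\<exists>w. \<omega> \<kappa> z v w \<noteq> 0))"

text \<open>Sign convention: the Hamiltonian vector field of \<open>f\<close> is the field \<open>X\<close> with
  \<open>\<omega>(v, X) = df(v)\<close> for all \<open>v\<close>; in particular it is \<open>\<partial>/\<partial>\<phi>\<close> for \<open>f = \<lambda>\<close> and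
  \<open>\<omega> = d\<lambda> \<and> d\<phi>\<close>. The same convention is used on \<open>U\<close> and on the slices below.\<close>

definition form_dual :: "('v \<Rightarrow> 'v \<Rightarrow> real) \<Rightarrow> ('v \<Rightarrow> real) \<Rightarrow> 'v" where
  "form_dual B \<alpha> = (THE X. \<forall>v. B v X = \<alpha> v)"

definition ham_field :: "'m two_form \<Rightarrow> ('m \<Rightarrow> real) \<Rightarrow> 'm chart \<Rightarrow> R4 \<Rightarrow> R4" where
  "ham_field \<omega> f \<kappa> z = form_dual (\<omega> \<kappa> z) (dchart \<kappa> f z)"

definition poisson_commute :: "'m chart set \<Rightarrow> 'm two_form \<Rightarrow> ('m \<Rightarrow> real) \<Rightarrow> ('m \<Rightarrow> real) \<Rightarrow> bool" where
  "poisson_commute \<A> \<omega> f h \<longleftrightarrow>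
     (\<forall>\<kappa>\<in>\<A>. \<forall>z\<in>cimg \<kappa>. \<omega> \<kappa> z (ham_field \<omega> f \<kappa> z) (ham_field \<omega> h \<kappa> z) = 0)"

text \<open>\<open>\<gamma>\<close>, restricted to the closed interval \<open>I\<close>, is an integral curve of the Hamiltonian
  vector field of \<open>f\<close>.\<close>

definition ham_curve ::
    "'m::topological_space set \<Rightarrow> 'm chart set \<Rightarrow> 'm two_form \<Rightarrow> ('m \<Rightarrow> real) \<Rightarrow> real set \<Rightarrow> (real \<Rightarrow> 'm) \<Rightarrow> bool" where
  "ham_curve U \<A> \<omega> f I \<gamma> \<longleftrightarrow> continuous_on I \<gamma> \<and> \<gamma> ` I \<subseteq> U \<and>
     (\<forall>\<kappa>\<in>\<A>. \<forall>t\<in>I. \<gamma> t \<in> cdom \<kappa> \<longrightarrow>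
        ((cmap \<kappa> \<circ> \<gamma>) has_vector_derivative ham_field \<omega> f \<kappa> (cmap \<kappa> (\<gamma> t))) (at t within I))"


section \<open>Integrable systems and parabolic orbits\<close>

text \<open>\<open>rank_dF \<kappa> Ht G p\<close> is the rank at \<open>p\<close> of the differential of \<open>F = (Ht, G)\<close>, computed in
  the chart \<open>\<kappa>\<close> around \<open>p\<close>.\<close>

definition rank_dF :: "'m chart \<Rightarrow> ('m \<Rightarrow> real) \<Rightarrow> ('m \<Rightarrow> real) \<Rightarrow> 'm \<Rightarrow> nat" where
  "rank_dF \<kappa> Ht G p = dim (range (dchart \<kappa> (\<lambda>q. (Ht q, G q)) (cmap \<kappa> p)))"

definition integrable_system ::
    "'m::{t2_space,second_countable_topology} set \<Rightarrow> 'm chart set \<Rightarrow> 'm two_form \<Rightarrow> ('m \<Rightarrow> real) \<Rightarrow> ('m \<Rightarrow> real) \<Rightarrow> bool" where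
  "integrable_system U \<A> \<omega> Ht G \<longleftrightarrow>
     smooth_4manifold U \<A> \<and> symplectic_form \<A> \<omega> \<and> smooth_fun \<A> Ht \<and> smooth_fun \<A> G \<and>
     poisson_commute \<A> \<omega> Ht G \<and>
     (\<exists>W. open W \<and> W \<subseteq> U \<and> U \<subseteq> closure W \<and>
        (\<forall>\<kappa>\<in>\<A>. \<forall>p\<in>W \<inter> cdom \<kappa>. rank_dF \<kappa> Ht G p = 2))"

definition nonzero_differential :: "'m chart set \<Rightarrow> ('m \<Rightarrow> real) \<Rightarrow> 'm \<Rightarrow> bool" where
  "nonzero_differential \<A> f p \<longleftrightarrow>
     (\<exists>\<kappa>\<in>\<A>. p \<in> cdom \<kappa> \<and> dchart \<kappa> f (cmap \<kappa> p) \<noteq> (\<lambda>_. 0))"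

text \<open>The conditions on a parabolic point \<open>P\<close> with \<open>dG(P) \<noteq> 0\<close>. The chart \<open>\<kappa>\<close> is a slice chart
  for the hypersurface \<open>{G = G(P)}\<close>, which is given in it by the vanishing of the last
  coordinate; the restriction of \<open>Ht\<close> is therefore the function \<open>H0\<close> of the first three
  coordinates. By criticality the conditions do not depend on the choice of \<open>\<kappa>\<close>.\<close>

definition parabolic_wrt :: "'m chart set \<Rightarrow> ('m \<Rightarrow> real) \<Rightarrow> ('m \<Rightarrow> real) \<Rightarrow> 'm \<Rightarrow> bool" where
  "parabolic_wrt \<A> Ht G P \<longleftrightarrow>
     (\<exists>\<kappa>\<in>\<A>. \<exists>a b c k. P \<in> cdom \<kappa> \<and> cmap \<kappa> P = (a, b, c, 0) \<and>
        (\<forall>q\<in>cdom \<kappa>. G q = G P \<longleftrightarrow> snd (snd (snd (cmap \<kappa> q))) = 0) \<and>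
        rank_dF \<kappa> Ht G P = 1 \<and>
        dchart \<kappa> G (cmap \<kappa> P) \<noteq> (\<lambda>_. 0) \<and>
        (\<forall>v. dchart \<kappa> Ht (cmap \<kappa> P) v = k * dchart \<kappa> G (cmap \<kappa> P) v) \<and>
        (let H0 = (\<lambda>(x, y, z). Ht (cinv \<kappa> (x, y, z, 0))); P0 = (a, b, c) in
           form_rank (hessian H0 P0) = 1 \<and>
           (\<exists>v. (\<forall>w. hessian H0 P0 v w = 0) \<and>
                (deriv ^^ 3) (\<lambda>t. H0 (P0 + t *\<^sub>R v)) 0 \<noteq> 0)) \<and>
        form_rank (hessian (\<lambda>z. Ht (cinv \<kappa> z) - k * G (cinv \<kappa> z)) (cmap \<kappa> P)) = 3)"

definition parabolic_point :: "'m chart set \<Rightarrow> ('m \<Rightarrow> real) \<Rightarrow> ('m \<Rightarrow> real) \<Rightarrow> 'm \<Rightarrow> bool" where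
  "parabolic_point \<A> Ht G P \<longleftrightarrow>
     (if nonzero_differential \<A> G P then parabolic_wrt \<A> Ht G P else parabolic_wrt \<A> G Ht P)"

text \<open>The orbit of \<open>p\<close> under the local Hamiltonian action: the points that can be reached from
  \<open>p\<close> along finitely many integral curves of the two Hamiltonian vector fields, each traversed
  in either direction.\<close>

definition flow_rel ::
    "'m::topological_space set \<Rightarrow> 'm chart set \<Rightarrow> 'm two_form \<Rightarrow> ('m \<Rightarrow> real) \<Rightarrow> ('m \<times> 'm) set" where
  "flow_rel U \<A> \<omega> f =
     {(\<gamma> s, \<gamma> t) | \<gamma> s t. \<exists>a b. s \<in> {a..b} \<and> t \<in> {a..b} \<and> ham_curve U \<A> \<omega> f {a..b} \<gamma>}"

definition action_orbit ::
    "'m::topological_space set \<Rightarrow> 'm chart set \<Rightarrow> 'm two_form \<Rightarrow> ('m \<Rightarrow> real) \<Rightarrow> ('m \<Rightarrow> real) \<Rightarrow> 'm \<Rightarrow> 'm set" where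
  "action_orbit U \<A> \<omega> Ht G p = (flow_rel U \<A> \<omega> Ht \<union> flow_rel U \<A> \<omega> G)\<^sup>* `` {p}"

definition parabolic_orbit ::
    "'m::topological_space set \<Rightarrow> 'm chart set \<Rightarrow> 'm two_form \<Rightarrow> ('m \<Rightarrow> real) \<Rightarrow> ('m \<Rightarrow> real) \<Rightarrow> 'm set \<Rightarrow> bool" where
  "parabolic_orbit U \<A> \<omega> Ht G \<beta> \<longleftrightarrow>
     (\<exists>p\<in>U. \<beta> = action_orbit U \<A> \<omega> Ht G p) \<and>
     \<beta> homeomorphic sphere (0::complex) 1 \<and>
     (\<forall>p\<in>\<beta>. parabolic_point \<A> Ht G p)"


section \<open>The local normal form\<close>

definition dx :: "R4 \<Rightarrow> real" where "dx v = fst v"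
definition dy :: "R4 \<Rightarrow> real" where "dy v = fst (snd v)"
definition dlam :: "R4 \<Rightarrow> real" where "dlam v = fst (snd (snd v))"
definition dphi :: "R4 \<Rightarrow> real" where "dphi v = snd (snd (snd v))"

definition wedge :: "('v \<Rightarrow> real) \<Rightarrow> ('v \<Rightarrow> real) \<Rightarrow> 'v \<Rightarrow> 'v \<Rightarrow> real" where
  "wedge \<alpha> \<beta> v w = \<alpha> v * \<beta> w - \<alpha> w * \<beta> v"

text \<open>Coordinates \<open>\<kappa>\<close> on \<open>D4 = cdom \<kappa>\<close>, centred at \<open>P\<close>. The function \<open>h\<close>, defined on an open set
  \<open>V\<close> containing the values of \<open>(Ht, G)\<close> on \<open>D4\<close>, expresses \<open>H\<close> through \<open>Ht\<close> and \<open>G\<close>.\<close>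

definition parabolic_coordinates ::
    "'m chart set \<Rightarrow> 'm two_form \<Rightarrow> ('m \<Rightarrow> real) \<Rightarrow> ('m \<Rightarrow> real) \<Rightarrow> 'm set \<Rightarrow> 'm \<Rightarrow> 'm chart \<Rightarrow>
     (real \<times> real) set \<Rightarrow> (real \<times> real \<Rightarrow> real) \<Rightarrow> (R3 \<Rightarrow> real) \<Rightarrow> (R3 \<Rightarrow> real) \<Rightarrow> (R3 \<Rightarrow> real) \<Rightarrow> bool" where
  "parabolic_coordinates \<A> \<omega> Ht G \<beta> P \<kappa> V h g A B \<longleftrightarrow>
     \<kappa> \<in> \<A> \<and> P \<in> cdom \<kappa> \<and> cmap \<kappa> P = (0, 0, 0, 0) \<and>
     \<beta> \<inter> cdom \<kappa> = {q \<in> cdom \<kappa>. \<exists>\<phi>. cmap \<kappa> q = (0, 0, 0, \<phi>)} \<and>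
     open V \<and> (\<lambda>q. (Ht q, G q)) ` cdom \<kappa> \<subseteq> V \<and> smooth_on V h \<and>
     (\<forall>s\<in>V. frechet_derivative h (at s) (1, 0) \<noteq> 0) \<and>
     (let pr = (\<lambda>(x, y, l, \<phi>). (x, y, l)) in
        smooth_on (pr ` cimg \<kappa>) g \<and> smooth_on (pr ` cimg \<kappa>) A \<and> smooth_on (pr ` cimg \<kappa>) B) \<and>
     (\<forall>x y l \<phi>. (x, y, l, \<phi>) \<in> cimg \<kappa> \<longrightarrow>
        (let q = cinv \<kappa> (x, y, l, \<phi>) in h (Ht q, G q) = x^2 - y^3 + l * y \<and> G q = l) \<and>
        (\<forall>v w. \<omega> \<kappa> (x, y, l, \<phi>) v w =
           g (x, y, l) * wedge dx dy v w +
           wedge dlam (\<lambda>u. dphi u + A (x, y, l) * dx u + B (x, y, l) * dy u) v w))"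


section \<open>First return maps and time-one maps\<close>

text \<open>The cross-section \<open>D3 = {\<phi> = 0}\<close> in the coordinates \<open>(x, y, \<lambda>)\<close>.\<close>

definition section3 :: "'m chart \<Rightarrow> R3 set" where
  "section3 \<kappa> = {(x, y, l). (x, y, l, 0) \<in> cimg \<kappa>}"

definition section_point :: "'m chart \<Rightarrow> R3 \<Rightarrow> 'm" where
  "section_point \<kappa> = (\<lambda>(x, y, l). cinv \<kappa> (x, y, l, 0))"

text \<open>\<open>\<mu>\<close> is, near the origin, the map of first return to the cross-section along the flow of
  \<open>G\<close>. The cross-section may be shrunk to a neighbourhood \<open>N\<close> of the origin. Fixing the origin
  and continuity there single out the return after one turn around the periodic orbit, whatever
  the shape of \<open>N\<close> away from the origin.\<close>

definition first_return_map ::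
    "'m::topological_space set \<Rightarrow> 'm chart set \<Rightarrow> 'm two_form \<Rightarrow> ('m \<Rightarrow> real) \<Rightarrow> 'm chart \<Rightarrow> (R3 \<Rightarrow> R3) \<Rightarrow> bool" where
  "first_return_map U \<A> \<omega> G \<kappa> \<mu> \<longleftrightarrow> \<mu> 0 = 0 \<and> isCont \<mu> 0 \<and>
     (\<exists>N W. open N \<and> N \<subseteq> section3 \<kappa> \<and> open W \<and> 0 \<in> W \<and> W \<subseteq> N \<and>
        (\<forall>p\<in>W. \<mu> p \<in> N \<and>
           (\<exists>T>0. \<exists>\<gamma>. ham_curve U \<A> \<omega> G {0..T} \<gamma> \<and>
              \<gamma> 0 = section_point \<kappa> p \<and> \<gamma> T = section_point \<kappa> (\<mu> p) \<and>
              (\<forall>t\<in>{0<..<T}. \<gamma> t \<notin> section_point \<kappa> ` N))))"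

text \<open>The vector field tangent to the slices \<open>\<lambda> = const\<close> which on each slice is the Hamiltonian
  vector field of \<open>K\<close> with respect to \<open>g dx \<and> dy\<close>.\<close>

definition slice_ham_field :: "(R3 \<Rightarrow> real) \<Rightarrow> (R3 \<Rightarrow> real) \<Rightarrow> R3 \<Rightarrow> R3" where
  "slice_ham_field g K = (\<lambda>(x, y, l).
     (let X = form_dual (\<lambda>v w. g (x, y, l) * wedge fst snd v w)
                (frechet_derivative (\<lambda>(x', y'). K (x', y', l)) (at (x, y)))
      in (fst X, snd X, 0)))"

text \<open>\<open>q\<close> is the image of \<open>p\<close> under the time-1 map of the vector field \<open>X\<close> on \<open>V\<close>.\<close>

definition time_one_image :: "('a::real_normed_vector \<Rightarrow> 'a) \<Rightarrow> 'a set \<Rightarrow> 'a \<Rightarrow> 'a \<Rightarrow> bool" where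
  "time_one_image X V p q \<longleftrightarrow>
     (\<exists>\<gamma>. \<gamma> 0 = p \<and> \<gamma> 1 = q \<and>
        (\<forall>t\<in>{0..1}. \<gamma> t \<in> V \<and> (\<gamma> has_vector_derivative X (\<gamma> t)) (at t within {0..1})))"

end

theory Submission
  imports Defs
begin

text \<open>
  The return map \<open>\<mu>\<close> is the \<open>(x, y, \<lambda>)\<close>-part of the flow of \<open>G\<close> along the periodic orbit. By smooth
  dependence on initial conditions it is smooth, and since the flow preserves \<open>\<omega>\<close>, \<open>G\<close> and the
  other integral, \<open>\<mu>\<close> preserves \<open>\<lambda>\<close>, \<open>H = x\<^sup>2 - y\<^sup>3 + \<lambda>y\<close> and the slice form \<open>g dx \<and> dy\<close>.

  Two points \<open>(x, y)\<close>, \<open>(x', y')\<close> of a slice lie on the same level of \<open>H\<close> iff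
  \<open>(x' - x) a = - (y' - y) b\<close> with \<open>a = x + x'\<close> and \<open>b = \<lambda> - (y\<^sup>2 + yy' + y'\<^sup>2)\<close>. For any smooth
  \<open>H\<close>-preserving map with \<open>a\<close> and \<open>b\<close> independent at the origin this yields
  \<open>(x' - x, y' - y) = \<tau> (b, - a)\<close> with a smooth coefficient \<open>\<tau>\<close>, and \<open>\<tau>\<close> determines the map near the
  origin. Let \<open>\<sigma>(t, p)\<close> be the coefficient of the slice flow \<open>\<Phi>\<close> of \<open>H\<close>; since
  \<open>\<sigma>(t, 0) = - t / g(0)\<close>, the equation \<open>\<sigma>(T(p), p) = \<tau>(p)\<close> has a smooth solution \<open>T\<close>, and then
  \<open>\<mu>(p) = \<Phi>(T(p), p)\<close>. As \<open>\<mu>\<close> preserves the Hamiltonian field of \<open>H\<close>, \<open>T\<close> is a first integral, so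
  \<open>T dH\<close> is closed on the slices, and a primitive of it is the required \<open>K\<close>.
\<close>

section \<open>Calculus of smooth maps\<close>

text \<open>The obstacle is that the Hamiltonian field of \<open>H\<close> vanishes along the whole
  curve \<open>x = 0\<close>, \<open>\<lambda> = 3 y^2\<close>, and at the origin its linearisation
  is nilpotent on the slice. Solving \<open>\<mu> p = \<Phi> (T, p)\<close> for \<open>T\<close>
  directly fails: at the origin every \<open>T\<close> is a solution, and elsewhere the transit time
  between two points of a level has no evident smooth extension across that curve. The coefficient
  \<open>\<tau>\<close> repairs this. The secant vector \<open>(b, - a)\<close> replaces the
  Hamiltonian direction, and \<open>\<tau>\<close> measures the displacement in units of it. For the
  flow this coefficient has the non-zero time derivative \<open>- 1 / g 0\<close> at the equilibrium
  itself, so a scalar implicit function theorem applies there. Smoothness of the quotient comes from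
  Hadamard's lemma and the independence of \<open>a\<close> and \<open>b\<close>. Independence could
  fail for \<open>\<mu>\<close> only if \<open>x' = - x\<close> to first order on the slice; area
  preservation and the odd power of \<open>y\<close> in \<open>H\<close> exclude this. Finally,
  since \<open>T\<close> is constant along trajectories, the field of \<open>K\<close> is that of
  \<open>H\<close> run at constant speed \<open>T\<close> on each of them, so unit time for
  \<open>K\<close> is time \<open>T\<close> for \<open>H\<close>.\<close>

abbreviation fD :: "('a::real_normed_vector \<Rightarrow> 'b::real_normed_vector) \<Rightarrow> 'a \<Rightarrow> 'a \<Rightarrow> 'b" where
  "fD f x \<equiv> frechet_derivative f (at x)"

lemma fD_eqI: "(f has_derivative f') (at x) \<Longrightarrow> fD f x = f'"
  using frechet_derivative_at by metis

lemma fD_cong_open: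
  assumes "open S" "x \<in> S" "\<And>y. y \<in> S \<Longrightarrow> f y = g y"
  shows "fD f x = fD g x"
proof -
  have "(f has_derivative d) (at x) \<longleftrightarrow> (g has_derivative d) (at x)" for d
    using has_derivative_transform_within_open[OF _ assms(1,2)] assms(3) by metis
  then show ?thesis unfolding frechet_derivative_def by simp
qed

lemma differentiable_cong_open:
  assumes "open S" "x \<in> S" "\<And>y. y \<in> S \<Longrightarrow> f y = g y"
  shows "f differentiable (at x) \<longleftrightarrow> g differentiable (at x)"
  unfolding differentiable_def
  using has_derivative_transform_within_open[OF _ assms(1,2)] assms(3) by metis

lemma Ck_on_cong:
  assumes "open S" "\<And>y. y \<in> S \<Longrightarrow> f y = g y"
  shows "Ck_on k S f \<longleftrightarrow> Ck_on k S g"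
  using assms(2)
proof (induction k arbitrary: f g)
  case 0
  then show ?case by (simp cong: continuous_on_cong)
next
  case (Suc k)
  have "fD f x = fD g x" if "x \<in> S" for x
    using fD_cong_open[OF assms(1) that] Suc.prems by blast
  then have "Ck_on k S (\<lambda>x. fD f x v) = Ck_on k S (\<lambda>x. fD g x v)" for v
    by (intro Suc.IH) simp
  moreover have "f differentiable (at x) \<longleftrightarrow> g differentiable (at x)" if "x \<in> S" for x
    using differentiable_cong_open[OF assms(1) that] Suc.prems by blast
  ultimately show ?case by (simp cong: ball_cong)
qed

lemma Ck_on_subset: "Ck_on k S f \<Longrightarrow> T \<subseteq> S \<Longrightarrow> Ck_on k T f"
proof (induction k arbitrary: f)
  case 0 then show ?case by (simp add: continuous_on_subset)
next
  case (Suc k) then show ?case by (simp add: subset_iff)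
qed

text \<open>\<open>frechet_derivative\<close> is a choice operator, so unfolding
  \<open>Ck_on\<close> yields no formula. This rule accepts any explicit derivative and is the usual
  induction step for the closure properties.\<close>

lemma Ck_on_SucI:
  assumes "open S" "\<And>x. x \<in> S \<Longrightarrow> (f has_derivative f' x) (at x)" "\<And>v. Ck_on k S (\<lambda>x. f' x v)"
  shows "Ck_on (Suc k) S f"
proof -
  have "Ck_on k S (\<lambda>x. fD f x v)" for v
    using assms(3)[of v] Ck_on_cong[OF assms(1), of "\<lambda>x. fD f x v" "\<lambda>x. f' x v" k] fD_eqI[OF assms(2)]
    by simp
  moreover have "f differentiable (at x)" if "x \<in> S" for x
    using assms(2)[OF that] differentiableI by blast
  ultimately show ?thesis by simp
qed

lemma Ck_on_Suc_derivative: "Ck_on (Suc k) S f \<Longrightarrow> x \<in> S \<Longrightarrow> (f has_derivative fD f x) (at x)"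
  using frechet_derivative_works by auto

lemma Ck_on_SucD: "Ck_on (Suc k) S f \<Longrightarrow> Ck_on k S f"
proof (induction k arbitrary: f)
  case 0
  then show ?case
    by (simp add: continuous_at_imp_continuous_on differentiable_imp_continuous_within)
next
  case (Suc k)
  from Suc.prems have *: "\<And>x. x \<in> S \<Longrightarrow> f differentiable (at x)" "\<And>v. Ck_on (Suc k) S (\<lambda>x. fD f x v)"
    by simp_all
  show ?case using Suc.IH[OF *(2)] *(1) by simp
qed

lemma Ck_on_le: "Ck_on n S f \<Longrightarrow> m \<le> n \<Longrightarrow> Ck_on m S f"
  using Ck_on_SucD by (induction n) (auto simp: le_Suc_eq)

lemma Ck_on_continuous: "Ck_on k S f \<Longrightarrow> continuous_on S f"
  using Ck_on_le[of k S f 0] by simp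

lemma Ck_on_const: "open S \<Longrightarrow> Ck_on k S (\<lambda>x. c)"
proof (induction k arbitrary: c)
  case 0 then show ?case by simp
next
  case (Suc k)
  show ?case
    by (rule Ck_on_SucI[where f'="\<lambda>_ _. 0"]) (use Suc in auto)
qed

lemma Ck_on_linear:
  assumes "open S" "bounded_linear f" shows "Ck_on k S f"
proof (cases k)
  case 0 then show ?thesis
    using linear_continuous_on[OF assms(2)] by simp
next
  case (Suc n)
  show ?thesis unfolding Suc
    by (rule Ck_on_SucI[where f'="\<lambda>_. f"])
      (use assms bounded_linear_imp_has_derivative Ck_on_const in blast)+
qed

lemma Ck_on_add: "open S \<Longrightarrow> Ck_on k S f \<Longrightarrow> Ck_on k S g \<Longrightarrow> Ck_on k S (\<lambda>x. f x + g x)"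
proof (induction k arbitrary: f g)
  case 0 then show ?case by (simp add: continuous_on_add)
next
  case (Suc k)
  show ?case
    by (rule Ck_on_SucI[where f'="\<lambda>x v. fD f x v + fD g x v"])
      (use Suc in \<open>auto intro!: has_derivative_add simp: frechet_derivative_works[symmetric]\<close>)
qed

lemma (in bounded_linear) Ck_on_compose: "open S \<Longrightarrow> Ck_on k S g \<Longrightarrow> Ck_on k S (\<lambda>x. f (g x))"
proof (induction k arbitrary: g)
  case 0 then show ?case by (simp add: continuous_on)
next
  case (Suc k)
  show ?case
    by (rule Ck_on_SucI[where f'="\<lambda>x v. f (fD g x v)"])
      (use Suc in \<open>auto intro!: has_derivative simp: frechet_derivative_works[symmetric]\<close>)
qed

lemma (in bounded_bilinear) Ck_on_prod:
  "open S \<Longrightarrow> Ck_on k S f \<Longrightarrow> Ck_on k S g \<Longrightarrow> Ck_on k S (\<lambda>x. prod (f x) (g x))"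
proof (induction k arbitrary: f g)
  case 0 then show ?case by (simp add: continuous_on)
next
  case (Suc k)
  show ?case
  proof (rule Ck_on_SucI[where f'="\<lambda>x v. prod (f x) (fD g x v) + prod (fD f x v) (g x)"])
    fix x assume "x \<in> S"
    then show "((\<lambda>x. prod (f x) (g x)) has_derivative (\<lambda>v. prod (f x) (fD g x v) + prod (fD f x v) (g x))) (at x)"
      using Suc.prems by (intro FDERIV) (auto simp: frechet_derivative_works[symmetric])
  next
    fix v
    have "Ck_on k S f" "Ck_on k S g" using Suc.prems(2,3) Ck_on_SucD by blast+
    then show "Ck_on k S (\<lambda>x. prod (f x) (fD g x v) + prod (fD f x v) (g x))"
      by (intro Ck_on_add Suc.IH Suc.prems) (use Suc.prems in auto)
  qed (rule Suc.prems)
qed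

lemmas Ck_on_scaleR = bounded_bilinear.Ck_on_prod[OF bounded_bilinear_scaleR]
lemmas Ck_on_mult = bounded_bilinear.Ck_on_prod[OF bounded_bilinear_mult]
lemmas Ck_on_minus = bounded_linear.Ck_on_compose[OF bounded_linear_minus[OF bounded_linear_ident]]
lemmas Ck_on_fst = bounded_linear.Ck_on_compose[OF bounded_linear_fst]
lemmas Ck_on_snd = bounded_linear.Ck_on_compose[OF bounded_linear_snd]
lemmas Ck_on_inner_left = bounded_linear.Ck_on_compose[OF bounded_linear_inner_left]

lemma Ck_on_diff: "open S \<Longrightarrow> Ck_on k S f \<Longrightarrow> Ck_on k S g \<Longrightarrow> Ck_on k S (\<lambda>x. f x - g x)"
  using Ck_on_add[of S k f "\<lambda>x. - g x"] Ck_on_minus[of S k g] by simp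

lemma Ck_on_sum: "open S \<Longrightarrow> (\<And>i. i \<in> I \<Longrightarrow> Ck_on k S (f i)) \<Longrightarrow> Ck_on k S (\<lambda>x. \<Sum>i\<in>I. f i x)"
  by (induction I rule: infinite_finite_induct) (auto intro: Ck_on_const Ck_on_add)

lemma Ck_on_id: "open S \<Longrightarrow> Ck_on k S (\<lambda>x. x)"
  by (rule Ck_on_linear) (auto intro: bounded_linear_ident)

lemma Ck_on_Pair:
  assumes "open S" "Ck_on k S f" "Ck_on k S g" shows "Ck_on k S (\<lambda>x. (f x, g x))"
proof -
  have "bounded_linear (\<lambda>x::'b. (x, 0::'c))" "bounded_linear (\<lambda>x::'c. (0::'b, x))"
    by (auto intro!: bounded_linear_Pair bounded_linear_ident bounded_linear_zero)
  then have "Ck_on k S (\<lambda>x. (f x, 0) + (0, g x))"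
    by (intro Ck_on_add assms bounded_linear.Ck_on_compose[of "\<lambda>x. (x, 0)"]
      bounded_linear.Ck_on_compose[of "\<lambda>x. (0, x)"])
  then show ?thesis by simp
qed

lemma bounded_linear_basis_expansion:
  assumes "bounded_linear L"
  shows "L w = (\<Sum>b\<in>Basis. (w \<bullet> b) *\<^sub>R L b)"
proof -
  interpret bounded_linear L by fact
  have "L w = L (\<Sum>b\<in>Basis. (w \<bullet> b) *\<^sub>R b)" by (simp only: euclidean_representation)
  also have "\<dots> = (\<Sum>b\<in>Basis. (w \<bullet> b) *\<^sub>R L b)" by (subst sum) (simp only: scaleR)
  finally show ?thesis .
qed

text \<open>In the chain rule the derivative of \<open>g\<close> is applied to a vector that varies
  with \<open>x\<close> as well. Expanding this vector in the basis gives a finite sum of scalar C^k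
  functions times partial derivatives of \<open>g\<close> at \<open>f x\<close>, to which the
  induction hypothesis applies.\<close>

lemma Ck_on_compose:
  fixes f :: "'a::real_normed_vector \<Rightarrow> 'b::euclidean_space" and g :: "'b \<Rightarrow> 'c::real_normed_vector"
  assumes "open S" "open T" "Ck_on k S f" "Ck_on k T g" "f ` S \<subseteq> T"
  shows "Ck_on k S (\<lambda>x. g (f x))"
  using assms(3,4)
proof (induction k arbitrary: g)
  case 0 then show ?case using assms(5) by (auto intro: continuous_on_compose2)
next
  case (Suc k)
  have d: "(f has_derivative fD f x) (at x)" "(g has_derivative fD g (f x)) (at (f x))" if "x \<in> S" for x
    using that Suc.prems assms(5) by (auto simp: frechet_derivative_works[symmetric])
  show ?case
  proof (rule Ck_on_SucI[where f'="\<lambda>x v. \<Sum>b\<in>Basis. (fD f x v \<bullet> b) *\<^sub>R fD g (f x) b"])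
    fix x assume x: "x \<in> S"
    have *: "fD g (f x) w = (\<Sum>b\<in>Basis. (w \<bullet> b) *\<^sub>R fD g (f x) b)" for w
      by (rule bounded_linear_basis_expansion[OF has_derivative_bounded_linear[OF d(2)[OF x]]])
    show "((\<lambda>x. g (f x)) has_derivative (\<lambda>v. \<Sum>b\<in>Basis. (fD f x v \<bullet> b) *\<^sub>R fD g (f x) b)) (at x)"
      by (rule has_derivative_eq_rhs[OF has_derivative_compose[OF d[OF x]]]) (rule ext, rule *)
  next
    fix v
    have *: "Ck_on k S (\<lambda>x. fD g (f x) b)" for b
      using Suc.IH[of "\<lambda>y. fD g y b"] Suc.prems Ck_on_SucD by auto
    show "Ck_on k S (\<lambda>x. \<Sum>b\<in>Basis. (fD f x v \<bullet> b) *\<^sub>R fD g (f x) b)"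
      by (intro Ck_on_sum Ck_on_scaleR Ck_on_inner_left assms *) (use Suc.prems in auto)
  qed (rule assms(1))
qed

lemma Ck_on_inverse:
  fixes f :: "'a::real_normed_vector \<Rightarrow> real"
  assumes "open S" "Ck_on k S f" "\<And>x. x \<in> S \<Longrightarrow> f x \<noteq> 0"
  shows "Ck_on k S (\<lambda>x. inverse (f x))"
  using assms(2)
proof (induction k)
  case 0 then show ?case using assms(3) by (auto intro: continuous_on_inverse)
next
  case (Suc k)
  then have k: "Ck_on k S (\<lambda>x. inverse (f x))" using Ck_on_SucD by blast
  show ?case
    by (rule Ck_on_SucI[where f'="\<lambda>x v. - (inverse (f x) * fD f x v * inverse (f x))"])
     (use Suc k assms in \<open>auto intro!: Ck_on_minus Ck_on_mult has_derivative_inverse simp: frechet_derivative_works[symmetric]\<close>)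
qed

lemma Ck_on_divide:
  fixes f g :: "'a::real_normed_vector \<Rightarrow> real"
  assumes "open S" "Ck_on k S f" "Ck_on k S g" "\<And>x. x \<in> S \<Longrightarrow> g x \<noteq> 0"
  shows "Ck_on k S (\<lambda>x. f x / g x)"
  using Ck_on_mult[OF assms(1,2) Ck_on_inverse[OF assms(1,3,4)]] by (simp add: divide_inverse)

lemma Ck_on_power:
  fixes f :: "'a::real_normed_vector \<Rightarrow> real"
  shows "open S \<Longrightarrow> Ck_on k S f \<Longrightarrow> Ck_on k S (\<lambda>x. f x ^ n)"
  by (induction n) (auto intro: Ck_on_const Ck_on_mult)

named_theorems Ck_intros
lemmas [Ck_intros] = Ck_on_const Ck_on_id Ck_on_add Ck_on_diff Ck_on_minus Ck_on_mult Ck_on_scaleR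
  Ck_on_fst Ck_on_snd Ck_on_Pair Ck_on_inner_left Ck_on_sum Ck_on_power

section \<open>Continuity of the derivative and integrals depending on a parameter\<close>

text \<open>\<open>Ck_on\<close> controls the derivative one direction at a time. In finite
  dimension this already gives continuity in operator norm, the form required by the Leibniz rule,
  the inverse function theorem and the compactness estimates.\<close>

lemma Ck_on_1_blinfun_continuous:
  fixes f :: "'a::euclidean_space \<Rightarrow> 'b::real_normed_vector"
  assumes "Ck_on (Suc 0) S f"
  shows "continuous_on S (\<lambda>x. Blinfun (fD f x))"
proof (rule continuous_on_blinfun_componentwise)
  fix i :: 'a assume "i \<in> Basis"
  have "blinfun_apply (Blinfun (fD f x)) i = fD f x i" if "x \<in> S" for x
    using Ck_on_Suc_derivative[OF assms that] has_derivative_bounded_linear bounded_linear_Blinfun_apply by metis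
  moreover have "continuous_on S (\<lambda>x. fD f x i)" using assms by simp
  ultimately show "continuous_on S (\<lambda>x. blinfun_apply (Blinfun (fD f x)) i)"
    by (simp cong: continuous_on_cong)
qed

text \<open>Differentiation under the integral sign. The interval \<open>{0..1}\<close> sits in an
  open \<open>J\<close> because \<open>Ck_on\<close> uses two-sided derivatives, also in the
  variable of integration.\<close>

lemma has_derivative_parameter_integral:
  fixes f :: "'a::euclidean_space \<times> real \<Rightarrow> 'b::banach"
  assumes "open S" "open J" "{0..1} \<subseteq> J" "Ck_on (Suc 0) (S \<times> J) f" "x \<in> S"
  shows "((\<lambda>x. integral {0..1} (\<lambda>t. f (x, t))) has_derivative
            (\<lambda>v. integral {0..1} (\<lambda>t. fD f (x, t) (v, 0)))) (at x)"
proof -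
  obtain r where r: "r > 0" "ball x r \<subseteq> S" using assms(1,5) openE by blast
  let ?U = "ball x r"
  have bl: "bounded_linear (fD f z)" if "z \<in> S \<times> J" for z
    using Ck_on_Suc_derivative[OF assms(4) that] has_derivative_bounded_linear by blast
  define B where "B = (\<lambda>y t. Blinfun (fD f (y, t)) o\<^sub>L Blinfun (\<lambda>v. (v, 0::real)))"
  have bl2: "bounded_linear (\<lambda>v::'a. (v, 0::real))"
    by (auto intro!: bounded_linear_Pair bounded_linear_ident bounded_linear_zero)
  have B: "blinfun_apply (B y t) v = fD f (y, t) (v, 0)" if "y \<in> ?U" "t \<in> {0..1}" for y t v
    unfolding B_def blinfun_apply_blinfun_compose
    using that r(2) assms(3) by (subst (1 2) bounded_linear_Blinfun_apply) (auto intro!: bl bl2)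
  have cf: "continuous_on (S \<times> J) f" using Ck_on_continuous assms(4) by blast
  have "((\<lambda>x. integral (cbox 0 1) (\<lambda>t. f (x, t))) has_derivative integral (cbox 0 1) (B x)) (at x within ?U)"
  proof (rule leibniz_rule)
    fix y t assume y: "y \<in> ?U" "t \<in> cbox (0::real) 1"
    have "((\<lambda>y. (y, t)) has_derivative (\<lambda>v. (v, 0))) (at y)" by (auto intro!: derivative_eq_intros)
    moreover have "(f has_derivative fD f (y,t)) (at (y, t))"
      using y r(2) assms(3) by (intro Ck_on_Suc_derivative[OF assms(4)]) auto
    ultimately have "((\<lambda>y. f (y, t)) has_derivative (\<lambda>v. fD f (y, t) (v, 0))) (at y)"
      using has_derivative_compose by blast
    moreover have "blinfun_apply (B y t) = (\<lambda>v. fD f (y, t) (v, 0))" using B y by auto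
    ultimately show "((\<lambda>y. f (y, t)) has_derivative blinfun_apply (B y t)) (at y within ?U)"
      using has_derivative_at_withinI by metis
  next
    fix y assume "y \<in> ?U"
    then have "continuous_on {0..1} (\<lambda>t. f (y, t))"
      using r(2) assms(3) by (intro continuous_on_compose2[OF cf]) (auto intro!: continuous_intros)
    then show "(\<lambda>t. f (y, t)) integrable_on cbox 0 1"
      using integrable_continuous_real by auto
  next
    have "continuous_on (S \<times> J) (\<lambda>z. Blinfun (fD f z) o\<^sub>L Blinfun (\<lambda>v. (v, 0::real)))"
      by (intro continuous_intros Ck_on_1_blinfun_continuous assms)
    then have "continuous_on (S \<times> J) (\<lambda>(y,t). B y t)" unfolding B_def by (simp add: case_prod_beta')
    then show "continuous_on (?U \<times> cbox 0 1) (\<lambda>(y,t). B y t)"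
      by (rule continuous_on_subset) (use r(2) assms(3) in auto)
  qed (use r in auto)
  moreover have "blinfun_apply (integral (cbox 0 1) (B x)) = (\<lambda>v. integral {0..1} (\<lambda>t. fD f (x, t) (v, 0)))"
  proof
    fix v
    have "continuous_on {0..1} (B x)" unfolding B_def
      using assms(3,5)
      by (intro continuous_intros continuous_on_compose2[OF Ck_on_1_blinfun_continuous[OF assms(4)]]) auto
    then have "B x integrable_on cbox 0 1" using integrable_continuous_real by auto
    then have "blinfun_apply (integral (cbox 0 1) (B x)) v = integral (cbox 0 1) (\<lambda>t. blinfun_apply (B x t) v)"
      by (rule blinfun_apply_integral)
    also have "\<dots> = integral {0..1} (\<lambda>t. fD f (x, t) (v, 0))"
      using B[of x] r(1) by (auto intro!: integral_cong)
    finally show "blinfun_apply (integral (cbox 0 1) (B x)) v = integral {0..1} (\<lambda>t. fD f (x, t) (v, 0))" .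
  qed
  ultimately show ?thesis using r(1) at_within_open[of x ?U] by simp
qed

lemma Ck_on_parameter_integral:
  fixes f :: "'a::euclidean_space \<times> real \<Rightarrow> 'b::banach"
  assumes "open S" "open J" "{0..1} \<subseteq> J" "Ck_on k (S \<times> J) f"
  shows "Ck_on k S (\<lambda>x. integral {0..1} (\<lambda>t. f (x, t)))"
  using assms(4)
proof (induction k arbitrary: f)
  case 0
  then have "continuous_on (S \<times> cbox 0 1) (\<lambda>(x, t). f (x, t))"
    using continuous_on_subset[of "S \<times> J" f "S \<times> cbox 0 1"] assms(3) by (auto simp: case_prod_beta')
  then show ?case
    using integral_continuous_on_param[of S 0 1 "\<lambda>x t. f (x, t)"] by simp
next
  case (Suc k)
  have "Ck_on (Suc 0) (S \<times> J) f" using Suc.prems Ck_on_le[of "Suc k" _ f "Suc 0"] by blast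
  then show ?case
    using Suc.prems
    by (intro Ck_on_SucI[where f'="\<lambda>x v. integral {0..1} (\<lambda>t. fD f (x, t) (v, 0))"]
      has_derivative_parameter_integral[OF assms(1-3)] Suc.IH) (use assms in auto)
qed

lemma Ck_on_bounded_linear_fD: "Ck_on (Suc k) S f \<Longrightarrow> x \<in> S \<Longrightarrow> bounded_linear (fD f x)"
  using Ck_on_Suc_derivative has_derivative_bounded_linear by blast

lemma smooth_onI: "(\<And>k. Ck_on k S f) \<Longrightarrow> smooth_on S f"
  by (simp add: smooth_on_def)

lemma smooth_onD: "smooth_on S f \<Longrightarrow> Ck_on k S f"
  by (simp add: smooth_on_def)

lemma smooth_on_subset: "smooth_on S f \<Longrightarrow> T \<subseteq> S \<Longrightarrow> smooth_on T f"
  unfolding smooth_on_def using Ck_on_subset by blast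

lemma smooth_on_derivative: "smooth_on S f \<Longrightarrow> x \<in> S \<Longrightarrow> (f has_derivative fD f x) (at x)"
  using Ck_on_Suc_derivative smooth_onD by blast

lemma smooth_on_continuous: "smooth_on S f \<Longrightarrow> continuous_on S f"
  using Ck_on_continuous smooth_onD by blast

lemma Ck_on_partial: "Ck_on (Suc k) S f \<Longrightarrow> Ck_on k S (\<lambda>x. fD f x v)"
  by simp

lemma open_nonzero:
  assumes "open S" "continuous_on S f" shows "open {x \<in> S. f x \<noteq> (0::real)}"
proof -
  have "{x \<in> S. f x \<noteq> 0} = S \<inter> f -` (- {0})" by auto
  then show ?thesis using continuous_open_preimage[OF assms(2,1), of "- {0}"] by (simp add: open_Compl)
qed

section \<open>Uniform estimates on compact sets\<close>

lemma norm_Blinfun_diff: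
  assumes "bounded_linear f" "bounded_linear g"
  shows "norm (Blinfun f - Blinfun g) = onorm (f - g)"
  by (simp add: norm_blinfun.rep_eq minus_blinfun.rep_eq bounded_linear_Blinfun_apply assms fun_diff_def)

text \<open>The remainder is bounded by the oscillation of the derivative near \<open>z\<close>.
  Fattening \<open>K\<close> by closed balls inside \<open>S\<close> gives a compact set on which
  the derivative is uniformly continuous, so that one \<open>d\<close> serves all
  \<open>z\<close>.\<close>

lemma C1_uniformly_differentiable:
  fixes f :: "'a::euclidean_space \<Rightarrow> 'b::real_normed_vector"
  assumes S: "open S" and f: "Ck_on (Suc 0) S f" and K: "compact K" "K \<subseteq> S" and "\<eta> > 0"
  shows "\<exists>d>0. \<forall>z\<in>K. \<forall>h. norm h < d \<longrightarrow> z + h \<in> S \<and> norm (f (z + h) - f z - fD f z h) \<le> \<eta> * norm h"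
proof -
  obtain e where e: "e > 0" "(\<Union>x\<in>K. cball x e) \<subseteq> S"
    using compact_subset_open_imp_cball_epsilon_subset[OF K(1) S K(2)] .
  let ?K = "\<Union>x\<in>K. cball x e"
  note bl = Ck_on_bounded_linear_fD[OF f]
  have "uniformly_continuous_on ?K (\<lambda>x. Blinfun (fD f x))"
    by (intro compact_uniformly_continuous compact_minkowski_sum_cball K
      continuous_on_subset[OF Ck_on_1_blinfun_continuous[OF f]] e)
  then obtain d where d: "d > 0" "\<And>x y. x \<in> ?K \<Longrightarrow> y \<in> ?K \<Longrightarrow> dist y x < d \<Longrightarrow>
      dist (Blinfun (fD f y)) (Blinfun (fD f x)) < \<eta>"
    unfolding uniformly_continuous_on_def using \<open>\<eta> > 0\<close> by metis
  show ?thesis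
  proof (intro exI[of _ "min d e"] conjI ballI allI impI)
    fix z h :: 'a assume z: "z \<in> K" and h: "norm h < min d e"
    let ?B = "ball z (min d e)"
    have B: "x \<in> ?K \<and> x \<in> S" if "x \<in> ?B" for x
    proof -
      have "x \<in> ?K" using that z by force
      then show ?thesis using e(2) by blast
    qed
    have "z + h \<in> ?B" using h by (simp add: dist_norm)
    then show "z + h \<in> S" using B by blast
    have zB: "z \<in> ?B" using d e by simp
    have "norm (f (z + h) - f z - fD f z (z + h - z)) \<le> norm (z + h - z) * \<eta>"
    proof (rule differentiable_bound_linearization[where S="?B"])
      fix t :: real assume "t \<in> {0..1}"
      then have "norm (t *\<^sub>R h) \<le> norm h" by (simp add: mult_left_le_one_le)
      then show "z + t *\<^sub>R (z + h - z) \<in> ?B" using h by (simp add: dist_norm)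
    next
      fix x assume "x \<in> ?B"
      then show "(f has_derivative fD f x) (at x within ?B)"
        using B Ck_on_Suc_derivative[OF f] has_derivative_at_withinI by blast
    next
      fix x assume x: "x \<in> ?B"
      have "dist (Blinfun (fD f x)) (Blinfun (fD f z)) < \<eta>"
        using B[OF x] B[OF zB] x by (intro d) (auto simp: dist_commute)
      then show "onorm (fD f x - fD f z) \<le> \<eta>"
        using norm_Blinfun_diff[OF bl bl] B[OF x] B[OF zB] by (simp add: dist_norm)
    qed (rule zB)
    then show "norm (f (z + h) - f z - fD f z h) \<le> \<eta> * norm h" by (simp add: mult.commute)
  qed (use d e in auto)
qed

lemma C1_compact_bound:
  fixes f :: "'a::euclidean_space \<Rightarrow> 'b::real_normed_vector"
  assumes f: "Ck_on (Suc 0) S f" and K: "compact K" "K \<subseteq> S"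
  shows "\<exists>L\<ge>0. \<forall>x\<in>K. \<forall>v. norm (fD f x v) \<le> L * norm v"
proof -
  note bl = Ck_on_bounded_linear_fD[OF f]
  have "compact ((\<lambda>x. Blinfun (fD f x)) ` K)"
    by (intro compact_continuous_image continuous_on_subset[OF Ck_on_1_blinfun_continuous[OF f]] K)
  then have "bounded ((\<lambda>x. Blinfun (fD f x)) ` K)" by (rule compact_imp_bounded)
  then obtain L where L: "L > 0" "\<And>x. x \<in> K \<Longrightarrow> norm (Blinfun (fD f x)) \<le> L"
    unfolding bounded_pos by auto
  have "norm (fD f x v) \<le> L * norm v" if "x \<in> K" for x v
  proof -
    have "norm (fD f x v) = norm (blinfun_apply (Blinfun (fD f x)) v)"
      using bl K that by (simp add: bounded_linear_Blinfun_apply subset_iff)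
    also have "\<dots> \<le> norm (Blinfun (fD f x)) * norm v" by (rule norm_blinfun)
    also have "\<dots> \<le> L * norm v" using L(2)[OF that] by (simp add: mult_right_mono)
    finally show ?thesis .
  qed
  then show ?thesis using L(1) by (intro exI[of _ L]) auto
qed

lemma C1_lipschitz:
  fixes f :: "'a::euclidean_space \<Rightarrow> 'b::real_normed_vector"
  assumes f: "Ck_on (Suc 0) S f" and K: "compact K" "convex K" "K \<subseteq> S"
  shows "\<exists>L\<ge>0. \<forall>x\<in>K. \<forall>y\<in>K. norm (f x - f y) \<le> L * norm (x - y)"
proof -
  obtain L where L: "L \<ge> 0" "\<And>x v. x \<in> K \<Longrightarrow> norm (fD f x v) \<le> L * norm v"
    using C1_compact_bound[OF f K(1,3)] by blast
  have "norm (f x - f y) \<le> L * norm (x - y)" if "x \<in> K" "y \<in> K" for x y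
  proof (rule differentiable_bound[OF K(2) _ _ that])
    fix z assume "z \<in> K"
    then show "(f has_derivative fD f z) (at z within K)"
      using Ck_on_Suc_derivative[OF f] K has_derivative_at_withinI by blast
    show "onorm (fD f z) \<le> L" by (rule onorm_le) (rule L(2)[OF \<open>z \<in> K\<close>])
  qed
  then show ?thesis using L(1) by blast
qed

section \<open>Symmetry of second derivatives\<close>

text \<open>Two applications of the mean value theorem: first to the difference of \<open>f\<close>
  along the two sides parallel to \<open>u\<close>, then to the resulting difference of derivatives
  in direction \<open>v\<close>. The bound on \<open>h\<close> keeps the whole parallelogram inside
  the ball.\<close>

lemma second_difference:
  fixes f :: "'a::euclidean_space \<Rightarrow> real"
  assumes f: "Ck_on (Suc (Suc 0)) (ball x r) f" and h: "0 < h" "h * (norm u + norm v) < r"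
  shows "\<exists>\<xi> \<zeta>. 0 < \<xi> \<and> \<xi> < h \<and> 0 < \<zeta> \<and> \<zeta> < h \<and>
     f (x + h *\<^sub>R u + h *\<^sub>R v) - f (x + h *\<^sub>R u) - f (x + h *\<^sub>R v) + f x
       = h * (h * fD (\<lambda>z. fD f z u) (x + \<xi> *\<^sub>R u + \<zeta> *\<^sub>R v) v)"
proof -
  have inb: "x + s *\<^sub>R u + t *\<^sub>R v \<in> ball x r" if "0 \<le> s" "s \<le> h" "0 \<le> t" "t \<le> h" for s t
  proof -
    have "norm (s *\<^sub>R u + t *\<^sub>R v) \<le> s * norm u + t * norm v"
      using that norm_triangle_ineq[of "s *\<^sub>R u" "t *\<^sub>R v"] by simp
    also have "\<dots> \<le> h * (norm u + norm v)"
      using that by (simp add: distrib_left add_mono mult_right_mono)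
    finally have "norm ((x + s *\<^sub>R u + t *\<^sub>R v) - x) < r" using h by (simp add: add.assoc)
    then show ?thesis by (metis dist_norm dist_commute mem_ball)
  qed
  have f1: "(f has_derivative fD f z) (at z)" if "z \<in> ball x r" for z
    using Ck_on_Suc_derivative[OF f that] .
  have f2: "((\<lambda>z. fD f z u) has_derivative fD (\<lambda>z. fD f z u) z) (at z)" if "z \<in> ball x r" for z
    using f Ck_on_Suc_derivative[of 0 "ball x r" "\<lambda>z. fD f z u"] that by simp
  have lin: "fD f z (c *\<^sub>R w) = c * fD f z w" if "z \<in> ball x r" for z c w
    using has_derivative_bounded_linear[OF f1[OF that]] by (simp add: bounded_linear.linear linear_cmul)
  have lin2: "fD (\<lambda>z. fD f z u) z (c *\<^sub>R w) = c * fD (\<lambda>z. fD f z u) z w" if "z \<in> ball x r" for z c w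
    using has_derivative_bounded_linear[OF f2[OF that]] by (simp add: bounded_linear.linear linear_cmul)
  let ?\<phi> = "\<lambda>s. f (x + s *\<^sub>R u + h *\<^sub>R v) - f (x + s *\<^sub>R u)"
  have d1: "((\<lambda>s. f (x + s *\<^sub>R u + t *\<^sub>R v)) has_real_derivative fD f (x + s *\<^sub>R u + t *\<^sub>R v) u) (at s)"
    if "0 \<le> s" "s \<le> h" "0 \<le> t" "t \<le> h" for s t
  proof -
    have "((\<lambda>s. x + s *\<^sub>R u + t *\<^sub>R v) has_derivative (\<lambda>c. c *\<^sub>R u)) (at s)"
      by (auto intro!: derivative_eq_intros)
    from has_derivative_compose[OF this f1[OF inb[OF that]]]
    show ?thesis using lin[OF inb[OF that]] by (simp add: has_field_derivative_def mult_commute_abs)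
  qed
  have d2: "((\<lambda>t. fD f (x + s *\<^sub>R u + t *\<^sub>R v) u) has_real_derivative
      fD (\<lambda>z. fD f z u) (x + s *\<^sub>R u + t *\<^sub>R v) v) (at t)"
    if "0 \<le> s" "s \<le> h" "0 \<le> t" "t \<le> h" for s t
  proof -
    have "((\<lambda>t. x + s *\<^sub>R u + t *\<^sub>R v) has_derivative (\<lambda>c. c *\<^sub>R v)) (at t)"
      by (auto intro!: derivative_eq_intros)
    from has_derivative_compose[OF this f2[OF inb[OF that]]]
    show ?thesis using lin2[OF inb[OF that]] by (simp add: has_field_derivative_def mult_commute_abs)
  qed
  have "\<exists>\<xi>. 0 < \<xi> \<and> \<xi> < h \<and> ?\<phi> h - ?\<phi> 0 = (h - 0) * (fD f (x + \<xi> *\<^sub>R u + h *\<^sub>R v) u - fD f (x + \<xi> *\<^sub>R u) u)"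
    by (rule MVT2[OF h(1)]) (use d1[of _ h] d1[of _ 0] h in \<open>auto intro!: derivative_intros\<close>)
  then obtain \<xi> where \<xi>: "0 < \<xi>" "\<xi> < h" "?\<phi> h - ?\<phi> 0 = h * (fD f (x + \<xi> *\<^sub>R u + h *\<^sub>R v) u - fD f (x + \<xi> *\<^sub>R u) u)"
    by auto
  have "\<exists>\<zeta>. 0 < \<zeta> \<and> \<zeta> < h \<and> fD f (x + \<xi> *\<^sub>R u + h *\<^sub>R v) u - fD f (x + \<xi> *\<^sub>R u + 0 *\<^sub>R v) u
      = (h - 0) * fD (\<lambda>z. fD f z u) (x + \<xi> *\<^sub>R u + \<zeta> *\<^sub>R v) v"
    by (rule MVT2[OF h(1)]) (use d2 \<xi> in auto)
  then obtain \<zeta> where "0 < \<zeta>" "\<zeta> < h" "fD f (x + \<xi> *\<^sub>R u + h *\<^sub>R v) u - fD f (x + \<xi> *\<^sub>R u) u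
      = h * fD (\<lambda>z. fD f z u) (x + \<xi> *\<^sub>R u + \<zeta> *\<^sub>R v) v" by auto
  then show ?thesis using \<xi> by (intro exI[of _ \<xi>] exI[of _ \<zeta>]) (simp add: algebra_simps)
qed

text \<open>The second difference is symmetric in \<open>u\<close> and \<open>v\<close>, so
  \<open>second_difference\<close> makes the two mixed derivatives equal at two points near
  \<open>x\<close>; continuity brings both points to \<open>x\<close>.\<close>

lemma second_derivative_symmetric:
  fixes f :: "'a::euclidean_space \<Rightarrow> real"
  assumes "open S" and f: "Ck_on (Suc (Suc 0)) S f" and x: "x \<in> S"
  shows "fD (\<lambda>z. fD f z u) x v = fD (\<lambda>z. fD f z v) x u"
proof -
  obtain r where r: "r > 0" "ball x r \<subseteq> S" using assms(1) x openE by blast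
  have fr: "Ck_on (Suc (Suc 0)) (ball x r) f" using Ck_on_subset f r by blast
  let ?A = "\<lambda>z. fD (\<lambda>z. fD f z u) z v" and ?B = "\<lambda>z. fD (\<lambda>z. fD f z v) z u"
  have cA: "isCont ?A x" and cB: "isCont ?B x"
    using fr r by (auto simp: continuous_on_eq_continuous_at)
  have "\<bar>?A x - ?B x\<bar> \<le> \<epsilon>" if eps: "\<epsilon> > 0" for \<epsilon>
  proof -
    obtain d1 where d1: "d1 > 0" "\<And>z. dist z x < d1 \<Longrightarrow> dist (?A z) (?A x) < \<epsilon>/2"
      using cA[unfolded continuous_at_eps_delta, rule_format, OF half_gt_zero[OF eps]] by blast
    obtain d2 where d2: "d2 > 0" "\<And>z. dist z x < d2 \<Longrightarrow> dist (?B z) (?B x) < \<epsilon>/2"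
      using cB[unfolded continuous_at_eps_delta, rule_format, OF half_gt_zero[OF eps]] by blast
    define m where "m = min r (min d1 d2)"
    \<comment> \<open>The summand 1 avoids a division by zero when \<open>u\<close> and
      \<open>v\<close> both vanish.\<close>
    define h where "h = m / (norm u + norm v + 1)"
    have m: "m > 0" using r d1 d2 by (simp add: m_def)
    have h: "h > 0" unfolding h_def using m by (intro divide_pos_pos) (auto intro: add_nonneg_pos)
    have "h * (norm u + norm v) < h * (norm u + norm v + 1)" using h by simp
    also have "\<dots> = m" unfolding h_def by (simp add: add_nonneg_pos less_imp_neq[symmetric])
    finally have hm: "h * (norm u + norm v) < m" .
    then have hr: "h * (norm u + norm v) < r" "h * (norm v + norm u) < r" by (auto simp: m_def add.commute)
    have inb: "dist (x + s *\<^sub>R u + t *\<^sub>R v) x < m" if "0 < s" "s < h" "0 < t" "t < h" for s t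
    proof -
      have "norm (s *\<^sub>R u + t *\<^sub>R v) \<le> s * norm u + t * norm v"
        using that norm_triangle_ineq[of "s *\<^sub>R u" "t *\<^sub>R v"] by simp
      also have "\<dots> \<le> h * (norm u + norm v)"
        using that by (simp add: distrib_left add_mono mult_right_mono)
      finally show ?thesis using hm by (simp add: dist_norm add.assoc)
    qed
    obtain a b where ab: "0 < a" "a < h" "0 < b" "b < h" "f (x + h *\<^sub>R u + h *\<^sub>R v) - f (x + h *\<^sub>R u) - f (x + h *\<^sub>R v) + f x
       = h * (h * ?A (x + a *\<^sub>R u + b *\<^sub>R v))" using second_difference[OF fr h hr(1)] by blast
    obtain c d where cd: "0 < c" "c < h" "0 < d" "d < h" "f (x + h *\<^sub>R v + h *\<^sub>R u) - f (x + h *\<^sub>R v) - f (x + h *\<^sub>R u) + f x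
       = h * (h * ?B (x + c *\<^sub>R v + d *\<^sub>R u))" using second_difference[OF fr h hr(2)] by blast
    have comm: "x + h *\<^sub>R v + h *\<^sub>R u = x + h *\<^sub>R u + h *\<^sub>R v" "x + c *\<^sub>R v + d *\<^sub>R u = x + d *\<^sub>R u + c *\<^sub>R v"
      by (simp_all add: algebra_simps)
    have "h * (h * ?A (x + a *\<^sub>R u + b *\<^sub>R v)) = h * (h * ?B (x + d *\<^sub>R u + c *\<^sub>R v))"
      using ab(5) cd(5) unfolding comm by linarith
    then have eq: "?A (x + a *\<^sub>R u + b *\<^sub>R v) = ?B (x + d *\<^sub>R u + c *\<^sub>R v)" using h by simp
    have "dist (?A (x + a *\<^sub>R u + b *\<^sub>R v)) (?A x) < \<epsilon>/2"
      using inb[OF ab(1-4)] by (intro d1) (simp add: m_def)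
    moreover have "dist (?B (x + d *\<^sub>R u + c *\<^sub>R v)) (?B x) < \<epsilon>/2"
      using inb[OF cd(3,4,1,2)] by (intro d2) (simp add: m_def)
    ultimately show ?thesis using eq unfolding dist_real_def by linarith
  qed
  then have "\<bar>?A x - ?B x\<bar> \<le> 0" using field_le_epsilon[of "\<bar>?A x - ?B x\<bar>" 0] by simp
  then show ?thesis by simp
qed

section \<open>The implicit function theorem for smooth functions\<close>

text \<open>Smoothness is bootstrapped from the formula for the derivative of the implicit function.\<close>

lemma implicit_function_Ck:
  fixes F :: "real \<times> 'a::euclidean_space \<Rightarrow> real"
  assumes S: "open S" and F: "smooth_on S F"
    and W: "open W" and r: "\<And>p. p \<in> W \<Longrightarrow> r differentiable (at p)"
    and in_S: "\<And>p. p \<in> W \<Longrightarrow> (r p, p) \<in> S" and z: "\<And>p. p \<in> W \<Longrightarrow> F (r p, p) = 0"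
    and nz: "\<And>p. p \<in> W \<Longrightarrow> fD F (r p, p) (1, 0) \<noteq> 0"
  shows "Ck_on k W r"
proof (induction k)
  case 0
  show ?case using r by (simp add: continuous_at_imp_continuous_on differentiable_imp_continuous_within)
next
  case (Suc k)
  have dr: "(r has_derivative (\<lambda>v. - (fD F (r p, p) (0, v) / fD F (r p, p) (1, 0)))) (at p)" if "p \<in> W" for p
  proof -
    have 1: "(r has_derivative fD r p) (at p)" using r that frechet_derivative_works by blast
    have 2: "((\<lambda>p. (r p, p)) has_derivative (\<lambda>v. (fD r p v, v))) (at p)"
      by (intro has_derivative_Pair 1 has_derivative_ident)
    have 3: "((\<lambda>p. F (r p, p)) has_derivative (\<lambda>v. fD F (r p, p) (fD r p v, v))) (at p)"
      using has_derivative_compose[OF 2 smooth_on_derivative[OF F in_S[OF that]]] .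
    have 4: "((\<lambda>p. F (r p, p)) has_derivative (\<lambda>v. 0)) (at p)"
      by (rule has_derivative_transform_within_open[OF has_derivative_const[of 0] W that]) (use z in auto)
    have lin: "linear (fD F (r p, p))"
      using smooth_on_derivative[OF F in_S[OF that]] has_derivative_bounded_linear bounded_linear.linear by blast
    have "fD r p v = - (fD F (r p, p) (0, v) / fD F (r p, p) (1, 0))" for v
    proof -
      have "0 = fD F (r p, p) (fD r p v, v)" using has_derivative_unique[OF 3 4] by metis
      also have "(fD r p v, v) = fD r p v *\<^sub>R (1, 0) + (0, v)" by simp
      also have "fD F (r p, p) \<dots> = fD r p v * fD F (r p, p) (1, 0) + fD F (r p, p) (0, v)"
        by (simp only: linear_add[OF lin] linear_cmul[OF lin] real_scaleR_def)
      finally show ?thesis using nz[OF that] by (simp add: field_simps)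
    qed
    then show ?thesis using 1 by presburger
  qed
  have rp: "Ck_on k W (\<lambda>p. (r p, p))" by (intro Ck_on_Pair W Suc Ck_on_id)
  have "Ck_on k W (\<lambda>p. fD F (r p, p) v)" for v
    by (rule Ck_on_compose[OF W S rp Ck_on_partial[OF smooth_onD[OF F]]]) (use in_S in \<open>simp add: image_subset_iff\<close>)
  then show ?case
    by (intro Ck_on_SucI[OF W dr] Ck_on_minus Ck_on_divide W nz)
qed

text \<open>The inverse function theorem is applied to \<open>\<Psi>\<close>, which keeps the
  parameter and replaces the unknown by the value of \<open>F\<close>; the solution is the first
  component of the inverse over the value 0. Restricting to \<open>S1\<close>, where the derivative
  in the unknown is non-zero, makes \<open>implicit_function_Ck\<close> applicable at every point of
  the solution.\<close>

theorem implicit_function_smooth: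
  fixes F :: "real \<times> 'a::euclidean_space \<Rightarrow> real"
  assumes S: "open S" and F: "smooth_on S F" and z0: "(r0, p0) \<in> S" "F (r0, p0) = 0"
    and nz: "fD F (r0, p0) (1, 0) \<noteq> 0"
  shows "\<exists>W r. open W \<and> p0 \<in> W \<and> smooth_on W r \<and> r p0 = r0 \<and>
           (\<forall>p\<in>W. (r p, p) \<in> S \<and> F (r p, p) = 0)"
proof -
  define S1 where "S1 = {z \<in> S. fD F z (1, 0) \<noteq> 0}"
  have "continuous_on S (\<lambda>z. fD F z (1, 0))"
    using Ck_on_partial[OF smooth_onD[OF F]] by (rule Ck_on_continuous)
  then have S1: "open S1" unfolding S1_def by (rule open_nonzero[OF S])
  define \<Psi> where "\<Psi> = (\<lambda>z. (F z, snd z))"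
  define \<Psi>' where "\<Psi>' = (\<lambda>z. Blinfun (\<lambda>v. (fD F z v, snd v)))"
  have \<Psi>k: "Ck_on (Suc 0) S1 \<Psi>" unfolding \<Psi>_def
    by (intro Ck_on_Pair Ck_on_snd Ck_on_id S1 Ck_on_subset[OF smooth_onD[OF F]]) (auto simp: S1_def)
  have dF: "(F has_derivative fD F z) (at z)" if "z \<in> S1" for z
    using smooth_on_derivative[OF F] that by (simp add: S1_def)
  have d: "(\<Psi> has_derivative (\<lambda>v. (fD F z v, snd v))) (at z)" if "z \<in> S1" for z
    unfolding \<Psi>_def by (intro has_derivative_Pair dF that has_derivative_snd has_derivative_ident)
  have app: "blinfun_apply (\<Psi>' z) = (\<lambda>v. (fD F z v, snd v))" if "z \<in> S1" for z
    unfolding \<Psi>'_def using has_derivative_bounded_linear[OF d[OF that]] by (rule bounded_linear_Blinfun_apply)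
  have z0S: "(r0, p0) \<in> S1" using z0 nz by (simp add: S1_def)
  have lin0: "linear (fD F (r0, p0))"
    using has_derivative_bounded_linear[OF dF[OF z0S]] bounded_linear.linear by blast
  let ?c = "fD F (r0, p0) (1, 0)"
  \<comment> \<open>The inverse of the triangular derivative of \<open>\<Psi>\<close> at the base
    point, obtained by solving for the first coordinate.\<close>
  define inv where "inv = (\<lambda>w::real \<times> 'a. ((fst w - fD F (r0, p0) (0, snd w)) / ?c, snd w))"
  have "bounded_linear (\<lambda>v. fD F (r0, p0) (0, v))"
    by (rule bounded_linear_compose[OF has_derivative_bounded_linear[OF dF[OF z0S]]])
      (auto intro!: bounded_linear_Pair bounded_linear_ident bounded_linear_zero)
  then have blinv: "bounded_linear inv" unfolding inv_def
    by (intro bounded_linear_Pair bounded_linear_compose[OF bounded_linear_divide] bounded_linear_sub bounded_linear_fst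
      bounded_linear_snd bounded_linear_compose[OF _ bounded_linear_snd])
  have "inv (fD F (r0, p0) v, snd v) = v" for v
  proof -
    have "v = fst v *\<^sub>R (1, 0) + (0, snd v)" by (cases v) simp
    then have "fD F (r0, p0) v = fD F (r0, p0) (fst v *\<^sub>R (1, 0) + (0, snd v))" by simp
    also have "\<dots> = fst v * ?c + fD F (r0, p0) (0, snd v)"
      by (simp only: linear_add[OF lin0] linear_cmul[OF lin0] real_scaleR_def)
    finally show ?thesis using nz by (simp add: inv_def)
  qed
  then have inv: "Blinfun inv o\<^sub>L \<Psi>' (r0, p0) = id_blinfun"
    by (intro blinfun_eqI) (simp add: app[OF z0S] bounded_linear_Blinfun_apply[OF blinv])
  have cont: "continuous_on S1 \<Psi>'"
  proof (rule continuous_on_eq[OF Ck_on_1_blinfun_continuous[OF \<Psi>k]])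
    fix z assume "z \<in> S1"
    then show "Blinfun (fD \<Psi> z) = \<Psi>' z" using fD_eqI[OF d] by (simp add: \<Psi>'_def)
  qed
  have d': "(\<Psi> has_derivative blinfun_apply (\<Psi>' z)) (at z)" if "z \<in> S1" for z
    using d[OF that] app[OF that] by simp
  obtain U' V g g' where g: "open U'" "U' \<subseteq> S1" "(r0, p0) \<in> U'" "open V" "\<Psi> (r0, p0) \<in> V" "homeomorphism U' V \<Psi> g"
    "\<And>y. y \<in> V \<Longrightarrow> (g has_derivative (g' y)) (at y)"
    using inverse_function_theorem[OF S1 d' cont z0S inv] by metis
  define W where "W = {p. (0, p) \<in> V}"
  define r where "r = (\<lambda>p. fst (g (0, p)))"
  have W: "open W" unfolding W_def
    using open_vimage[OF g(4), of "\<lambda>p. (0, p)"] by (simp add: vimage_def continuous_on_Pair)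
  have gr: "g (0, p) = (r p, p) \<and> (r p, p) \<in> S1 \<and> F (r p, p) = 0" if "p \<in> W" for p
  proof -
    have "\<Psi> (g (0, p)) = (0, p)" and U: "g (0, p) \<in> U'"
      using g(6) that unfolding homeomorphism_def W_def by auto
    then have *: "F (g (0, p)) = 0" "snd (g (0, p)) = p" by (auto simp: \<Psi>_def)
    then have "g (0, p) = (r p, p)" by (simp add: r_def prod_eq_iff)
    then show ?thesis using U g(2) * by auto
  qed
  have p0: "p0 \<in> W" using g(5) z0 by (simp add: W_def \<Psi>_def)
  have "g (\<Psi> (r0, p0)) = (r0, p0)" using g(3,6) by (simp add: homeomorphism_def)
  then have r0: "r p0 = r0" using z0 by (simp add: r_def \<Psi>_def)
  have rd: "r differentiable (at p)" if "p \<in> W" for p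
  proof -
    have "((\<lambda>p. (0::real, p)) has_derivative (\<lambda>v. (0, v))) (at p)" by (auto intro!: derivative_eq_intros)
    from has_derivative_compose[OF this g(7)] that
    have "((\<lambda>p. g (0, p)) has_derivative (\<lambda>v. g' (0, p) (0, v))) (at p)" by (simp add: W_def)
    from has_derivative_fst[OF this] show ?thesis unfolding r_def by (rule differentiableI)
  qed
  have "Ck_on k W r" for k
    by (rule implicit_function_Ck[OF S F W rd]) (use gr S1_def in auto)
  then show ?thesis using W p0 r0 gr by (intro exI[of _ W] exI[of _ r]) (auto simp: smooth_on_def S1_def)
qed

section \<open>Hadamard's lemma and smooth division\<close>

lemma difference_eq_integral:
  fixes f :: "'a::euclidean_space \<Rightarrow> real"
  assumes f: "Ck_on (Suc 0) S f" and seg: "\<And>t. t \<in> {0..1} \<Longrightarrow> p - t *\<^sub>R w \<in> S"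
  shows "f p - f (p - w) = integral {0..1} (\<lambda>t. fD f (p - t *\<^sub>R w) w)"
proof -
  have "((\<lambda>t. f (p - t *\<^sub>R w)) has_vector_derivative (- fD f (p - t *\<^sub>R w) w)) (at t within {0..1})"
    if "t \<in> {0..1}" for t
  proof -
    have "((\<lambda>t. p - t *\<^sub>R w) has_derivative (\<lambda>c. - (c *\<^sub>R w))) (at t within {0..1})"
      by (auto intro!: derivative_eq_intros)
    from has_derivative_compose[OF this Ck_on_Suc_derivative[OF f seg[OF that]]]
    have *: "((\<lambda>t. f (p - t *\<^sub>R w)) has_derivative (\<lambda>c. fD f (p - t *\<^sub>R w) (- (c *\<^sub>R w)))) (at t within {0..1})" .
    have lin: "linear (fD f (p - t *\<^sub>R w))"
      using Ck_on_bounded_linear_fD[OF f seg[OF that]] bounded_linear.linear by blast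
    show ?thesis using * unfolding has_vector_derivative_def
      by (simp add: linear_neg[OF lin] linear_cmul[OF lin])
  qed
  from fundamental_theorem_of_calculus[OF _ this]
  have "((\<lambda>t. - fD f (p - t *\<^sub>R w) w) has_integral (f (p - w) - f p)) {0..1}" by simp
  from has_integral_neg[OF this] show ?thesis by (simp add: integral_unique)
qed

text \<open>The function \<open>r\<close> measures how far one has to move from \<open>p\<close> in the transversal direction \<open>e\<close> to reach
  the hypersurface \<open>b = 0\<close>. By Hadamard's lemma \<open>b\<close>, and \<open>f\<close> where it vanishes at the point
  reached, are smooth multiples of \<open>r\<close>, and the factor of \<open>b\<close> does not vanish.\<close>

theorem smooth_division:
  fixes f b :: "'a::euclidean_space \<Rightarrow> real"
  assumes S: "open S" and f: "smooth_on S f" and b: "smooth_on S b" and p0: "p0 \<in> S" "b p0 = 0"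
    and nz: "fD b p0 e \<noteq> 0"
  shows "\<exists>W r \<tau>. open W \<and> p0 \<in> W \<and> W \<subseteq> S \<and> smooth_on W r \<and> r p0 = 0 \<and> smooth_on W \<tau> \<and>
     (\<forall>p\<in>W. p - r p *\<^sub>R e \<in> S \<and> b (p - r p *\<^sub>R e) = 0 \<and> (f (p - r p *\<^sub>R e) = 0 \<longrightarrow> f p = \<tau> p * b p))"
proof -
  obtain \<rho> where \<rho>: "\<rho> > 0" "ball p0 \<rho> \<subseteq> S" using S p0 openE by blast
  \<comment> \<open>With \<open>Q\<close> the condition that \<open>p - r *\<^sub>R e\<close> lies
    on \<open>b = 0\<close> becomes an implicit equation for the number \<open>r\<close> with
    parameter \<open>p\<close>.\<close>
  define Q where "Q = (\<lambda>z::real \<times> 'a. snd z - fst z *\<^sub>R e)"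
  define S' where "S' = {z. Q z \<in> S}"
  have contQ: "continuous_on UNIV Q" unfolding Q_def by (intro continuous_intros)
  have S': "open S'" unfolding S'_def using open_vimage[OF S contQ] by (simp add: vimage_def)
  have Qk: "Ck_on k S' Q" for k unfolding Q_def by (intro Ck_intros S')
  have B: "smooth_on S' (\<lambda>z. b (Q z))"
    by (intro smooth_onI Ck_on_compose[OF S' S Qk smooth_onD[OF b]]) (auto simp: S'_def)
  have z0: "(0, p0) \<in> S'" using p0 by (simp add: S'_def Q_def)
  have "(Q has_derivative (\<lambda>v. snd v - fst v *\<^sub>R e)) (at (0, p0))"
    unfolding Q_def by (auto intro!: derivative_eq_intros)
  from has_derivative_compose[OF this, of b "fD b p0"]
  have "((\<lambda>z. b (Q z)) has_derivative (\<lambda>v. fD b p0 (snd v - fst v *\<^sub>R e))) (at (0, p0))"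
    using smooth_on_derivative[OF b p0(1)] by (simp add: Q_def)
  then have "fD (\<lambda>z. b (Q z)) (0, p0) = (\<lambda>v. fD b p0 (snd v - fst v *\<^sub>R e))" by (rule fD_eqI)
  moreover have linb: "linear (fD b p0)"
    using smooth_on_derivative[OF b p0(1)] has_derivative_bounded_linear bounded_linear.linear by blast
  ultimately have "fD (\<lambda>z. b (Q z)) (0, p0) (1, 0) \<noteq> 0" using nz by (simp add: linear_neg)
  then obtain W0 r where W0: "open W0" "p0 \<in> W0" "smooth_on W0 r" "r p0 = 0"
    "\<And>p. p \<in> W0 \<Longrightarrow> (r p, p) \<in> S' \<and> b (Q (r p, p)) = 0"
    using implicit_function_smooth[OF S' B z0] p0(2) by (auto simp: Q_def)
  \<comment> \<open>The radii leave room for all \<open>t\<close> in the open interval from -1 to 2: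
    the displacement then stays below \<open>\<rho>/2\<close>, and \<open>p\<close> is within
    \<open>\<rho>/2\<close> of \<open>p0\<close>.\<close>
  define W1 where "W1 = {p \<in> W0 \<inter> ball p0 (\<rho>/2). norm (r p *\<^sub>R e) < \<rho>/4}"
  have cr: "continuous_on W0 r" using W0(3) smooth_on_continuous by blast
  have W1: "open W1"
  proof -
    have "continuous_on (W0 \<inter> ball p0 (\<rho>/2)) (\<lambda>p. norm (r p *\<^sub>R e))"
      by (intro continuous_intros continuous_on_subset[OF cr]) auto
    then have "open ((W0 \<inter> ball p0 (\<rho>/2)) \<inter> (\<lambda>p. norm (r p *\<^sub>R e)) -` {..<\<rho>/4})"
      by (intro continuous_open_preimage) (use W0 in auto)
    then show ?thesis unfolding W1_def by (simp add: vimage_def Int_def)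
  qed
  have p0W1: "p0 \<in> W1" using W0 \<rho> by (simp add: W1_def)
  have seg: "p - t *\<^sub>R r p *\<^sub>R e \<in> S" if "p \<in> W1" "t \<in> {-1<..<2}" for p t
  proof -
    have "norm (t *\<^sub>R r p *\<^sub>R e) \<le> 2 * norm (r p *\<^sub>R e)"
      unfolding norm_scaleR[of t] using that by (intro mult_right_mono) auto
    also have "\<dots> < \<rho>/2" using that by (simp add: W1_def)
    finally have "norm (t *\<^sub>R r p *\<^sub>R e) < \<rho>/2" .
    moreover have "dist p0 p < \<rho>/2" using that by (simp add: W1_def)
    moreover have "dist p0 (p - t *\<^sub>R r p *\<^sub>R e) \<le> dist p0 p + norm (t *\<^sub>R r p *\<^sub>R e)"
      using dist_triangle[of p0 "p - t *\<^sub>R r p *\<^sub>R e" p] by (simp add: dist_norm)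
    ultimately show ?thesis using \<rho>(2) by auto
  qed
  \<comment> \<open>The Hadamard quotient: the increment of \<open>f\<close> from the point on the
    hypersurface to \<open>p\<close>, divided by \<open>r p\<close>. The integral gives it a
    meaning, and smoothness, also where \<open>r p = 0\<close>.\<close>
  define m where "m = (\<lambda>(f::'a \<Rightarrow> real) p. integral {0..1} (\<lambda>t. fD f (p - t *\<^sub>R r p *\<^sub>R e) e))"
  have mk: "Ck_on k W1 (m f)" if "smooth_on S f" for k and f :: "'a \<Rightarrow> real"
  proof -
    let ?J = "{-1<..<2::real}"
    have o: "open (W1 \<times> ?J)" using W1 by (intro open_Times) auto
    have rk: "Ck_on k (W1 \<times> ?J) (\<lambda>z. r (fst z))"
      by (rule Ck_on_compose[OF o W1 Ck_on_fst[OF o Ck_on_id[OF o]] Ck_on_subset[OF smooth_onD[OF W0(3)]]])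
       (auto simp: W1_def)
    have 1: "Ck_on k (W1 \<times> ?J) (\<lambda>z. fst z - snd z *\<^sub>R r (fst z) *\<^sub>R e)"
      by (intro Ck_intros o rk)
    have 2: "(\<lambda>z. fst z - snd z *\<^sub>R r (fst z) *\<^sub>R e) ` (W1 \<times> ?J) \<subseteq> S"
      using seg by (simp add: image_subset_iff)
    have "Ck_on k (W1 \<times> ?J) (\<lambda>z. fD f (fst z - snd z *\<^sub>R r (fst z) *\<^sub>R e) e)"
      by (rule Ck_on_compose[OF o S 1 Ck_on_partial[OF smooth_onD[OF that]] 2])
    then have "Ck_on k W1 (\<lambda>x. integral {0..1} (\<lambda>t. (\<lambda>z. fD f (fst z - snd z *\<^sub>R r (fst z) *\<^sub>R e) e) (x, t)))"
      by (intro Ck_on_parameter_integral[OF W1, of ?J]) auto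
    then show ?thesis by (simp add: m_def)
  qed
  have had: "f p - f (p - r p *\<^sub>R e) = r p * m f p" if "smooth_on S f" "p \<in> W1" for f p
  proof -
    have "f p - f (p - r p *\<^sub>R e) = integral {0..1} (\<lambda>t. fD f (p - t *\<^sub>R r p *\<^sub>R e) (r p *\<^sub>R e))"
      by (rule difference_eq_integral[OF smooth_onD[OF that(1)]]) (use seg that in auto)
    also have "\<dots> = integral {0..1} (\<lambda>t. r p *\<^sub>R fD f (p - t *\<^sub>R r p *\<^sub>R e) e)"
    proof (rule integral_cong)
      fix t :: real assume "t \<in> {0..1}"
      then have "linear (fD f (p - t *\<^sub>R r p *\<^sub>R e))"
        using smooth_on_derivative[OF that(1) seg[OF that(2), of t]] has_derivative_bounded_linear bounded_linear.linear by auto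
      then show "fD f (p - t *\<^sub>R r p *\<^sub>R e) (r p *\<^sub>R e) = r p *\<^sub>R fD f (p - t *\<^sub>R r p *\<^sub>R e) e"
        by (rule linear_cmul)
    qed
    finally show ?thesis unfolding m_def by simp
  qed
  \<comment> \<open>At \<open>p0\<close> the segment degenerates to a point, so the integrand is the
    constant \<open>fD b p0 e\<close>.\<close>
  have mb0: "m b p0 \<noteq> 0" using nz by (simp add: m_def W0)
  define W where "W = {p \<in> W1. m b p \<noteq> 0}"
  have W: "open W"
    unfolding W_def by (rule open_nonzero[OF W1 Ck_on_continuous[OF mk[OF b, of 0]]])
  have "W \<subseteq> W1" by (auto simp: W_def)
  \<comment> \<open>The increments of \<open>f\<close> and \<open>b\<close> share the factor
    \<open>r\<close>, which cancels in the quotient.\<close>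
  define \<tau> where "\<tau> = (\<lambda>p. m f p / m b p)"
  have "smooth_on W \<tau>" unfolding \<tau>_def
    by (intro smooth_onI Ck_on_divide W Ck_on_subset[OF mk \<open>W \<subseteq> W1\<close>] f b) (simp add: W_def)
  moreover have "f p = \<tau> p * b p" if "p \<in> W" "f (p - r p *\<^sub>R e) = 0" for p
  proof -
    have "p \<in> W1" "m b p \<noteq> 0" "b (p - r p *\<^sub>R e) = 0" using that W0(5) by (auto simp: W_def W1_def Q_def)
    then show ?thesis using had[OF f, of p] had[OF b, of p] that by (simp add: \<tau>_def)
  qed
  moreover have "W \<subseteq> S"
  proof
    fix p assume "p \<in> W"
    then show "p \<in> S" using seg[of p 0] \<open>W \<subseteq> W1\<close> by auto
  qed
  moreover have "smooth_on W r" using smooth_on_subset[OF W0(3)] by (auto simp: W_def W1_def)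
  moreover have "p - r p *\<^sub>R e \<in> S \<and> b (p - r p *\<^sub>R e) = 0" if "p \<in> W" for p
    using W0(5)[of p] that by (auto simp: W_def W1_def S'_def Q_def)
  ultimately show ?thesis using W mb0 p0W1 W0(4) by (intro exI[of _ W] exI[of _ r] exI[of _ \<tau>]) (auto simp: W_def)
qed

section \<open>Ordinary differential equations\<close>

lemma has_vector_derivative_continuous_on:
  "(\<And>x. x \<in> S \<Longrightarrow> (f has_vector_derivative f' x) (at x within S)) \<Longrightarrow> continuous_on S f"
  unfolding continuous_on_eq_continuous_within using has_vector_derivative_continuous by blast

text \<open>The integral majorant \<open>v\<close> dominates \<open>norm (u s)\<close> and is
  differentiable even where the norm is not. The integrating factor, together with the term
  \<open>c * s\<close> that absorbs the inhomogeneity, makes \<open>w\<close>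
  non-increasing.\<close>

lemma gronwall_unit:
  fixes u :: "real \<Rightarrow> 'a::real_normed_vector"
  assumes d: "\<And>s. s \<in> {0..1} \<Longrightarrow> (u has_vector_derivative u' s) (at s within {0..1})"
    and b: "\<And>s. s \<in> {0..1} \<Longrightarrow> norm (u' s) \<le> L * norm (u s) + c"
    and L: "0 \<le> L" "0 \<le> c"
  shows "norm (u 1) \<le> (norm (u 0) + c) * exp L"
proof -
  have cu: "continuous_on {0..1} u"
    by (rule has_vector_derivative_continuous_on) (rule d)
  define k where "k = (\<lambda>x. L * norm (u x) + c)"
  define v where "v = (\<lambda>s. norm (u 0) + integral {0..s} k)"
  have ck: "continuous_on {0..1} k" unfolding k_def by (intro continuous_intros cu)
  have dv: "(v has_vector_derivative k s) (at s within {0..1})" if "s \<in> {0..1}" for s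
  proof -
    have "((\<lambda>u. integral {0..u} k) has_vector_derivative k s) (at s within {0..1})"
      by (rule integral_has_vector_derivative[OF ck that])
    then show ?thesis unfolding v_def by (auto intro: derivative_eq_intros)
  qed
  have cv: "continuous_on {0..1} v"
    by (rule has_vector_derivative_continuous_on) (rule dv)
  have uv: "norm (u s) \<le> v s" if "s \<in> {0..1}" for s
  proof (cases "s = 0")
    case False
    then have s: "0 < s" "s \<le> 1" using that by auto
    have "norm (u s - u 0) \<le> v s - v 0"
    proof (rule differentiable_bound_general[OF s(1)])
      fix x assume x: "0 < x" "x < s"
      then have at: "at x within {0..1} = at x" using s by (intro at_within_Icc_at) auto
      show "(u has_vector_derivative u' x) (at x)" "(v has_vector_derivative k x) (at x)"
        using d[of x] dv[of x] x s at by auto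
      show "norm (u' x) \<le> k x" using b[of x] x s by (simp add: k_def)
    qed (use s in \<open>auto intro: continuous_on_subset[OF cu] continuous_on_subset[OF cv]\<close>)
    moreover have "v 0 = norm (u 0)" by (simp add: v_def)
    ultimately show ?thesis using norm_triangle_sub[of "u s" "u 0"] by linarith
  qed (simp add: v_def)
  define w where "w = (\<lambda>s. exp (- L * s) * v s - c * s)"
  have "w 1 \<le> w 0"
  proof (rule DERIV_nonpos_imp_decreasing_open[of 0 1 w])
    fix x :: real assume x: "0 < x" "x < 1"
    then have "(v has_real_derivative k x) (at x)"
      using dv[of x] at_within_Icc_at[of 0 x 1] by (simp add: has_real_derivative_iff_has_vector_derivative)
    then have "(w has_real_derivative (exp (- L * x) * (k x - L * v x) - c)) (at x)"
      unfolding w_def by (auto intro!: derivative_eq_intros simp: algebra_simps)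
    moreover have "exp (- L * x) * (k x - L * v x) - c \<le> 0"
    proof -
      have "L * norm (u x) \<le> L * v x" using uv[of x] x L by (intro mult_left_mono) auto
      then have "k x - L * v x \<le> c" by (simp add: k_def)
      then have "exp (- L * x) * (k x - L * v x) \<le> exp (- L * x) * c" by (intro mult_left_mono) auto
      also have "\<dots> \<le> 1 * c" using L x by (intro mult_right_mono) auto
      finally show ?thesis by simp
    qed
    ultimately show "\<exists>y. (w has_real_derivative y) (at x) \<and> y \<le> 0" by blast
  qed (auto simp: w_def intro!: continuous_intros cv)
  then have "exp (- L) * v 1 \<le> norm (u 0) + c" by (simp add: w_def v_def)
  then have "exp L * (exp (- L) * v 1) \<le> exp L * (norm (u 0) + c)" by (intro mult_left_mono) auto
  then have "v 1 \<le> (norm (u 0) + c) * exp L" by (simp add: mult.assoc[symmetric] mult_exp_exp mult.commute)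
  then show ?thesis using uv[of 1] by simp
qed

lemma has_vector_derivative_affine_segment:
  fixes I :: "real set"
  assumes I: "convex I" and st: "s \<in> I" "t \<in> I" and "\<theta> \<in> {0..1}"
    and d: "(u has_vector_derivative u') (at (s + \<theta> * (t - s)) within I)"
  shows "((\<lambda>\<theta>. u (s + \<theta> * (t - s))) has_vector_derivative (t - s) *\<^sub>R u') (at \<theta> within {0..1})"
proof -
  have img: "(\<lambda>\<theta>. s + \<theta> * (t - s)) ` {0..1} \<subseteq> I"
  proof clarify
    fix \<theta>' :: real assume "\<theta>' \<in> {0..1}"
    then show "s + \<theta>' * (t - s) \<in> I"
      using convexD_alt[OF I st, of \<theta>'] by (simp add: algebra_simps)
  qed
  have "((\<lambda>\<theta>. s + \<theta> * (t - s)) has_vector_derivative (t - s)) (at \<theta> within {0..1})"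
    by (auto intro!: derivative_eq_intros simp: has_vector_derivative_def)
  from vector_diff_chain_within[OF this, of u u'] show ?thesis
    using has_vector_derivative_within_subset[OF d img] by (simp add: o_def)
qed

text \<open>Rescaling the segment from \<open>s\<close> to \<open>t\<close> to the unit interval
  multiplies \<open>L\<close> and \<open>c\<close> by its length. As \<open>t < s\<close> is
  allowed, the same estimate serves backward in time.\<close>

lemma gronwall:
  fixes u :: "real \<Rightarrow> 'a::real_normed_vector"
  assumes I: "convex I" and st: "s \<in> I" "t \<in> I"
    and d: "\<And>x. x \<in> I \<Longrightarrow> (u has_vector_derivative u' x) (at x within I)"
    and b: "\<And>x. x \<in> I \<Longrightarrow> norm (u' x) \<le> L * norm (u x) + c"
    and L: "0 \<le> L" "0 \<le> c"
  shows "norm (u t) \<le> (norm (u s) + c * \<bar>t - s\<bar>) * exp (L * \<bar>t - s\<bar>)"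
proof -
  let ?\<sigma> = "\<lambda>\<theta>. s + \<theta> * (t - s)"
  have inI: "?\<sigma> \<theta> \<in> I" if "\<theta> \<in> {0..1}" for \<theta>
    using convexD_alt[OF I st, of \<theta>] that by (simp add: algebra_simps)
  have "norm (u (?\<sigma> 1)) \<le> (norm (u (?\<sigma> 0)) + c * \<bar>t - s\<bar>) * exp (L * \<bar>t - s\<bar>)"
  proof (rule gronwall_unit)
    fix \<theta> :: real assume \<theta>: "\<theta> \<in> {0..1}"
    show "((\<lambda>\<theta>. u (?\<sigma> \<theta>)) has_vector_derivative (t - s) *\<^sub>R u' (?\<sigma> \<theta>)) (at \<theta> within {0..1})"
      by (rule has_vector_derivative_affine_segment[OF I st \<theta> d[OF inI[OF \<theta>]]])
    have "norm ((t - s) *\<^sub>R u' (?\<sigma> \<theta>)) \<le> \<bar>t - s\<bar> * (L * norm (u (?\<sigma> \<theta>)) + c)"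
      using b[OF inI[OF \<theta>]] by (simp add: mult_left_mono)
    then show "norm ((t - s) *\<^sub>R u' (?\<sigma> \<theta>)) \<le> (L * \<bar>t - s\<bar>) * norm (u (?\<sigma> \<theta>)) + c * \<bar>t - s\<bar>"
      by (simp add: algebra_simps)
  qed (use L in auto)
  then show ?thesis by simp
qed

section \<open>Existence of solutions for Lipschitz right-hand sides\<close>

text \<open>Picard iteration in Bielecki's weighted supremum norm. The unknown is
  \<open>w = Y / E\<close> with an exponential weight \<open>E\<close>, which makes the Picard
  operator a contraction with factor 1/2 on the whole interval, however long it is.\<close>

lemma ode_solution_closed_interval:
  fixes F :: "real \<Rightarrow> 'e::euclidean_space \<Rightarrow> 'e"
  assumes ab: "\<alpha> \<le> 0" "0 \<le> \<beta>"
    and cF: "continuous_on ({\<alpha>..\<beta>} \<times> UNIV) (\<lambda>z. F (fst z) (snd z))"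
    and lip: "\<And>t y y'. t \<in> {\<alpha>..\<beta>} \<Longrightarrow> norm (F t y - F t y') \<le> L * norm (y - y')"
  shows "\<exists>Y. Y 0 = y0 \<and> (\<forall>t\<in>{\<alpha>..\<beta>}. (Y has_vector_derivative F t (Y t)) (at t within {\<alpha>..\<beta>}))"
proof -
  \<comment> \<open>The shift by 1 makes \<open>M\<close> positive whatever \<open>L\<close>
    is.\<close>
  define M where "M = \<bar>L\<bar> + 1"
  have M: "M > 0" "L \<le> M" by (auto simp: M_def)
  define E where "E = (\<lambda>s::real. exp (2 * M * \<bar>s\<bar>))"
  have E: "E s > 0" "E s \<ge> 1" "continuous_on X E" for s X unfolding E_def using M by (auto intro!: continuous_intros)
  define G where "G = (\<lambda>(w::real \<Rightarrow>\<^sub>C 'e) s. F s (E s *\<^sub>R w s))"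
  have cG: "continuous_on {\<alpha>..\<beta>} (G w)" for w
  proof -
    have "continuous_on {\<alpha>..\<beta>} (\<lambda>s. (s, E s *\<^sub>R w s))"
      by (intro continuous_intros E continuous_on_apply_bcontfun)
    from continuous_on_compose2[OF cF this] show ?thesis by (simp add: G_def image_subset_iff)
  qed
  define Pc where "Pc = (\<lambda>w t. y0 + (integral {\<alpha>..t} (G w) - integral {\<alpha>..0} (G w)))"
  have dP: "(Pc w has_vector_derivative G w t) (at t within {\<alpha>..\<beta>})" if "t \<in> {\<alpha>..\<beta>}" for w t
  proof -
    have "((\<lambda>u. integral {\<alpha>..u} (G w)) has_vector_derivative G w t) (at t within {\<alpha>..\<beta>})"
      by (rule integral_has_vector_derivative[OF cG that])
    then show ?thesis unfolding Pc_def by (auto intro!: derivative_eq_intros)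
  qed
  have cP: "continuous_on {\<alpha>..\<beta>} (Pc w)" for w
    by (rule has_vector_derivative_continuous_on) (rule dP)
  have P0: "Pc w 0 = y0" for w by (simp add: Pc_def)
  \<comment> \<open>Bounded continuous functions live on the whole line, so the new iterate is
    extended beyond the endpoints as a constant by means of \<open>clamp\<close>.\<close>
  have "\<exists>g::real \<Rightarrow>\<^sub>C 'e. \<forall>t. g t = inverse (E (clamp \<alpha> \<beta> t)) *\<^sub>R Pc w (clamp \<alpha> \<beta> t)" for w
  proof -
    have "continuous_on (cbox \<alpha> \<beta>) (\<lambda>t. inverse (E t) *\<^sub>R Pc w t)"
      using E(1) by (auto intro!: continuous_intros E cP simp: less_imp_neq[symmetric])
    from continuous_on_cbox_bcontfunE[OF this] show ?thesis by metis
  qed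
  then obtain T :: "(real \<Rightarrow>\<^sub>C 'e) \<Rightarrow> (real \<Rightarrow>\<^sub>C 'e)" where
    T: "\<And>w t. T w t = inverse (E (clamp \<alpha> \<beta> t)) *\<^sub>R Pc w (clamp \<alpha> \<beta> t)" by metis
  \<comment> \<open>The derivative of the difference is at most \<open>dist w w' * M * E s\<close>,
    which integrates between 0 and \<open>t\<close> to \<open>dist w w' * (E t - 1) / 2\<close>. The
    two signs of \<open>t\<close> are separated because \<open>E\<close> has a corner at 0.\<close>
  have key: "norm (Pc w t - Pc w' t) \<le> dist w w' * E t / 2" if t: "t \<in> {\<alpha>..\<beta>}" for w w' t
  proof -
    let ?D = "\<lambda>t. Pc w t - Pc w' t" and ?D' = "\<lambda>s. G w s - G w' s" and ?d = "dist w w'"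
    have dD: "(?D has_vector_derivative ?D' s) (at s within {\<alpha>..\<beta>})" if "s \<in> {\<alpha>..\<beta>}" for s
      by (intro derivative_intros dP that)
    have cD: "continuous_on {\<alpha>..\<beta>} ?D" by (intro continuous_intros cP)
    have bD: "norm (?D' s) \<le> ?d * M * E s" if "s \<in> {\<alpha>..\<beta>}" for s
    proof -
      have "norm (?D' s) \<le> L * norm (E s *\<^sub>R w s - E s *\<^sub>R w' s)" unfolding G_def by (rule lip[OF that])
      also have "\<dots> = L * (E s * dist (w s) (w' s))"
        using E(1)[of s] by (simp add: scaleR_diff_right[symmetric] dist_norm)
      also have "\<dots> \<le> M * (E s * ?d)"
        using M E(1)[of s] dist_bounded[of w s w'] by (intro mult_mono) auto
      finally show ?thesis by (simp add: mult.commute mult.left_commute)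
    qed
    consider "t = 0" | "t > 0" | "t < 0" by linarith
    then show ?thesis
    proof cases
      case 1 then show ?thesis using P0 E(1)[of t] by simp
    next
      case 2
      have "norm (?D t - ?D 0) \<le> ?d * exp (2 * M * t) / 2 - ?d * exp (2 * M * 0) / 2"
      proof (rule differentiable_bound_general[OF 2])
        fix s assume s: "0 < s" "s < t"
        then have "at s within {\<alpha>..\<beta>} = at s" using t ab by (intro at_within_Icc_at) auto
        then show "(?D has_vector_derivative ?D' s) (at s)" using dD[of s] s t ab by auto
        show "((\<lambda>s. ?d * exp (2 * M * s) / 2) has_vector_derivative ?d * M * exp (2 * M * s)) (at s)"
          unfolding has_real_derivative_iff_has_vector_derivative[symmetric]
          by (auto intro!: derivative_eq_intros)
        show "norm (?D' s) \<le> ?d * M * exp (2 * M * s)" using bD[of s] s t ab by (simp add: E_def)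
      qed (use t ab in \<open>auto intro!: continuous_intros continuous_on_subset[OF cD]\<close>)
      moreover have "E t = exp (2 * M * t)" using 2 by (simp add: E_def)
      ultimately have "norm (Pc w t - Pc w' t) \<le> ?d * E t / 2 - ?d / 2" using P0[of w] P0[of w'] by simp
      then show ?thesis using zero_le_dist[of w w'] by linarith
    next
      case 3
      have "norm (?D 0 - ?D t) \<le> - ?d * exp (- 2 * M * 0) / 2 - (- ?d * exp (- 2 * M * t) / 2)"
      proof (rule differentiable_bound_general[OF 3])
        fix s assume s: "t < s" "s < 0"
        then have "at s within {\<alpha>..\<beta>} = at s" using t ab by (intro at_within_Icc_at) auto
        then show "(?D has_vector_derivative ?D' s) (at s)" using dD[of s] s t ab by auto
        show "((\<lambda>s. - ?d * exp (- 2 * M * s) / 2) has_vector_derivative ?d * M * exp (- 2 * M * s)) (at s)"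
          unfolding has_real_derivative_iff_has_vector_derivative[symmetric]
          by (auto intro!: derivative_eq_intros)
        show "norm (?D' s) \<le> ?d * M * exp (- 2 * M * s)" using bD[of s] s t ab by (simp add: E_def)
      qed (use t ab in \<open>auto intro!: continuous_intros continuous_on_subset[OF cD]\<close>)
      moreover have "E t = exp (- 2 * M * t)" using 3 by (simp add: E_def)
      ultimately have "norm (Pc w t - Pc w' t) \<le> ?d * E t / 2 - ?d / 2"
        using P0[of w] P0[of w'] by (simp add: norm_minus_commute)
      then show ?thesis using zero_le_dist[of w w'] by linarith
    qed
  qed
  have cl: "clamp \<alpha> \<beta> t \<in> {\<alpha>..\<beta>}" for t using clamp_in_interval[of \<alpha> \<beta> t] ab by simp
  have "dist (T w) (T w') \<le> 1/2 * dist w w'" for w w'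
  proof (rule dist_bound)
    fix t
    let ?c = "clamp \<alpha> \<beta> t"
    have "dist (T w t) (T w' t) = inverse (E ?c) * norm (Pc w ?c - Pc w' ?c)"
      using E(1)[of ?c] by (simp add: T dist_norm scaleR_diff_right[symmetric])
    also have "\<dots> \<le> inverse (E ?c) * (dist w w' * E ?c / 2)"
      using E(1)[of ?c] by (intro mult_left_mono key cl) auto
    also have "\<dots> = 1/2 * dist w w'" using E(1)[of ?c] by simp
    finally show "dist (T w t) (T w' t) \<le> 1/2 * dist w w'" .
  qed
  then obtain w where w: "T w = w" using banach_fix_type[of "1/2" T] by auto
  define Y where "Y = (\<lambda>t. E t *\<^sub>R w t)"
  have YP: "Y t = Pc w t" if "t \<in> {\<alpha>..\<beta>}" for t
  proof -
    have "clamp \<alpha> \<beta> t = t" using that by (intro clamp_cancel_cbox) auto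
    then have "w t = inverse (E t) *\<^sub>R Pc w t" using T[of w t] w by simp
    then show ?thesis using E(1)[of t] by (simp add: Y_def)
  qed
  have "(Y has_vector_derivative F t (Y t)) (at t within {\<alpha>..\<beta>})" if t: "t \<in> {\<alpha>..\<beta>}" for t
  proof -
    have "(Pc w has_vector_derivative F t (Y t)) (at t within {\<alpha>..\<beta>})"
      using dP[OF t, of w] by (simp add: G_def Y_def)
    then show ?thesis by (rule has_vector_derivative_transform[rotated 2]) (use t YP in auto)
  qed
  moreover have "Y 0 = y0" using YP[of 0] P0 ab by simp
  ultimately show ?thesis by blast
qed

text \<open>Solutions on the intervals \<open>{-b..b}\<close> agree by Gronwall's inequality and are
  glued. The Lipschitz constant may blow up as \<open>b\<close> approaches \<open>a\<close>, hence
  the detour through compact intervals.\<close>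

lemma ode_solution_open_interval:
  fixes F :: "real \<Rightarrow> 'e::euclidean_space \<Rightarrow> 'e"
  assumes a: "0 < a"
    and cF: "continuous_on ({-a<..<a} \<times> UNIV) (\<lambda>z. F (fst z) (snd z))"
    and lip: "\<And>b. 0 < b \<Longrightarrow> b < a \<Longrightarrow> \<exists>L\<ge>0. \<forall>t\<in>{-b..b}. \<forall>y y'. norm (F t y - F t y') \<le> L * norm (y - y')"
  shows "\<exists>Y. Y 0 = y0 \<and> (\<forall>t\<in>{-a<..<a}. (Y has_vector_derivative F t (Y t)) (at t))"
proof -
  have "\<exists>Y. Y 0 = y0 \<and> (\<forall>t\<in>{-b..b}. (Y has_vector_derivative F t (Y t)) (at t within {-b..b}))"
    if b: "0 < b" "b < a" for b
  proof -
    obtain L where L: "\<And>t y y'. t \<in> {-b..b} \<Longrightarrow> norm (F t y - F t y') \<le> L * norm (y - y')"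
      using lip[OF b] by blast
    have "continuous_on ({-b..b} \<times> UNIV) (\<lambda>z. F (fst z) (snd z))"
      by (rule continuous_on_subset[OF cF]) (use b in auto)
    from ode_solution_closed_interval[OF _ _ this L] b show ?thesis by auto
  qed
  then obtain Z where Z: "\<And>b. 0 < b \<Longrightarrow> b < a \<Longrightarrow> Z b 0 = y0"
    "\<And>b t. 0 < b \<Longrightarrow> b < a \<Longrightarrow> t \<in> {-b..b} \<Longrightarrow> (Z b has_vector_derivative F t (Z b t)) (at t within {-b..b})"
    by metis
  have uniq: "Z b t = Z b' t" if b: "0 < b" "b \<le> b'" "b' < a" "t \<in> {-b..b}" for b b' t
  proof -
    have ba: "b < a" "0 < b'" using b by auto
    obtain L where L: "L \<ge> 0" "\<And>t y y'. t \<in> {-b..b} \<Longrightarrow> norm (F t y - F t y') \<le> L * norm (y - y')"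
      using lip[OF b(1) ba(1)] by blast
    have sub: "{-b..b} \<subseteq> {-b'..b'}" using b by auto
    have "norm (Z b t - Z b' t) \<le> (norm (Z b 0 - Z b' 0) + 0 * \<bar>t - 0\<bar>) * exp (L * \<bar>t - 0\<bar>)"
    proof (rule gronwall[of "{-b..b}"])
      fix x assume x: "x \<in> {-b..b}"
      have "(Z b' has_vector_derivative F x (Z b' x)) (at x within {-b..b})"
        by (rule has_vector_derivative_within_subset[OF Z(2) sub]) (use b x in auto)
      then show "((\<lambda>x. Z b x - Z b' x) has_vector_derivative F x (Z b x) - F x (Z b' x)) (at x within {-b..b})"
        by (intro derivative_intros Z(2) b x ba)
      show "norm (F x (Z b x) - F x (Z b' x)) \<le> L * norm (Z b x - Z b' x) + 0" using L(2)[OF x] by simp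
    qed (use b L in auto)
    then show ?thesis using Z(1)[OF b(1) ba(1)] Z(1)[OF ba(2) b(3)] by simp
  qed
  \<comment> \<open>The interval used at time \<open>t\<close> reaches halfway from
    \<open>\<bar>t\<bar>\<close> to \<open>a\<close>, so it contains \<open>t\<close> in its
    interior.\<close>
  define Y where "Y = (\<lambda>t. Z ((\<bar>t\<bar> + a) / 2) t)"
  have YZ: "Y t = Z b t" if "0 < b" "b < a" "t \<in> {-b..b}" for b t
  proof -
    define c where "c = (\<bar>t\<bar> + a) / 2"
    have c: "0 < c" "c < a" "t \<in> {-c..c}"
      using that a unfolding c_def by (auto simp: field_simps abs_if)
    show ?thesis
    proof (cases "b \<le> c")
      case True then show ?thesis using uniq[of b c t] that c by (simp add: Y_def c_def)
    next
      case False then show ?thesis using uniq[of c b t] that c by (simp add: Y_def c_def)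
    qed
  qed
  have "(Y has_vector_derivative F t (Y t)) (at t)" if t: "t \<in> {-a<..<a}" for t
  proof -
    define b where "b = (\<bar>t\<bar> + a) / 2"
    have b: "0 < b" "b < a" "t \<in> {-b<..<b}" using t a unfolding b_def by (auto simp: field_simps abs_if)
    have "at t within {-b..b} = at t" using b by (intro at_within_Icc_at) auto
    then have "(Z b has_vector_derivative F t (Y t)) (at t)" using Z(2)[OF b(1,2), of t] YZ[of b t] b by simp
    then show ?thesis
      by (rule has_vector_derivative_transform_within_open[of _ _ _ "{-b<..<b}"])
        (use b YZ[of b] in auto)
  qed
  moreover have "Y 0 = y0" using YZ[of "a/2" 0] Z(1)[of "a/2"] a by simp
  ultimately show ?thesis by blast
qed

section \<open>Smooth dependence on parameters\<close>

text \<open>The Lipschitz condition is global in the state, whereas \<open>f\<close> will be smooth only near the graph of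
  the solution. This covers both fields that are truncated outside a ball and linear variational
  equations.\<close>

definition lipschitz_state :: "(real \<times> 'p::euclidean_space) set \<Rightarrow> ((real \<times> 'p) \<times> 'e::euclidean_space \<Rightarrow> 'e) \<Rightarrow> bool" where
  "lipschitz_state D f \<longleftrightarrow> (\<forall>C. compact C \<and> C \<subseteq> D \<longrightarrow>
     (\<exists>L\<ge>0. \<forall>q\<in>C. \<forall>y y'. norm (f (q, y) - f (q, y')) \<le> L * norm (y - y')))"

text \<open>The initial value is 0 for every parameter: for a flow the unknown will be the
  displacement from the initial point. Then the derivative in a parameter direction starts at 0 too,
  and the variational equation is a problem of the same kind.\<close>

definition solves :: "real \<Rightarrow> 'p::euclidean_space set \<Rightarrow> ((real \<times> 'p) \<times> 'e::euclidean_space \<Rightarrow> 'e) \<Rightarrow> (real \<times> 'p \<Rightarrow> 'e) \<Rightarrow> bool" where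
  "solves a W f Y \<longleftrightarrow> (\<forall>p\<in>W. Y (0, p) = 0 \<and>
     (\<forall>t\<in>{-a<..<a}. ((\<lambda>t. Y (t, p)) has_vector_derivative f ((t, p), Y (t, p))) (at t)))"

lemma solvesD:
  assumes "solves a W f Y" "p \<in> W"
  shows "Y (0, p) = 0"
    and "t \<in> {-a<..<a} \<Longrightarrow> ((\<lambda>t. Y (t, p)) has_vector_derivative f ((t, p), Y (t, p))) (at t within X)"
  using assms unfolding solves_def by (blast intro: has_vector_derivative_at_within)+

lemma solves_continuous_time: "solves a W f Y \<Longrightarrow> p \<in> W \<Longrightarrow> continuous_on {-a<..<a} (\<lambda>t. Y (t, p))"
  by (rule has_vector_derivative_continuous_on) (rule solvesD)

text \<open>Gronwall's inequality against the reference solution at \<open>p0\<close>. Replacing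
  \<open>p\<close> by \<open>p0\<close> in the equation at the reference state costs at most
  \<open>\<eta>\<close>, uniformly in time by compactness.\<close>

lemma solves_uniform:
  assumes W: "open W" and cf: "continuous_on (({-a<..<a} \<times> W) \<times> UNIV) f"
    and lip: "lipschitz_state ({-a<..<a} \<times> W) f" and Y: "solves a W f Y"
    and p0: "p0 \<in> W" and b: "0 \<le> b" "b < a" and eps: "\<epsilon> > 0"
  shows "\<exists>d>0. \<forall>p. dist p p0 < d \<longrightarrow> p \<in> W \<and> (\<forall>t\<in>{-b..b}. norm (Y (t, p) - Y (t, p0)) \<le> \<epsilon>)"
proof -
  obtain r where r: "r > 0" "cball p0 r \<subseteq> W" using W p0 open_contains_cball by blast
  let ?C = "{-b..b} \<times> cball p0 r"
  have C: "compact ?C" "?C \<subseteq> {-a<..<a} \<times> W" using r b by (auto intro!: compact_Times)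
  then obtain L where L: "L \<ge> 0" "\<And>q y y'. q \<in> ?C \<Longrightarrow> norm (f (q, y) - f (q, y')) \<le> L * norm (y - y')"
    using lip unfolding lipschitz_state_def by meson
  define g where "g = (\<lambda>q. f (q, Y (fst q, p0)))"
  have "continuous_on ?C (\<lambda>q. (q, Y (fst q, p0)))"
    by (intro continuous_intros continuous_on_compose2[OF solves_continuous_time[OF Y p0]])
      (use b in auto)
  then have "continuous_on ?C g" unfolding g_def
    by (rule continuous_on_compose2[OF cf]) (use C in auto)
  then have "uniformly_continuous_on ?C g" using C(1) by (rule compact_uniformly_continuous)
  \<comment> \<open>Chosen so that the Gronwall bound \<open>\<eta> * (b + 1) * exp (L * b)\<close>
    equals \<open>\<epsilon>\<close>; \<open>b + 1\<close> in place of \<open>b\<close> admits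
    \<open>b = 0\<close>.\<close>
  moreover define \<eta> where "\<eta> = \<epsilon> / ((b + 1) * exp (L * b))"
  have \<eta>: "\<eta> > 0" unfolding \<eta>_def using b eps by (intro divide_pos_pos mult_pos_pos) auto
  ultimately obtain d where d: "d > 0" "\<And>q q'. q \<in> ?C \<Longrightarrow> q' \<in> ?C \<Longrightarrow> dist q' q < d \<Longrightarrow> dist (g q') (g q) < \<eta>"
    unfolding uniformly_continuous_on_def by metis
  show ?thesis
  proof (intro exI[of _ "min d r"] conjI allI impI)
    fix p assume p: "dist p p0 < min d r"
    then have pr: "p \<in> cball p0 r" by (simp add: dist_commute)
    then show pW: "p \<in> W" using r by blast
    show "\<forall>t\<in>{-b..b}. norm (Y (t, p) - Y (t, p0)) \<le> \<epsilon>"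
    proof
      fix t assume t: "t \<in> {-b..b}"
      have "norm (Y (t, p) - Y (t, p0)) \<le> (norm (Y (0, p) - Y (0, p0)) + \<eta> * \<bar>t - 0\<bar>) * exp (L * \<bar>t - 0\<bar>)"
      proof (rule gronwall[of "{-b..b}"])
        fix s assume s: "s \<in> {-b..b}"
        then have sa: "s \<in> {-a<..<a}" using b by auto
        show "((\<lambda>s. Y (s, p) - Y (s, p0)) has_vector_derivative f ((s, p), Y (s, p)) - f ((s, p0), Y (s, p0))) (at s within {-b..b})"
          by (intro has_vector_derivative_diff solvesD(2)[OF Y] pW p0 sa)
        have 1: "norm (f ((s, p), Y (s, p)) - f ((s, p), Y (s, p0))) \<le> L * norm (Y (s, p) - Y (s, p0))"
          using s pr by (intro L) auto
        have "dist (g (s, p)) (g (s, p0)) < \<eta>" using s pr p r by (intro d) (auto simp: dist_Pair_Pair)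
        then have 2: "norm (f ((s, p), Y (s, p0)) - f ((s, p0), Y (s, p0))) \<le> \<eta>" by (simp add: g_def dist_norm)
        show "norm (f ((s, p), Y (s, p)) - f ((s, p0), Y (s, p0))) \<le> L * norm (Y (s, p) - Y (s, p0)) + \<eta>"
          using norm_triangle_ineq[of "f ((s, p), Y (s, p)) - f ((s, p), Y (s, p0))" "f ((s, p), Y (s, p0)) - f ((s, p0), Y (s, p0))"] 1 2
          by simp
      qed (use b t L \<eta> in auto)
      also have "\<dots> \<le> (\<eta> * (b + 1)) * exp (L * b)"
        using \<eta> t b L by (intro mult_mono) (auto simp: solvesD(1)[OF Y] pW p0 intro!: mult_left_mono)
      also have "\<dots> = \<epsilon>" using b by (simp add: \<eta>_def)
      finally show "norm (Y (t, p) - Y (t, p0)) \<le> \<epsilon>" .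
    qed
  qed (use d r in auto)
qed

lemma solves_continuous:
  assumes W: "open W" and cf: "continuous_on (({-a<..<a} \<times> W) \<times> UNIV) f"
    and lip: "lipschitz_state ({-a<..<a} \<times> W) f" and Y: "solves a W f Y"
  shows "continuous_on ({-a<..<a} \<times> W) Y"
proof (rule continuous_at_imp_continuous_on, clarify)
  fix t0 p0 assume t0: "t0 \<in> {-a<..<a}" and p0: "p0 \<in> W"
  define b where "b = (\<bar>t0\<bar> + a) / 2"
  have b: "0 \<le> b" "b < a" "\<bar>t0\<bar> < b" using t0 unfolding b_def by (auto simp: field_simps abs_if)
  show "isCont Y (t0, p0)" unfolding continuous_at_eps_delta
  proof (intro allI impI)
    fix e :: real assume e: "e > 0"
    obtain d1 where d1: "d1 > 0" "\<And>p t. dist p p0 < d1 \<Longrightarrow> t \<in> {-b..b} \<Longrightarrow> norm (Y (t, p) - Y (t, p0)) \<le> e/3"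
      using solves_uniform[OF W cf lip Y p0 b(1,2), of "e/3"] e by auto
    have "isCont (\<lambda>t. Y (t, p0)) t0"
      using solves_continuous_time[OF Y p0] t0 by (simp add: continuous_on_eq_continuous_at)
    then obtain d2 where d2: "d2 > 0" "\<And>t. dist t t0 < d2 \<Longrightarrow> dist (Y (t, p0)) (Y (t0, p0)) < e/3"
      using e unfolding continuous_at_eps_delta by (metis divide_pos_pos zero_less_numeral)
    show "\<exists>d>0. \<forall>x'. dist x' (t0, p0) < d \<longrightarrow> dist (Y x') (Y (t0, p0)) < e"
    proof (intro exI[of _ "min d1 (min d2 (b - \<bar>t0\<bar>))"] conjI allI impI)
      fix q assume q: "dist q (t0, p0) < min d1 (min d2 (b - \<bar>t0\<bar>))"
      obtain t p where [simp]: "q = (t, p)" by fastforce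
      have t: "dist t t0 < min d1 (min d2 (b - \<bar>t0\<bar>))" and p: "dist p p0 < min d1 (min d2 (b - \<bar>t0\<bar>))"
        using q dist_fst_le[of q "(t0, p0)"] dist_snd_le[of q "(t0, p0)"] by auto
      have "t \<in> {-b..b}" using t by (auto simp: dist_real_def)
      then have "norm (Y (t, p) - Y (t, p0)) \<le> e/3" using d1(2) p by auto
      moreover have "dist (Y (t, p0)) (Y (t0, p0)) < e/3" using d2(2) t by auto
      ultimately show "dist (Y q) (Y (t0, p0)) < e"
        using dist_triangle[of "Y (t, p)" "Y (t0, p0)" "Y (t, p0)"] e by (simp add: dist_norm)
    qed (use d1 d2 b in auto)
  qed
qed

text \<open>\<open>Z v\<close> solves the equation linearised along the solution at
  \<open>p\<close>, for one \<open>v\<close> at a time; linearity in \<open>v\<close> follows from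
  uniqueness. The error \<open>Y (s, p') - Y (s, p) - Z v s\<close> starts at 0 and obeys a linear
  differential inequality whose inhomogeneity is small compared with \<open>norm v\<close>, so
  Gronwall's inequality makes the error small compared with \<open>norm v\<close>.\<close>

lemma solves_has_derivative_parameter:
  fixes f :: "(real \<times> 'p::euclidean_space) \<times> 'e::euclidean_space \<Rightarrow> 'e"
  assumes W: "open W" and cf: "continuous_on (({-a<..<a} \<times> W) \<times> UNIV) f"
    and lip: "lipschitz_state ({-a<..<a} \<times> W) f" and Y: "solves a W f Y"
    and Q: "open Q" "Ck_on (Suc 0) Q f" "\<And>q. q \<in> {-a<..<a} \<times> W \<Longrightarrow> (q, Y q) \<in> Q"
    and p: "p \<in> W" and t: "t \<in> {-a<..<a}"
    and Z0: "\<And>v. Z v 0 = 0"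
    and Z: "\<And>v s. s \<in> {-a<..<a} \<Longrightarrow>
      (Z v has_vector_derivative fD f ((s, p), Y (s, p)) ((0, v), Z v s)) (at s)"
  shows "((\<lambda>p. Y (t, p)) has_derivative (\<lambda>v. Z v t)) (at p)"
proof -
  define b where "b = \<bar>t\<bar>"
  have b: "0 \<le> b" "b < a" using t by (auto simp: b_def)
  let ?I = "{-b..b}"
  have Ia: "s \<in> {-a<..<a}" if "s \<in> ?I" for s using that b by auto
  define z where "z = (\<lambda>s. ((s, p), Y (s, p)))"
  have zQ: "z s \<in> Q" if "s \<in> ?I" for s using Q(3) Ia[OF that] p by (auto simp: z_def)
  have "continuous_on ?I z" unfolding z_def
    by (intro continuous_intros continuous_on_subset[OF solves_continuous_time[OF Y p]]) (use Ia in auto)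
  then have K: "compact (z ` ?I)" by (intro compact_continuous_image) auto
  have KQ: "z ` ?I \<subseteq> Q" using zQ by auto
  obtain B where B: "B \<ge> 0" "\<And>s h. s \<in> ?I \<Longrightarrow> norm (fD f (z s) h) \<le> B * norm h"
    using C1_compact_bound[OF Q(2) K KQ] by auto
  have lin: "linear (fD f (z s))" if "s \<in> ?I" for s
    using Ck_on_bounded_linear_fD[OF Q(2) zQ[OF that]] bounded_linear.linear by blast
  have Z': "(Z v has_vector_derivative fD f (z s) ((0, v), Z v s)) (at s within ?I)" if "s \<in> ?I" for v s
    using Z[OF Ia[OF that], of v] by (simp add: z_def has_vector_derivative_at_within)
  have zI: "0 \<in> ?I" "t \<in> ?I" "convex ?I" using b by (auto simp: b_def)
  have pair_le: "norm ((0::real, v), w) \<le> norm v + norm w" for v :: 'p and w :: 'e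
    using norm_Pair_le[of "(0::real, v)" w] norm_Pair_le[of "0::real" v] by simp
  \<comment> \<open>The Gronwall constant bounding \<open>Z v s\<close> in terms of
    \<open>norm v\<close>.\<close>
  define Cz where "Cz = B * b * exp (B * b)"
  have Cz: "Cz \<ge> 0" using B b by (simp add: Cz_def)
  have Zb: "norm (Z v s) \<le> Cz * norm v" if s: "s \<in> ?I" for v s
  proof -
    have "norm (Z v s) \<le> (norm (Z v 0) + (B * norm v) * \<bar>s - 0\<bar>) * exp (B * \<bar>s - 0\<bar>)"
    proof (rule gronwall[OF zI(3,1) s Z'])
      fix x assume x: "x \<in> ?I"
      have "norm (fD f (z x) ((0, v), Z v x)) \<le> B * norm ((0::real, v), Z v x)" by (rule B(2)[OF x])
      also have "\<dots> \<le> B * (norm v + norm (Z v x))" by (intro mult_left_mono pair_le B)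
      finally show "norm (fD f (z x) ((0, v), Z v x)) \<le> B * norm (Z v x) + B * norm v" by (simp add: algebra_simps)
    qed (use B in auto)
    also have "\<dots> \<le> (B * norm v * b) * exp (B * b)"
      using s B Z0 by (intro mult_mono) (auto intro!: mult_left_mono)
    finally show ?thesis by (simp add: Cz_def mult_ac)
  qed
  have Zlin: "linear (\<lambda>v. Z v t)"
  proof (rule linearI)
    fix v v'
    have "norm (Z (v + v') t - Z v t - Z v' t) \<le> (norm (Z (v + v') 0 - Z v 0 - Z v' 0) + 0 * \<bar>t - 0\<bar>) * exp (B * \<bar>t - 0\<bar>)"
    proof (rule gronwall[OF zI(3,1,2)])
      fix x assume x: "x \<in> ?I"
      show "((\<lambda>s. Z (v + v') s - Z v s - Z v' s) has_vector_derivative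
          fD f (z x) ((0, v + v'), Z (v + v') x) - fD f (z x) ((0, v), Z v x) - fD f (z x) ((0, v'), Z v' x)) (at x within ?I)"
        by (intro has_vector_derivative_diff Z' x)
      have "fD f (z x) ((0, v + v'), Z (v + v') x) - fD f (z x) ((0, v), Z v x) - fD f (z x) ((0, v'), Z v' x) =
          fD f (z x) (0, Z (v + v') x - Z v x - Z v' x)"
        by (simp add: linear_diff[OF lin[OF x], symmetric])
      then show "norm (fD f (z x) ((0, v + v'), Z (v + v') x) - fD f (z x) ((0, v), Z v x) - fD f (z x) ((0, v'), Z v' x))
          \<le> B * norm (Z (v + v') x - Z v x - Z v' x) + 0"
        using B(2)[OF x, of "(0, Z (v + v') x - Z v x - Z v' x)"] by (simp add: norm_Pair)
    qed (use B in auto)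
    then show "Z (v + v') t = Z v t + Z v' t" by (simp add: Z0 diff_diff_eq)
  next
    fix c v
    have "norm (Z (c *\<^sub>R v) t - c *\<^sub>R Z v t) \<le> (norm (Z (c *\<^sub>R v) 0 - c *\<^sub>R Z v 0) + 0 * \<bar>t - 0\<bar>) * exp (B * \<bar>t - 0\<bar>)"
    proof (rule gronwall[OF zI(3,1,2)])
      fix x assume x: "x \<in> ?I"
      show "((\<lambda>s. Z (c *\<^sub>R v) s - c *\<^sub>R Z v s) has_vector_derivative
          fD f (z x) ((0, c *\<^sub>R v), Z (c *\<^sub>R v) x) - c *\<^sub>R fD f (z x) ((0, v), Z v x)) (at x within ?I)"
        using has_vector_derivative_diff[OF Z'[OF x] bounded_linear.has_vector_derivative[OF bounded_linear_scaleR_right Z'[OF x]]] .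
      have "fD f (z x) ((0, c *\<^sub>R v), Z (c *\<^sub>R v) x) - c *\<^sub>R fD f (z x) ((0, v), Z v x) =
          fD f (z x) (0, Z (c *\<^sub>R v) x - c *\<^sub>R Z v x)"
        by (simp add: linear_diff[OF lin[OF x], symmetric] linear_cmul[OF lin[OF x], symmetric])
      then show "norm (fD f (z x) ((0, c *\<^sub>R v), Z (c *\<^sub>R v) x) - c *\<^sub>R fD f (z x) ((0, v), Z v x))
          \<le> B * norm (Z (c *\<^sub>R v) x - c *\<^sub>R Z v x) + 0"
        using B(2)[OF x, of "(0, Z (c *\<^sub>R v) x - c *\<^sub>R Z v x)"] by (simp add: norm_Pair)
    qed (use B in auto)
    then show "Z (c *\<^sub>R v) t = c *\<^sub>R Z v t" by (simp add: Z0)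
  qed
  show ?thesis unfolding has_derivative_at_alt
  proof (intro conjI allI impI)
    show "bounded_linear (\<lambda>v. Z v t)"
      using Zlin Zb[OF zI(2)] by (intro bounded_linear_intro[of _ Cz]) (auto simp: linear_add[OF Zlin] linear_cmul[OF Zlin] mult.commute)
    fix e :: real assume e: "e > 0"
    \<comment> \<open>\<open>\<eta> * (M - 1)\<close> will be the factor of \<open>norm v\<close> in
      the Gronwall bound; the summand 1 keeps \<open>M\<close> positive when
      \<open>b = 0\<close>.\<close>
    define M where "M = (1 + Cz) * b * exp ((B + 1) * b) + 1"
    have M: "M > 0" using Cz b unfolding M_def by (intro add_nonneg_pos mult_nonneg_nonneg) auto
    define \<eta> where "\<eta> = min 1 (e / M)"
    have \<eta>: "0 < \<eta>" "\<eta> \<le> 1" "\<eta> * M \<le> e" using e M by (auto simp: \<eta>_def min_def field_simps)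
    obtain d where d: "d > 0" "\<And>s h. s \<in> ?I \<Longrightarrow> norm h < d \<Longrightarrow>
        norm (f (z s + h) - f (z s) - fD f (z s) h) \<le> \<eta> * norm h"
      using C1_uniformly_differentiable[OF Q(1,2) K KQ \<eta>(1)] by auto
    obtain d' where d': "d' > 0" "\<And>p'. dist p' p < d' \<Longrightarrow> p' \<in> W"
      "\<And>p' s. dist p' p < d' \<Longrightarrow> s \<in> ?I \<Longrightarrow> norm (Y (s, p') - Y (s, p)) \<le> d/3"
      using solves_uniform[OF W cf lip Y p b, of "d/3"] d(1) by (metis divide_pos_pos zero_less_numeral)
    show "\<exists>d>0. \<forall>p'. norm (p' - p) < d \<longrightarrow> norm (Y (t, p') - Y (t, p) - Z (p' - p) t) \<le> e * norm (p' - p)"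
    proof (intro exI[of _ "min (d/3) d'"] conjI allI impI)
      fix p' assume p': "norm (p' - p) < min (d/3) d'"
      define v where "v = p' - p"
      have pW: "p' \<in> W" using d'(2) p' by (simp add: dist_norm)
      let ?w = "\<lambda>s. Y (s, p') - Y (s, p)"
      let ?R = "\<lambda>s. f ((s, p'), Y (s, p')) - f ((s, p), Y (s, p)) - fD f (z s) ((0, v), ?w s)"
      have "norm (?w t - Z v t) \<le> (norm (?w 0 - Z v 0) + (\<eta> * (1 + Cz) * norm v) * \<bar>t - 0\<bar>) * exp ((B + 1) * \<bar>t - 0\<bar>)"
      proof (rule gronwall[OF zI(3,1,2)])
        fix s assume s: "s \<in> ?I"
        show "((\<lambda>s. ?w s - Z v s) has_vector_derivative
            f ((s, p'), Y (s, p')) - f ((s, p), Y (s, p)) - fD f (z s) ((0, v), Z v s)) (at s within ?I)"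
          by (intro has_vector_derivative_diff solvesD(2)[OF Y] p pW Ia Z' s)
        have h: "norm ((0::real, v), ?w s) < d"
          using pair_le[of v "?w s"] d'(3)[of p' s] p' s d(1) by (simp add: v_def dist_norm)
        have zs: "z s + ((0, v), ?w s) = ((s, p'), Y (s, p'))" by (simp add: z_def v_def)
        have "norm (?R s) \<le> \<eta> * norm ((0::real, v), ?w s)"
          using d(2)[OF s h] by (simp add: zs) (simp add: z_def)
        also have "\<dots> \<le> \<eta> * (norm v + norm (?w s))" using \<eta> by (intro mult_left_mono pair_le) auto
        also have "\<dots> \<le> \<eta> * (norm v + (norm (?w s - Z v s) + Cz * norm v))"
          using \<eta> Zb[OF s, of v] norm_triangle_sub[of "?w s" "Z v s"] by (intro mult_left_mono add_left_mono) auto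
        finally have R: "norm (?R s) \<le> \<eta> * norm (?w s - Z v s) + \<eta> * (1 + Cz) * norm v" by (simp add: algebra_simps)
        \<comment> \<open>The bound \<open>\<eta> \<le> 1\<close> keeps the growth rate at
          \<open>B + 1\<close>, independently of \<open>e\<close>.\<close>
        have \<eta>w: "\<eta> * norm (?w s - Z v s) \<le> 1 * norm (?w s - Z v s)" using \<eta> by (intro mult_right_mono) auto
        define F1 F0 l l' k where "F1 = f ((s, p'), Y (s, p'))" and "F0 = f ((s, p), Y (s, p))"
          and "l = fD f (z s) ((0, v), ?w s)" and "l' = fD f (z s) ((0, v), Z v s)" and "k = norm (?w s - Z v s)"
        have "l - l' = fD f (z s) (0, ?w s - Z v s)" unfolding l_def l'_def
          by (simp add: linear_diff[OF lin[OF s], symmetric])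
        then have "norm (l - l') \<le> B * k" using B(2)[OF s, of "(0, ?w s - Z v s)"] by (simp add: norm_Pair k_def)
        moreover have "norm (F1 - F0 - l) \<le> k + \<eta> * (1 + Cz) * norm v"
          using R \<eta>w unfolding F1_def F0_def l_def k_def by linarith
        moreover have "F1 - F0 - l' = (F1 - F0 - l) + (l - l')" by simp
        ultimately have "norm (F1 - F0 - l') \<le> (k + \<eta> * (1 + Cz) * norm v) + B * k"
          using norm_triangle_mono by metis
        then show "norm (f ((s, p'), Y (s, p')) - f ((s, p), Y (s, p)) - fD f (z s) ((0, v), Z v s))
            \<le> (B + 1) * norm (?w s - Z v s) + \<eta> * (1 + Cz) * norm v"
          unfolding F1_def[symmetric] F0_def[symmetric] l'_def[symmetric] k_def[symmetric]
          by (simp add: distrib_right)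
      qed (use B \<eta> Cz in auto)
      also have "\<dots> = (\<eta> * (1 + Cz) * norm v * b) * exp ((B + 1) * b)"
        by (simp add: b_def Z0 solvesD(1)[OF Y] p pW)
      also have "\<dots> \<le> (\<eta> * M) * norm v" unfolding M_def using \<eta> by (simp add: algebra_simps)
      also have "\<dots> \<le> e * norm v" using \<eta> by (intro mult_right_mono) auto
      finally show "norm (Y (t, p') - Y (t, p) - Z (p' - p) t) \<le> e * norm (p' - p)" by (simp add: v_def)
    qed (use d d' in auto)
  qed
qed

text \<open>A jointly continuous time derivative and differentiability in the parameter at one point
  suffice. The increment is split at \<open>(t, p')\<close>: its time part is compared with a linear
  motion of velocity \<open>f ((t, p), Y (t, p))\<close> by the mean value inequality, its parameter
  part is controlled by \<open>Z\<close>.\<close>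

lemma solves_has_derivative:
  fixes f :: "(real \<times> 'p::euclidean_space) \<times> 'e::euclidean_space \<Rightarrow> 'e"
  assumes W: "open W" and cf: "continuous_on (({-a<..<a} \<times> W) \<times> UNIV) f"
    and Y: "solves a W f Y" and cY: "continuous_on ({-a<..<a} \<times> W) Y"
    and q: "t \<in> {-a<..<a}" "p \<in> W"
    and Zd: "((\<lambda>p. Y (t, p)) has_derivative Z) (at p)"
  shows "(Y has_derivative (\<lambda>v. fst v *\<^sub>R f ((t, p), Y (t, p)) + Z (snd v))) (at (t, p))"
  unfolding has_derivative_at_alt
proof (intro conjI allI impI)
  let ?D = "{-a<..<a} \<times> W" and ?c = "f ((t, p), Y (t, p))"
  have D: "open ?D" using W by (intro open_Times) auto
  have "bounded_linear Z" using Zd has_derivative_bounded_linear by blast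
  then show "bounded_linear (\<lambda>v. fst v *\<^sub>R ?c + Z (snd v))"
    by (intro bounded_linear_add bounded_linear_compose[OF bounded_linear_scaleR_left] bounded_linear_fst
      bounded_linear_compose[OF _ bounded_linear_snd])
  fix e :: real assume e: "e > 0"
  have "continuous_on ?D (\<lambda>q. f (q, Y q))"
    by (rule continuous_on_compose2[OF cf]) (auto intro!: continuous_intros cY)
  then have "isCont (\<lambda>q. f (q, Y q)) (t, p)" using q D by (simp add: continuous_on_eq_continuous_at)
  moreover have e2: "e/2 > 0" using e by simp
  ultimately obtain d1 where d1: "d1 > 0" "\<And>q. dist q (t, p) < d1 \<Longrightarrow> dist (f (q, Y q)) ?c < e/2"
    unfolding continuous_at_eps_delta by blast
  obtain d2 where d2: "d2 > 0" "\<And>p'. norm (p' - p) < d2 \<Longrightarrow> norm (Y (t, p') - Y (t, p) - Z (p' - p)) \<le> e/2 * norm (p' - p)"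
    using Zd e2 unfolding has_derivative_at_alt by blast
  obtain d3 where d3: "d3 > 0" "ball (t, p) d3 \<subseteq> ?D" using D q openE[of ?D "(t, p)"] by blast
  show "\<exists>d>0. \<forall>q. norm (q - (t, p)) < d \<longrightarrow>
     norm (Y q - Y (t, p) - (fst (q - (t, p)) *\<^sub>R ?c + Z (snd (q - (t, p))))) \<le> e * norm (q - (t, p))"
  proof (intro exI[of _ "min (d1) (min d2 (d3))"] conjI allI impI)
    fix q assume q: "norm (q - (t, p)) < min d1 (min d2 d3)"
    obtain t' p' where qe[simp]: "q = (t', p')" by fastforce
    have nt: "norm (t' - t) \<le> norm (q - (t, p))" and np: "norm (p' - p) \<le> norm (q - (t, p))"
      using dist_fst_le[of q "(t, p)"] dist_snd_le[of q "(t, p)"] by (auto simp: dist_norm)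
    have near: "(s, p') \<in> ?D \<and> dist (s, p') (t, p) < d1" if s: "s \<in> closed_segment t t'" for s
    proof -
      have "norm (s - t) \<le> norm (t' - t)" using segment_bound1[OF s] .
      then have "dist (s, p') (t, p) \<le> dist (t', p') (t, p)"
        unfolding dist_Pair_Pair by (intro real_sqrt_le_mono add_mono power_mono) (auto simp: dist_norm)
      then have "dist (s, p') (t, p) < min d1 (min d2 d3)" using q by (simp add: dist_norm)
      moreover from this have "(s, p') \<in> ball (t, p) d3" by (simp add: dist_commute)
      ultimately show ?thesis using d3(2) by auto
    qed
    let ?g = "\<lambda>s. Y (s, p') - s *\<^sub>R ?c"
    have "norm (?g t' - ?g t) \<le> e/2 * norm (t' - t)"
    proof (rule differentiable_bound[where S="closed_segment t t'"])
      fix s assume s: "s \<in> closed_segment t t'"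
      have gY: "((\<lambda>s. Y (s, p')) has_vector_derivative f ((s, p'), Y (s, p'))) (at s)"
        using near[OF s] by (simp only: mem_Times_iff fst_conv snd_conv solvesD(2)[OF Y])
      have gc: "((\<lambda>s. s *\<^sub>R ?c) has_vector_derivative ?c) (at s)"
        unfolding has_vector_derivative_def
        by (rule bounded_linear_imp_has_derivative[OF bounded_linear_scaleR_left])
      have "(?g has_vector_derivative f ((s, p'), Y (s, p')) - ?c) (at s within closed_segment t t')"
        by (rule has_vector_derivative_at_within[OF has_vector_derivative_diff[OF gY gc]])
      then show "(?g has_derivative (\<lambda>h. h *\<^sub>R (f ((s, p'), Y (s, p')) - ?c))) (at s within closed_segment t t')"
        by (simp add: has_vector_derivative_def)
      have "dist (f ((s, p'), Y (s, p'))) ?c < e/2"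
        by (rule d1(2)[OF conjunct2[OF near[OF s]]])
      then have "norm (f ((s, p'), Y (s, p')) - ?c) \<le> e/2" by (simp only: dist_norm less_imp_le)
      note bound = this
      show "onorm (\<lambda>h. h *\<^sub>R (f ((s, p'), Y (s, p')) - ?c)) \<le> e/2"
      proof (rule onorm_le)
        fix h :: real
        show "norm (h *\<^sub>R (f ((s, p'), Y (s, p')) - ?c)) \<le> e/2 * norm h"
          using mult_left_mono[OF bound abs_ge_zero[of h]] by (simp only: norm_scaleR real_norm_def mult.commute)
      qed
    qed auto
    moreover have "norm (Y (t, p') - Y (t, p) - Z (p' - p)) \<le> e/2 * norm (p' - p)"
      using d2(2) np q by auto
    moreover have "Y q - Y (t, p) - (fst (q - (t, p)) *\<^sub>R ?c + Z (snd (q - (t, p)))) =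
        (?g t' - ?g t) + (Y (t, p') - Y (t, p) - Z (p' - p))" by (simp add: algebra_simps)
    ultimately have "norm (Y q - Y (t, p) - (fst (q - (t, p)) *\<^sub>R ?c + Z (snd (q - (t, p))))) \<le>
        e/2 * norm (t' - t) + e/2 * norm (p' - p)" using norm_triangle_mono by metis
    also have "\<dots> \<le> e/2 * norm (q - (t, p)) + e/2 * norm (q - (t, p))"
      using e nt np by (intro add_mono mult_left_mono) auto
    finally show "norm (Y q - Y (t, p) - (fst (q - (t, p)) *\<^sub>R ?c + Z (snd (q - (t, p))))) \<le> e * norm (q - (t, p))"
      by simp
  qed (use d1 d2 d3 in auto)
qed

lemma Ck_on_fD_compose:
  fixes f :: "'a::euclidean_space \<Rightarrow> 'b::real_normed_vector" and \<psi> :: "'c::euclidean_space \<Rightarrow> 'a"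
  assumes S: "open S" and T: "open T" and f: "Ck_on (Suc k) T f" and \<psi>: "Ck_on k S \<psi>" "\<psi> ` S \<subseteq> T"
    and w: "Ck_on k S w"
  shows "Ck_on k S (\<lambda>x. fD f (\<psi> x) (w x))"
proof -
  have "fD f (\<psi> x) (w x) = (\<Sum>b\<in>Basis. (w x \<bullet> b) *\<^sub>R fD f (\<psi> x) b)" if "x \<in> S" for x
    using \<psi>(2) that by (intro bounded_linear_basis_expansion[OF Ck_on_bounded_linear_fD[OF f]]) auto
  moreover have "Ck_on k S (\<lambda>x. \<Sum>b\<in>Basis. (w x \<bullet> b) *\<^sub>R fD f (\<psi> x) b)"
    by (intro Ck_on_sum Ck_on_scaleR Ck_on_inner_left S w Ck_on_compose[OF S T \<psi>(1) Ck_on_partial[OF f] \<psi>(2)])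
  ultimately show ?thesis using Ck_on_cong[OF S] by (metis (no_types, lifting))
qed

text \<open>Induction on \<open>k\<close>: the derivative of the solution in a parameter direction solves the variational
  equation, whose right-hand side is one degree less smooth but of the same type.\<close>

theorem Ck_on_solves:
  fixes f :: "(real \<times> 'p::euclidean_space) \<times> 'e::euclidean_space \<Rightarrow> 'e"
  assumes a: "0 < a" and W: "open W"
    and "continuous_on (({-a<..<a} \<times> W) \<times> UNIV) f" "lipschitz_state ({-a<..<a} \<times> W) f" "solves a W f Y"
    and "open Q" "Ck_on k Q f" "\<And>q. q \<in> {-a<..<a} \<times> W \<Longrightarrow> (q, Y q) \<in> Q"
  shows "Ck_on k ({-a<..<a} \<times> W) Y"
  using assms(3-)
proof (induction k arbitrary: f Y Q)
  case 0
  then show ?case using solves_continuous[OF W 0(1-3)] by simp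
next
  case (Suc k)
  let ?D = "{-a<..<a} \<times> W"
  note cf = Suc.prems(1) and lip = Suc.prems(2) and Y = Suc.prems(3) and Q = Suc.prems(4) and f = Suc.prems(5)
    and YQ = Suc.prems(6)
  have D: "open ?D" using W by (intro open_Times) auto
  have DU: "open (?D \<times> (UNIV :: 'e set))" by (rule open_Times[OF D open_UNIV])
  have f1: "Ck_on (Suc 0) Q f" by (rule Ck_on_le[OF f]) simp
  have Yk: "Ck_on k ?D Y" using Suc.IH[OF cf lip Y Q Ck_on_SucD[OF f] YQ] .
  have cY: "continuous_on ?D Y" using Ck_on_continuous[OF Yk] .
  \<comment> \<open>The right-hand side of the variational equation. It is affine in the state,
    hence defined and of class C^k for all states although \<open>f\<close> is differentiable only
    near the graph of \<open>Y\<close>.\<close>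
  define F where "F = (\<lambda>v z. fD f (fst z, Y (fst z)) ((0::real, v), snd z))"
  have lin: "linear (fD f (q, Y q))" if "q \<in> ?D" for q
    using Ck_on_bounded_linear_fD[OF f1 YQ[OF that]] bounded_linear.linear by blast
  have Fk: "Ck_on k (?D \<times> UNIV) (F v)" for v
  proof -
    have fs: "Ck_on k (?D \<times> UNIV) (\<lambda>z::(real \<times> 'p) \<times> 'e. fst z)" by (intro Ck_intros DU)
    have "Ck_on k (?D \<times> UNIV) (\<lambda>z::(real \<times> 'p) \<times> 'e. (fst z, Y (fst z)))"
      by (intro Ck_intros DU Ck_on_compose[OF DU D fs Yk]) auto
    moreover have "(\<lambda>z::(real \<times> 'p) \<times> 'e. (fst z, Y (fst z))) ` (?D \<times> UNIV) \<subseteq> Q" using YQ by auto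
    moreover have "Ck_on k (?D \<times> UNIV) (\<lambda>z::(real \<times> 'p) \<times> 'e. ((0::real, v), snd z))"
      by (intro Ck_intros DU)
    ultimately show ?thesis unfolding F_def by (rule Ck_on_fD_compose[OF DU Q f])
  qed
  have Flip: "lipschitz_state ?D (F v)" for v
    unfolding lipschitz_state_def
  proof (intro allI impI, elim conjE)
    fix C assume C: "compact C" "C \<subseteq> ?D"
    have "compact ((\<lambda>q. (q, Y q)) ` C)"
      by (intro compact_continuous_image continuous_intros continuous_on_subset[OF cY] C)
    moreover have "(\<lambda>q. (q, Y q)) ` C \<subseteq> Q" using C YQ by auto
    ultimately have "\<exists>L\<ge>0. \<forall>x\<in>(\<lambda>q. (q, Y q)) ` C. \<forall>h. norm (fD f x h) \<le> L * norm h"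
      by (rule C1_compact_bound[OF f1])
    then obtain L where L: "L \<ge> 0" "\<And>q h. q \<in> C \<Longrightarrow> norm (fD f (q, Y q) h) \<le> L * norm h" by auto
    have "norm (F v (q, y) - F v (q, y')) \<le> L * norm (y - y')" if q: "q \<in> C" for q y y'
    proof -
      have "F v (q, y) - F v (q, y') = fD f (q, Y q) (0, y - y')"
        unfolding F_def by (simp add: linear_diff[OF lin[OF subsetD[OF C(2) q]], symmetric])
      then show ?thesis using L(2)[OF q, of "(0, y - y')"] by (simp add: norm_Pair)
    qed
    then show "\<exists>L\<ge>0. \<forall>q\<in>C. \<forall>y y'. norm (F v (q, y) - F v (q, y')) \<le> L * norm (y - y')" using L(1) by blast
  qed
  have "\<exists>Z. Z 0 = 0 \<and> (\<forall>t\<in>{-a<..<a}. (Z has_vector_derivative F v ((t, p), Z t)) (at t))" if p: "p \<in> W" for v p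
  proof (rule ode_solution_open_interval[OF a])
    show "continuous_on ({-a<..<a} \<times> UNIV) (\<lambda>z. F v ((fst z, p), snd z))"
      by (rule continuous_on_compose2[OF Ck_on_continuous[OF Fk]]) (use p in \<open>auto intro!: continuous_intros\<close>)
    fix b assume "0 < b" "b < a"
    then have "compact ({-b..b} \<times> {p})" "{-b..b} \<times> {p} \<subseteq> ?D" using p by (auto intro!: compact_Times)
    then obtain L where "L \<ge> 0" "\<And>q y y'. q \<in> {-b..b} \<times> {p} \<Longrightarrow> norm (F v (q, y) - F v (q, y')) \<le> L * norm (y - y')"
      using Flip[of v] unfolding lipschitz_state_def by meson
    then show "\<exists>L\<ge>0. \<forall>t\<in>{-b..b}. \<forall>y y'. norm (F v ((t, p), y) - F v ((t, p), y')) \<le> L * norm (y - y')"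
      by (intro exI[of _ L]) auto
  qed
  note ex = this
  define Z where "Z = (\<lambda>v p. SOME Z. Z 0 = 0 \<and> (\<forall>t\<in>{-a<..<a}. (Z has_vector_derivative F v ((t, p), Z t)) (at t)))"
  have Z': "Z v p 0 = 0 \<and> (\<forall>t\<in>{-a<..<a}. (Z v p has_vector_derivative F v ((t, p), Z v p t)) (at t))"
    if "p \<in> W" for v p
    unfolding Z_def by (rule someI_ex[OF ex[OF that]])
  have Z: "Z v p 0 = 0" "t \<in> {-a<..<a} \<Longrightarrow> (Z v p has_vector_derivative F v ((t, p), Z v p t)) (at t)"
    if "p \<in> W" for v p t
    using Z'[OF that] by blast+
  define Zv where "Zv = (\<lambda>v q. Z v (snd q) (fst q))"
  have "solves a W (F v) (Zv v)" for v using Z by (simp add: solves_def Zv_def)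
  then have Zk: "Ck_on k ?D (Zv v)" for v
    by (intro Suc.IH[OF Ck_on_continuous[OF Fk] Flip _ DU Fk]) auto
  have d: "(Y has_derivative (\<lambda>v. fst v *\<^sub>R f (q, Y q) + Zv (snd v) q)) (at q)" if q: "q \<in> ?D" for q
  proof -
    obtain t p where tp: "q = (t, p)" "t \<in> {-a<..<a}" "p \<in> W" using q by blast
    have "((\<lambda>p. Y (t, p)) has_derivative (\<lambda>v. Z v p t)) (at p)"
      using Z[OF tp(3)] by (intro solves_has_derivative_parameter[OF W cf lip Y Q f1 YQ tp(3,2)]) (auto simp: F_def)
    from solves_has_derivative[OF W cf Y cY tp(2,3) this] show ?thesis by (simp add: tp Zv_def)
  qed
  have "Ck_on k ?D (\<lambda>q. (q, Y q))" by (intro Ck_intros D Yk)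
  then have "Ck_on k ?D (\<lambda>q. f (q, Y q))"
    by (rule Ck_on_compose[OF D Q _ Ck_on_SucD[OF f]]) (use YQ in auto)
  then show ?case
    by (intro Ck_on_SucI[OF D d] Ck_on_add Ck_on_scaleR Ck_on_const D Zk)
qed

section \<open>Local flows\<close>

text \<open>The field is truncated outside a ball to make it globally Lipschitz. \<open>L\<close> is
  exposed because the admissible \<open>a\<close> and \<open>\<rho>\<close> depend on it. The time
  \<open>a\<close> need not be small: at a zero of \<open>X\<close> every \<open>a\<close> is
  admissible once \<open>\<rho>\<close> is small enough, which is what the equilibrium at the origin
  requires.\<close>

theorem local_flow:
  fixes X :: "'e::euclidean_space \<Rightarrow> 'e"
  assumes S: "open S" and X: "smooth_on S X" and r: "0 < r" "cball z0 r \<subseteq> S"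
  shows "\<exists>L\<ge>0. (\<forall>x\<in>cball z0 r. \<forall>y\<in>cball z0 r. norm (X x - X y) \<le> L * norm (x - y)) \<and>
    (\<forall>a>0. \<forall>\<rho>>0. (\<rho> + norm (X z0) * a) * exp (L * a) < r \<longrightarrow>
      (\<exists>\<Phi>. smooth_on ({-a<..<a} \<times> ball z0 \<rho>) \<Phi> \<and>
        (\<forall>p\<in>ball z0 \<rho>. \<Phi> (0, p) = p \<and> (\<forall>t\<in>{-a<..<a}. \<Phi> (t, p) \<in> ball z0 r \<and>
           ((\<lambda>t. \<Phi> (t, p)) has_vector_derivative X (\<Phi> (t, p))) (at t)))))"
proof -
  have z0: "z0 \<in> cball z0 r" using r by simp
  obtain L where L: "L \<ge> 0" "\<And>x y. x \<in> cball z0 r \<Longrightarrow> y \<in> cball z0 r \<Longrightarrow> norm (X x - X y) \<le> L * norm (x - y)"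
    using C1_lipschitz[OF smooth_onD[OF X] compact_cball convex_cball r(2)] by blast
  \<comment> \<open>The nearest-point projection onto the ball is 1-Lipschitz, so \<open>X\<close>
    after \<open>c\<close> is Lipschitz on the whole space; it agrees with \<open>X\<close> on the
    ball.\<close>
  define c where "c = closest_point (cball z0 r)"
  have c: "c x \<in> cball z0 r" "x \<in> cball z0 r \<Longrightarrow> c x = x" "norm (c x - c y) \<le> norm (x - y)" for x y
    unfolding c_def using r closest_point_in_set[of "cball z0 r" x] closest_point_lipschitz[of "cball z0 r" x y]
    by (auto simp: closest_point_self dist_norm)
  have cc: "continuous_on A c" for A unfolding c_def using r by (intro continuous_on_closest_point) auto
  have Xc: "norm (X (c x) - X (c y)) \<le> L * norm (x - y)" for x y
    using L(2)[OF c(1) c(1), of x y] mult_left_mono[OF c(3) L(1), of x y] by linarith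
  \<comment> \<open>The unknown is the displacement from the initial point, which starts at 0 as
    \<open>solves\<close> demands.\<close>
  define f where "f = (\<lambda>z::(real \<times> 'e) \<times> 'e. X (c (snd (fst z) + snd z)))"
  have cX: "continuous_on (cball z0 r) X" using smooth_on_continuous[OF X] continuous_on_subset r(2) by blast
  have "continuous_on UNIV (\<lambda>z::(real \<times> 'e) \<times> 'e. c (snd (fst z) + snd z))"
    by (rule continuous_on_compose2[OF cc[of UNIV]]) (auto intro!: continuous_intros)
  then have "continuous_on UNIV f" unfolding f_def
    by (rule continuous_on_compose2[OF cX]) (use c(1) in auto)
  then have cf: "continuous_on A f" for A using continuous_on_subset by blast
  have flip: "norm (f (q, y) - f (q, y')) \<le> L * norm (y - y')" for q y y'
    using Xc[of "snd q + y" "snd q + y'"] by (simp add: f_def)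
  have lip: "lipschitz_state A f" for A
    unfolding lipschitz_state_def using L(1) flip by blast
  show ?thesis
  proof (intro exI[of _ L] conjI allI impI ballI L)
    fix a \<rho> assume a: "0 < a" and \<rho>: "0 < \<rho>" and small: "(\<rho> + norm (X z0) * a) * exp (L * a) < r"
    let ?W = "ball z0 \<rho>" and ?J = "{-a<..<a}"
    let ?D = "?J \<times> ?W"
    have "\<exists>Y. Y 0 = 0 \<and> (\<forall>t\<in>?J. (Y has_vector_derivative f ((t, p), Y t)) (at t))" for p
    proof (rule ode_solution_open_interval[OF a])
      show "continuous_on (?J \<times> UNIV) (\<lambda>z. f ((fst z, p), snd z))"
        by (rule continuous_on_compose2[OF cf[of UNIV]]) (auto intro!: continuous_intros)
      show "\<exists>L\<ge>0. \<forall>t\<in>{-b..b}. \<forall>y y'. norm (f ((t, p), y) - f ((t, p), y')) \<le> L * norm (y - y')" for b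
        using L(1) flip by blast
    qed
    then obtain Z where Z: "\<And>p. Z p 0 = 0" "\<And>p t. t \<in> ?J \<Longrightarrow> (Z p has_vector_derivative f ((t, p), Z p t)) (at t)"
      by metis
    define Y where "Y = (\<lambda>q. Z (snd q) (fst q))"
    have Y: "solves a ?W f Y" using Z by (simp add: solves_def Y_def)
    \<comment> \<open>The smallness condition keeps the truncated solution inside the open ball, so
      the truncation never acts along it.\<close>
    have inb: "p + Y (t, p) \<in> ball z0 r" if p: "p \<in> ?W" and t: "t \<in> ?J" for p t
    proof -
      let ?u = "\<lambda>s. (p + Y (s, p)) - z0"
      have "norm (?u t) \<le> (norm (?u 0) + norm (X z0) * \<bar>t - 0\<bar>) * exp (L * \<bar>t - 0\<bar>)"
      proof (rule gronwall[of ?J])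
        fix s assume s: "s \<in> ?J"
        have "((\<lambda>s. Y (s, p)) has_vector_derivative f ((s, p), Y (s, p))) (at s within ?J)"
          by (rule solvesD(2)[OF Y p s])
        then show "(?u has_vector_derivative f ((s, p), Y (s, p))) (at s within ?J)"
          by (auto intro!: derivative_eq_intros)
        have "norm (X (c (p + Y (s, p))) - X (c z0)) \<le> L * norm (?u s)" by (rule Xc)
        then show "norm (f ((s, p), Y (s, p))) \<le> L * norm (?u s) + norm (X z0)"
          using c(2)[OF z0] norm_triangle_sub[of "X (c (p + Y (s, p)))" "X z0"] by (simp add: f_def)
      qed (use a t L in auto)
      also have "\<dots> \<le> (\<rho> + norm (X z0) * a) * exp (L * a)"
        using p t L a \<rho> solvesD(1)[OF Y p]
        by (intro mult_mono add_mono mult_left_mono) (auto simp: dist_norm norm_minus_commute intro!: mult_left_mono)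
      also have "\<dots> < r" by (rule small)
      finally have "dist (p + Y (t, p)) z0 < r" by (simp only: dist_norm)
      then show ?thesis by (simp add: dist_commute)
    qed
    define Q where "Q = {z. z \<in> ?D \<times> UNIV \<and> snd (fst z) + snd z \<in> ball z0 r}"
    have Q: "open Q"
    proof -
      have "open ((\<lambda>z::(real \<times> 'e) \<times> 'e. snd (fst z) + snd z) -` ball z0 r)"
        by (intro open_vimage continuous_intros) auto
      moreover have "open (?D \<times> (UNIV::'e set))" by (intro open_Times) auto
      ultimately have "open ((?D \<times> UNIV) \<inter> (\<lambda>z::(real \<times> 'e) \<times> 'e. snd (fst z) + snd z) -` ball z0 r)" by (rule open_Int[rotated])
      then show ?thesis by (simp add: Q_def Int_def vimage_def)
    qed
    have "Ck_on k ?D Y" for k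
    proof (rule Ck_on_solves[OF a _ cf lip Y Q])
      have 1: "Ck_on k Q (\<lambda>z. snd (fst z) + snd z)" by (intro Ck_intros Q)
      have "Ck_on k Q (\<lambda>z. X (snd (fst z) + snd z))"
        by (rule Ck_on_compose[OF Q S 1 smooth_onD[OF X]]) (use r(2) in \<open>auto simp: Q_def\<close>)
      moreover have "f z = X (snd (fst z) + snd z)" if "z \<in> Q" for z
        using that c(2)[of "snd (fst z) + snd z"] by (simp add: f_def Q_def)
      ultimately show "Ck_on k Q f" using Ck_on_cong[OF Q, of f "\<lambda>z. X (snd (fst z) + snd z)"] by blast
    next
      fix q assume "q \<in> ?D"
      then show "(q, Y q) \<in> Q" using inb[of "snd q" "fst q"] by (auto simp: Q_def)
    qed simp
    moreover have D: "open ?D" by (intro open_Times) auto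
    ultimately have sm: "smooth_on ?D (\<lambda>q. snd q + Y q)"
      by (intro smooth_onI Ck_intros)
    have der: "((\<lambda>t. p + Y (t, p)) has_vector_derivative X (p + Y (t, p))) (at t)" if p: "p \<in> ?W" and t: "t \<in> ?J" for p t
    proof -
      have "f ((t, p), Y (t, p)) = X (p + Y (t, p))"
        using inb[OF p t] c(2)[of "p + Y (t, p)"] by (simp add: f_def)
      then show ?thesis using solvesD(2)[OF Y p t, of UNIV] by (auto intro!: derivative_eq_intros)
    qed
    show "\<exists>\<Phi>. smooth_on (?J \<times> ?W) \<Phi> \<and>
        (\<forall>p\<in>?W. \<Phi> (0, p) = p \<and> (\<forall>t\<in>?J. \<Phi> (t, p) \<in> ball z0 r \<and>
           ((\<lambda>t. \<Phi> (t, p)) has_vector_derivative X (\<Phi> (t, p))) (at t)))"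
    proof (rule exI[of _ "\<lambda>q. snd q + Y q"], intro conjI ballI)
      fix p t assume pt: "p \<in> ?W" "t \<in> ?J"
      show "snd (t, p) + Y (t, p) \<in> ball z0 r"
        unfolding snd_conv by (rule inb[OF pt])
      show "((\<lambda>t. snd (t, p) + Y (t, p)) has_vector_derivative X (snd (t, p) + Y (t, p))) (at t)"
        unfolding snd_conv by (rule der[OF pt])
    next
      fix p assume "p \<in> ?W"
      then show "snd (0, p) + Y (0, p) = p" using solvesD(1)[OF Y] by simp
    qed (rule sm)
  qed
qed

lemma smooth_on_partial: "smooth_on S f \<Longrightarrow> smooth_on S (\<lambda>x. fD f x v)"
  using Ck_on_partial smooth_onD smooth_onI by metis

lemma smooth_on_compose:
  fixes f :: "'a::real_normed_vector \<Rightarrow> 'b::euclidean_space" and g :: "'b \<Rightarrow> 'c::real_normed_vector"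
  assumes "open S" "open T" "smooth_on S f" "smooth_on T g" "f ` S \<subseteq> T"
  shows "smooth_on S (\<lambda>x. g (f x))"
  by (intro smooth_onI Ck_on_compose[OF assms(1,2) smooth_onD[OF assms(3)] smooth_onD[OF assms(4)] assms(5)])

lemma smooth_on_cong: "open S \<Longrightarrow> (\<And>y. y \<in> S \<Longrightarrow> f y = g y) \<Longrightarrow> smooth_on S f \<longleftrightarrow> smooth_on S g"
  unfolding smooth_on_def using Ck_on_cong by blast

lemma smooth_on_linear_fD: "smooth_on S f \<Longrightarrow> x \<in> S \<Longrightarrow> linear (fD f x)"
  using smooth_on_derivative has_derivative_bounded_linear bounded_linear.linear by blast

section \<open>Nondegenerate skew forms on four-space\<close>

definition e1 :: R4 where "e1 = (1, 0, 0, 0)"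
definition e2 :: R4 where "e2 = (0, 1, 0, 0)"
definition e3 :: R4 where "e3 = (0, 0, 1, 0)"
definition e4 :: R4 where "e4 = (0, 0, 0, 1)"

lemma R4_expand: "(a, b, c, d) = a *\<^sub>R e1 + b *\<^sub>R e2 + c *\<^sub>R e3 + d *\<^sub>R e4"
  by (simp add: e1_def e2_def e3_def e4_def)

lemma skew_swap:
  assumes "bilinear B" "\<And>v. B v v = (0::real)"
  shows "B v w = - B w v"
proof -
  have "B (v + w) (v + w) = B v w + B w v"
    unfolding bilinear_ladd[OF assms(1)] bilinear_radd[OF assms(1)] by (simp add: assms(2))
  then show ?thesis using assms(2)[of "v + w"] by linarith
qed

lemma skew_form_expand:
  assumes B: "bilinear B" "\<And>v. B v v = (0::real)"
  shows "B (a, b, c, d) (a', b', c', d') =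
     B e1 e2 * (a * b' - b * a') + B e1 e3 * (a * c' - c * a') + B e1 e4 * (a * d' - d * a') +
     B e2 e3 * (b * c' - c * b') + B e2 e4 * (b * d' - d * b') + B e3 e4 * (c * d' - d * c')"
proof -
  note sw = skew_swap[OF B]
  have "B e2 e1 = - B e1 e2" "B e3 e1 = - B e1 e3" "B e4 e1 = - B e1 e4"
    "B e3 e2 = - B e2 e3" "B e4 e2 = - B e2 e4" "B e4 e3 = - B e3 e4" by (rule sw)+
  then show ?thesis
    unfolding R4_expand
    by (simp add: bilinear_ladd[OF B(1)] bilinear_radd[OF B(1)] bilinear_lmul[OF B(1)] bilinear_rmul[OF B(1)] B(2) algebra_simps)
qed

definition pfaffian :: "(R4 \<Rightarrow> R4 \<Rightarrow> real) \<Rightarrow> real" where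
  "pfaffian B = B e1 e2 * B e3 e4 - B e1 e3 * B e2 e4 + B e1 e4 * B e2 e3"

text \<open>Cramer's rule: the inverse of a skew matrix of order four is its Hodge dual divided by the
  Pfaffian.\<close>

definition skew_solve :: "(R4 \<Rightarrow> R4 \<Rightarrow> real) \<Rightarrow> (R4 \<Rightarrow> real) \<Rightarrow> R4" where
  "skew_solve B \<alpha> =
    ((- B e3 e4 * \<alpha> e2 + B e2 e4 * \<alpha> e3 - B e2 e3 * \<alpha> e4) / pfaffian B,
     (B e3 e4 * \<alpha> e1 - B e1 e4 * \<alpha> e3 + B e1 e3 * \<alpha> e4) / pfaffian B,
     (- B e2 e4 * \<alpha> e1 + B e1 e4 * \<alpha> e2 - B e1 e2 * \<alpha> e4) / pfaffian B,
     (B e2 e3 * \<alpha> e1 - B e1 e3 * \<alpha> e2 + B e1 e2 * \<alpha> e3) / pfaffian B)"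

text \<open>The product of a skew matrix with its Hodge dual is the Pfaffian times the identity, up
  to sign. If the Pfaffian is zero, rows of the dual lie in the kernel of \<open>B\<close> and
  vanish by nondegeneracy. Three of them contain all entries of \<open>B\<close> involving
  \<open>e1\<close>, so \<open>e1\<close> would lie in the kernel.\<close>

lemma pfaffian_nonzero:
  assumes B: "bilinear B" "\<And>v. B v v = (0::real)" and nd: "\<And>v. v \<noteq> 0 \<Longrightarrow> \<exists>w. B v w \<noteq> 0"
  shows "pfaffian B \<noteq> 0"
proof
  assume pf: "pfaffian B = 0"
  note ex = skew_form_expand[OF B]
  have kernel: "v = 0" if "\<And>w. B w v = 0" for v
    using nd[of v] skew_swap[OF B, of v] that by auto
  have 1: "(0, B e3 e4, - B e2 e4, B e2 e3) = (0::R4)"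
    by (rule kernel, clarify, subst ex) (use pf in \<open>simp add: pfaffian_def\<close>, algebra)
  have 2: "(- B e3 e4, 0, B e1 e4, - B e1 e3) = (0::R4)"
    by (rule kernel, clarify, subst ex) (use pf in \<open>simp add: pfaffian_def\<close>, algebra)
  have 3: "(B e2 e4, - B e1 e4, 0, B e1 e2) = (0::R4)"
    by (rule kernel, clarify, subst ex) (use pf in \<open>simp add: pfaffian_def\<close>, algebra)
  have "B (1, 0, 0, 0) w = 0" for w
    by (cases w, simp only: ex) (use 1 2 3 in \<open>simp add: zero_prod_def\<close>)
  then show False using nd[of "(1, 0, 0, 0)"] by (auto simp: zero_prod_def)
qed

lemma skew_solve:
  assumes B: "bilinear B" "\<And>v. B v v = (0::real)" and pf: "pfaffian B \<noteq> 0" and \<alpha>: "linear \<alpha>"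
  shows "B v (skew_solve B \<alpha>) = \<alpha> v"
proof -
  obtain a b c d where v: "v = (a, b, c, d)" by (cases v)
  have \<alpha>v: "\<alpha> v = a * \<alpha> e1 + b * \<alpha> e2 + c * \<alpha> e3 + d * \<alpha> e4"
    unfolding v R4_expand by (simp add: linear_add[OF \<alpha>] linear_cmul[OF \<alpha>])
  define p where "p = pfaffian B"
  obtain q1 q2 q3 q4 where q: "skew_solve B \<alpha> = (q1, q2, q3, q4)" by (cases "skew_solve B \<alpha>")
  have n: "p * q1 = - B e3 e4 * \<alpha> e2 + B e2 e4 * \<alpha> e3 - B e2 e3 * \<alpha> e4"
    "p * q2 = B e3 e4 * \<alpha> e1 - B e1 e4 * \<alpha> e3 + B e1 e3 * \<alpha> e4"
    "p * q3 = - B e2 e4 * \<alpha> e1 + B e1 e4 * \<alpha> e2 - B e1 e2 * \<alpha> e4"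
    "p * q4 = B e2 e3 * \<alpha> e1 - B e1 e3 * \<alpha> e2 + B e1 e2 * \<alpha> e3"
    using q pf unfolding skew_solve_def p_def by auto
  have "p * B v (skew_solve B \<alpha>) =
     B e1 e2 * (a * (p * q2) - b * (p * q1)) + B e1 e3 * (a * (p * q3) - c * (p * q1)) + B e1 e4 * (a * (p * q4) - d * (p * q1)) +
     B e2 e3 * (b * (p * q3) - c * (p * q2)) + B e2 e4 * (b * (p * q4) - d * (p * q2)) + B e3 e4 * (c * (p * q4) - d * (p * q3))"
    unfolding q v skew_form_expand[OF B] by algebra
  also have "\<dots> = p * \<alpha> v" unfolding n unfolding \<alpha>v p_def pfaffian_def by algebra
  finally show ?thesis using pf by (simp add: p_def)
qed

lemma form_dual_eqI:
  assumes B: "bilinear B" "\<And>v. B v v = (0::real)" and nd: "\<And>v. v \<noteq> 0 \<Longrightarrow> \<exists>w. B v w \<noteq> 0"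
    and X: "\<And>v. B v X = \<alpha> v"
  shows "form_dual B \<alpha> = X"
  unfolding form_dual_def
proof (rule the_equality)
  fix Y assume Y: "\<forall>v. B v Y = \<alpha> v"
  have "B (Y - X) w = 0" for w
    using skew_swap[OF B, of "Y - X" w] X Y by (simp add: bilinear_rsub[OF B(1)])
  then show "Y = X" using nd[of "Y - X"] by auto
qed (use X in blast)

lemma form_dual_eq_skew_solve:
  assumes B: "bilinear B" "\<And>v. B v v = (0::real)" and nd: "\<And>v. v \<noteq> 0 \<Longrightarrow> \<exists>w. B v w \<noteq> 0"
    and \<alpha>: "linear \<alpha>"
  shows "form_dual B \<alpha> = skew_solve B \<alpha>"
  by (rule form_dual_eqI[OF B nd]) (use skew_solve[OF B pfaffian_nonzero[OF B nd] \<alpha>] in auto)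

text \<open>The product rule for a bilinear form that varies with the base point; in the first term
  the two vectors are frozen. Expansion in the bases reduces it to products of scalar
  functions.\<close>

lemma has_derivative_bilinear_family:
  fixes B :: "'a::euclidean_space \<Rightarrow> 'b::euclidean_space \<Rightarrow> 'c::euclidean_space \<Rightarrow> real"
  assumes S: "open S" and B: "\<And>y. y \<in> S \<Longrightarrow> bilinear (B y)" "\<And>b c. smooth_on S (\<lambda>y. B y b c)"
    and y: "(y has_derivative y') (at x)" "y x \<in> S"
    and V: "(V has_derivative V') (at x)" and W: "(W has_derivative W') (at x)"
  shows "((\<lambda>x. B (y x) (V x) (W x)) has_derivative
     (\<lambda>h. fD (\<lambda>y. B y (V x) (W x)) (y x) (y' h) + B (y x) (V' h) (W x) + B (y x) (V x) (W' h))) (at x)"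
proof -
  have exp: "B y v w = (\<Sum>i\<in>Basis. \<Sum>j\<in>Basis. (v \<bullet> i) * (w \<bullet> j) * B y i j)" if "y \<in> S" for y v w
  proof -
    have "B y v w = B y (\<Sum>i\<in>Basis. (v \<bullet> i) *\<^sub>R i) (\<Sum>j\<in>Basis. (w \<bullet> j) *\<^sub>R j)" by (simp only: euclidean_representation)
    also have "\<dots> = (\<Sum>(i, j)\<in>Basis \<times> Basis. B y ((v \<bullet> i) *\<^sub>R i) ((w \<bullet> j) *\<^sub>R j))"
      by (rule bilinear_sum[OF B(1)[OF that]])
    also have "\<dots> = (\<Sum>i\<in>Basis. \<Sum>j\<in>Basis. (v \<bullet> i) * (w \<bullet> j) * B y i j)"
      by (simp add: sum.cartesian_product[symmetric] bilinear_lmul[OF B(1)[OF that]] bilinear_rmul[OF B(1)[OF that]] mult_ac)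
    finally show ?thesis .
  qed
  have dB: "((\<lambda>y. B y i j) has_derivative fD (\<lambda>y. B y i j) z) (at z)" if "z \<in> S" for i j z
    by (rule smooth_on_derivative[OF B(2) that])
  have dBy: "((\<lambda>x. B (y x) i j) has_derivative (\<lambda>h. fD (\<lambda>y. B y i j) (y x) (y' h))) (at x)" for i j
    by (rule has_derivative_compose[OF y(1) dB[OF y(2)]])
  have "((\<lambda>y. \<Sum>i\<in>Basis. \<Sum>j\<in>Basis. (V x \<bullet> i) * (W x \<bullet> j) * B y i j) has_derivative
      (\<lambda>h. \<Sum>i\<in>Basis. \<Sum>j\<in>Basis. (V x \<bullet> i) * (W x \<bullet> j) * fD (\<lambda>y. B y i j) (y x) h)) (at (y x))"
    by (intro has_derivative_sum has_derivative_mult_right dB y)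
  then have "((\<lambda>z. B z (V x) (W x)) has_derivative
      (\<lambda>h. \<Sum>i\<in>Basis. \<Sum>j\<in>Basis. (V x \<bullet> i) * (W x \<bullet> j) * fD (\<lambda>y. B y i j) (y x) h)) (at (y x))"
    by (rule has_derivative_transform_within_open[OF _ S y(2)]) (rule exp[symmetric])
  then have fDB: "fD (\<lambda>z. B z (V x) (W x)) (y x) =
      (\<lambda>h. \<Sum>i\<in>Basis. \<Sum>j\<in>Basis. (V x \<bullet> i) * (W x \<bullet> j) * fD (\<lambda>y. B y i j) (y x) h)" by (rule fD_eqI)
  have dV: "((\<lambda>x. V x \<bullet> i) has_derivative (\<lambda>h. V' h \<bullet> i)) (at x)" for i
    by (rule has_derivative_inner_left[OF V])
  have dW: "((\<lambda>x. W x \<bullet> i) has_derivative (\<lambda>h. W' h \<bullet> i)) (at x)" for i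
    by (rule has_derivative_inner_left[OF W])
  have main: "((\<lambda>x. \<Sum>i\<in>Basis. \<Sum>j\<in>Basis. (V x \<bullet> i) * (W x \<bullet> j) * B (y x) i j) has_derivative
     (\<lambda>h. \<Sum>i\<in>Basis. \<Sum>j\<in>Basis. (V x \<bullet> i) * (W x \<bullet> j) * fD (\<lambda>y. B y i j) (y x) (y' h) +
        ((V x \<bullet> i) * (W' h \<bullet> j) + (V' h \<bullet> i) * (W x \<bullet> j)) * B (y x) i j)) (at x)"
    by (intro has_derivative_sum has_derivative_mult dV dW dBy)
  have cy: "isCont y x" using y(1) has_derivative_continuous by blast
  obtain T where T: "open T" "x \<in> T" "\<And>z. z \<in> T \<Longrightarrow> y z \<in> S"
    using cy S y(2) continuous_at_open[of x y] by metis
  have "((\<lambda>x. B (y x) (V x) (W x)) has_derivative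
     (\<lambda>h. \<Sum>i\<in>Basis. \<Sum>j\<in>Basis. (V x \<bullet> i) * (W x \<bullet> j) * fD (\<lambda>y. B y i j) (y x) (y' h) +
        ((V x \<bullet> i) * (W' h \<bullet> j) + (V' h \<bullet> i) * (W x \<bullet> j)) * B (y x) i j)) (at x)"
    by (rule has_derivative_transform_within_open[OF main T(1,2)]) (rule exp[OF T(3), symmetric])
  then show ?thesis
  proof (rule has_derivative_eq_rhs, intro ext)
    fix h
    show "(\<Sum>i\<in>Basis. \<Sum>j\<in>Basis. (V x \<bullet> i) * (W x \<bullet> j) * fD (\<lambda>y. B y i j) (y x) (y' h) +
        ((V x \<bullet> i) * (W' h \<bullet> j) + (V' h \<bullet> i) * (W x \<bullet> j)) * B (y x) i j) =
      fD (\<lambda>y. B y (V x) (W x)) (y x) (y' h) + B (y x) (V' h) (W x) + B (y x) (V x) (W' h)"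
      unfolding fDB exp[OF y(2), of "V' h" "W x"] exp[OF y(2), of "V x" "W' h"]
      by (simp add: sum.distrib distrib_right)
  qed
qed

lemma lipschitz_curves_equal:
  fixes z w :: "real \<Rightarrow> 'e::real_normed_vector"
  assumes I: "convex I" "s \<in> I" "t \<in> I" and eq: "z s = w s"
    and d: "\<And>x. x \<in> I \<Longrightarrow> (z has_vector_derivative Y (z x)) (at x within I)"
      "\<And>x. x \<in> I \<Longrightarrow> (w has_vector_derivative Y (w x)) (at x within I)"
    and K: "\<And>x. x \<in> I \<Longrightarrow> z x \<in> K \<and> w x \<in> K" "L \<ge> 0"
      "\<And>x y. x \<in> K \<Longrightarrow> y \<in> K \<Longrightarrow> norm (Y x - Y y) \<le> L * norm (x - y)"
  shows "z t = w t"
proof -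
  have "norm (z t - w t) \<le> (norm (z s - w s) + 0 * \<bar>t - s\<bar>) * exp (L * \<bar>t - s\<bar>)"
  proof (rule gronwall[OF I])
    fix x assume x: "x \<in> I"
    show "((\<lambda>x. z x - w x) has_vector_derivative Y (z x) - Y (w x)) (at x within I)"
      by (rule has_vector_derivative_diff[OF d(1)[OF x] d(2)[OF x]])
    show "norm (Y (z x) - Y (w x)) \<le> L * norm (z x - w x) + 0" using K(1)[OF x] K(3) by simp
  qed (use K in auto)
  then show ?thesis using eq by simp
qed

section \<open>Hamiltonian curves on a symplectic manifold\<close>

locale ham_system =
  fixes U :: "'m::{t2_space,second_countable_topology} set" and \<A> :: "'m chart set"
    and \<omega> :: "'m two_form" and G :: "'m \<Rightarrow> real"
  assumes manifold: "smooth_4manifold U \<A>" and symplectic: "symplectic_form \<A> \<omega>"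
    and smooth_G: "smooth_fun \<A> G"
begin

abbreviation "X \<equiv> ham_field \<omega> G"
abbreviation "curve \<equiv> ham_curve U \<A> \<omega> G"
abbreviation "overlap \<kappa> \<kappa>' \<equiv> cmap \<kappa> ` (cdom \<kappa> \<inter> cdom \<kappa>')"

lemma chart:
  assumes "\<kappa> \<in> \<A>"
  shows "open (cdom \<kappa>)" "open (cimg \<kappa>)" "continuous_on (cdom \<kappa>) (cmap \<kappa>)" "continuous_on (cimg \<kappa>) (cinv \<kappa>)"
    "inj_on (cmap \<kappa>) (cdom \<kappa>)" "cdom \<kappa> \<subseteq> U"
proof -
  have c: "is_chart \<kappa>" and u: "(\<Union>\<kappa>\<in>\<A>. cdom \<kappa>) = U"
    using manifold assms unfolding smooth_4manifold_def by auto
  then have h: "homeomorphism (cdom \<kappa>) (cimg \<kappa>) (cmap \<kappa>) (cinv \<kappa>)" by (simp add: is_chart_def)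
  show "open (cdom \<kappa>)" "open (cimg \<kappa>)" using c by (simp_all add: is_chart_def)
  show "continuous_on (cdom \<kappa>) (cmap \<kappa>)" "continuous_on (cimg \<kappa>) (cinv \<kappa>)" using h by (simp_all add: homeomorphism_def)
  show "inj_on (cmap \<kappa>) (cdom \<kappa>)" using h unfolding homeomorphism_def by (metis inj_on_inverseI)
  show "cdom \<kappa> \<subseteq> U" using u assms by blast
qed

lemma chart_inv:
  assumes "\<kappa> \<in> \<A>"
  shows "q \<in> cdom \<kappa> \<Longrightarrow> cinv \<kappa> (cmap \<kappa> q) = q" "z \<in> cimg \<kappa> \<Longrightarrow> cmap \<kappa> (cinv \<kappa> z) = z"
    "z \<in> cimg \<kappa> \<Longrightarrow> cinv \<kappa> z \<in> cdom \<kappa>"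
  using inv_into_f_f[OF chart(5)[OF assms]] by (auto simp: f_inv_into_f inv_into_into)

lemma chart_at: "p \<in> U \<Longrightarrow> \<exists>\<kappa>\<in>\<A>. p \<in> cdom \<kappa>"
  using manifold unfolding smooth_4manifold_def by auto

lemma open_chart_preimage:
  assumes "\<kappa> \<in> \<A>" "open B" shows "open {q \<in> cdom \<kappa>. cmap \<kappa> q \<in> B}"
proof -
  have "{q \<in> cdom \<kappa>. cmap \<kappa> q \<in> B} = cdom \<kappa> \<inter> cmap \<kappa> -` B" by auto
  then show ?thesis using continuous_open_preimage[OF chart(3,1)[OF assms(1)] assms(2)] by simp
qed

lemma overlap_eq: "\<kappa> \<in> \<A> \<Longrightarrow> overlap \<kappa> \<kappa>' = {z \<in> cimg \<kappa>. cinv \<kappa> z \<in> cdom \<kappa>'}"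
  using chart_inv by (auto intro!: image_eqI)

lemma open_overlap:
  assumes "\<kappa> \<in> \<A>" "\<kappa>' \<in> \<A>" shows "open (overlap \<kappa> \<kappa>')"
proof -
  have "overlap \<kappa> \<kappa>' = cimg \<kappa> \<inter> cinv \<kappa> -` cdom \<kappa>'" using overlap_eq[OF assms(1)] by auto
  then show ?thesis using continuous_open_preimage[OF chart(4,2)[OF assms(1)] chart(1)[OF assms(2)]] by simp
qed

lemma transition_smooth: "\<kappa> \<in> \<A> \<Longrightarrow> \<kappa>' \<in> \<A> \<Longrightarrow> smooth_on (overlap \<kappa> \<kappa>') (transition \<kappa> \<kappa>')"
  using manifold unfolding smooth_4manifold_def compatible_def by blast

lemma transition_mem:
  assumes "\<kappa> \<in> \<A>" "\<kappa>' \<in> \<A>" "z \<in> overlap \<kappa> \<kappa>'"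
  shows "transition \<kappa> \<kappa>' z \<in> overlap \<kappa>' \<kappa>" "transition \<kappa>' \<kappa> (transition \<kappa> \<kappa>' z) = z"
    "cinv \<kappa>' (transition \<kappa> \<kappa>' z) = cinv \<kappa> z"
  using assms chart_inv by (auto simp: transition_def)

lemma \<omega>_props:
  assumes "\<kappa> \<in> \<A>"
  shows "z \<in> cimg \<kappa> \<Longrightarrow> bilinear (\<omega> \<kappa> z)" "z \<in> cimg \<kappa> \<Longrightarrow> \<omega> \<kappa> z v v = 0"
    "z \<in> cimg \<kappa> \<Longrightarrow> v \<noteq> 0 \<Longrightarrow> \<exists>w. \<omega> \<kappa> z v w \<noteq> 0" "smooth_on (cimg \<kappa>) (\<lambda>z. \<omega> \<kappa> z v w)"
  using symplectic assms unfolding symplectic_form_def smooth_two_form_def by blast+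

lemma \<omega>_transition:
  assumes "\<kappa> \<in> \<A>" "\<kappa>' \<in> \<A>" "z \<in> overlap \<kappa> \<kappa>'"
  shows "\<omega> \<kappa>' (transition \<kappa> \<kappa>' z) (fD (transition \<kappa> \<kappa>') z v) (fD (transition \<kappa> \<kappa>') z w) = \<omega> \<kappa> z v w"
  using symplectic assms unfolding symplectic_form_def smooth_two_form_def by metis

lemma \<omega>_closed:
  assumes "\<kappa> \<in> \<A>" "z \<in> cimg \<kappa>"
  shows "fD (\<lambda>y. \<omega> \<kappa> y v w) z u + fD (\<lambda>y. \<omega> \<kappa> y w u) z v + fD (\<lambda>y. \<omega> \<kappa> y u v) z w = 0"
  using symplectic assms unfolding symplectic_form_def closed_form_def by blast

lemma smooth_chart: "smooth_fun \<A> f \<Longrightarrow> \<kappa> \<in> \<A> \<Longrightarrow> smooth_on (cimg \<kappa>) (f \<circ> cinv \<kappa>)"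
  unfolding smooth_fun_def by blast

lemma linear_dchart: "smooth_fun \<A> f \<Longrightarrow> \<kappa> \<in> \<A> \<Longrightarrow> z \<in> cimg \<kappa> \<Longrightarrow> linear (dchart \<kappa> f z)"
  unfolding dchart_def using smooth_on_linear_fD smooth_chart by blast

lemma ham_field_eq:
  assumes "smooth_fun \<A> f" "\<kappa> \<in> \<A>" "z \<in> cimg \<kappa>"
  shows "ham_field \<omega> f \<kappa> z = skew_solve (\<omega> \<kappa> z) (dchart \<kappa> f z)"
  unfolding ham_field_def
  by (rule form_dual_eq_skew_solve[OF \<omega>_props(1)[OF assms(2,3)] \<omega>_props(2)[OF assms(2,3)] \<omega>_props(3)[OF assms(2,3)] linear_dchart[OF assms]])

lemma pfaffian_\<omega>:
  assumes "\<kappa> \<in> \<A>" "z \<in> cimg \<kappa>" shows "pfaffian (\<omega> \<kappa> z) \<noteq> 0"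
  by (rule pfaffian_nonzero[OF \<omega>_props(1)[OF assms] \<omega>_props(2)[OF assms] \<omega>_props(3)[OF assms]])

lemma \<omega>_ham_field:
  assumes "smooth_fun \<A> f" "\<kappa> \<in> \<A>" "z \<in> cimg \<kappa>"
  shows "\<omega> \<kappa> z v (ham_field \<omega> f \<kappa> z) = dchart \<kappa> f z v"
  unfolding ham_field_eq[OF assms]
  by (rule skew_solve[OF \<omega>_props(1)[OF assms(2,3)] \<omega>_props(2)[OF assms(2,3)] pfaffian_\<omega>[OF assms(2,3)] linear_dchart[OF assms]])

text \<open>The description of the field by \<open>THE\<close> hides its regularity. The Pfaffian
  formula shows its components as quotients of smooth functions with non-vanishing
  denominator.\<close>

lemma smooth_ham_field:
  assumes "\<kappa> \<in> \<A>" shows "smooth_on (cimg \<kappa>) (X \<kappa>)"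
proof -
  note o = chart(2)[OF assms]
  have w: "Ck_on k (cimg \<kappa>) (\<lambda>z. \<omega> \<kappa> z v w)" for k v w using \<omega>_props(4)[OF assms] smooth_onD by blast
  have a: "Ck_on k (cimg \<kappa>) (\<lambda>z. dchart \<kappa> G z v)" for k v
    unfolding dchart_def by (rule Ck_on_partial[OF smooth_onD[OF smooth_chart[OF smooth_G assms]]])
  note pf = pfaffian_\<omega>[OF assms]
  have "Ck_on k (cimg \<kappa>) (\<lambda>z. skew_solve (\<omega> \<kappa> z) (dchart \<kappa> G z))" for k
  proof -
    have "Ck_on k (cimg \<kappa>) (\<lambda>z. pfaffian (\<omega> \<kappa> z))" unfolding pfaffian_def by (intro Ck_intros o w)
    then show ?thesis unfolding skew_solve_def by (intro Ck_intros Ck_on_divide o w a pf)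
  qed
  then have "smooth_on (cimg \<kappa>) (\<lambda>z. skew_solve (\<omega> \<kappa> z) (dchart \<kappa> G z))" by (rule smooth_onI)
  moreover have "smooth_on (cimg \<kappa>) (X \<kappa>) = smooth_on (cimg \<kappa>) (\<lambda>z. skew_solve (\<omega> \<kappa> z) (dchart \<kappa> G z))"
    by (rule smooth_on_cong[OF o]) (rule ham_field_eq[OF smooth_G assms])
  ultimately show ?thesis by simp
qed

lemma transition_inverse_derivative:
  assumes k: "\<kappa> \<in> \<A>" "\<kappa>' \<in> \<A>" and z: "z \<in> overlap \<kappa> \<kappa>'"
  shows "fD (transition \<kappa> \<kappa>') z (fD (transition \<kappa>' \<kappa>) (transition \<kappa> \<kappa>' z) v) = v"
proof -
  let ?\<tau> = "transition \<kappa> \<kappa>'" and ?\<sigma> = "transition \<kappa>' \<kappa>"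
  have d: "(?\<tau> has_derivative fD ?\<tau> z) (at (?\<sigma> (?\<tau> z)))" "(?\<sigma> has_derivative fD ?\<sigma> (?\<tau> z)) (at (?\<tau> z))"
    using smooth_on_derivative[OF transition_smooth[OF k] z]
      smooth_on_derivative[OF transition_smooth[OF k(2,1)] transition_mem(1)[OF k z]] transition_mem(2)[OF k z] by simp_all
  have "((\<lambda>y. ?\<tau> (?\<sigma> y)) has_derivative (\<lambda>v. v)) (at (?\<tau> z))"
    by (rule has_derivative_transform_within_open[OF has_derivative_ident open_overlap[OF k(2,1)] transition_mem(1)[OF k z]])
      (use transition_mem(2)[OF k(2,1)] in auto)
  from has_derivative_unique[OF has_derivative_compose[OF d(2,1)] this] show ?thesis by metis
qed

text \<open>Both sides represent \<open>dG\<close> through \<open>\<omega> \<kappa>'\<close>: the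
  form and the differential are compatible with the transition map, whose derivative is onto.
  Nondegeneracy makes the representative unique.\<close>

lemma ham_field_transition:
  assumes k: "\<kappa> \<in> \<A>" "\<kappa>' \<in> \<A>" and z: "z \<in> overlap \<kappa> \<kappa>'"
  shows "fD (transition \<kappa> \<kappa>') z (X \<kappa> z) = X \<kappa>' (transition \<kappa> \<kappa>' z)"
proof -
  let ?\<tau> = "transition \<kappa> \<kappa>'"
  have \<tau>z: "?\<tau> z \<in> overlap \<kappa>' \<kappa>" by (rule transition_mem[OF k z])
  have zi: "z \<in> cimg \<kappa>" "?\<tau> z \<in> cimg \<kappa>'" using z \<tau>z by auto
  have d\<tau>: "(?\<tau> has_derivative fD ?\<tau> z) (at z)" by (rule smooth_on_derivative[OF transition_smooth[OF k] z])
  have dG: "dchart \<kappa> G z u = dchart \<kappa>' G (?\<tau> z) (fD ?\<tau> z u)" for u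
  proof -
    have "((G \<circ> cinv \<kappa>') has_derivative dchart \<kappa>' G (?\<tau> z)) (at (?\<tau> z))"
      unfolding dchart_def by (rule smooth_on_derivative[OF smooth_chart[OF smooth_G k(2)] zi(2)])
    from has_derivative_compose[OF d\<tau> this]
    have "((G \<circ> cinv \<kappa>) has_derivative (\<lambda>u. dchart \<kappa>' G (?\<tau> z) (fD ?\<tau> z u))) (at z)"
      by (rule has_derivative_transform_within_open[OF _ open_overlap[OF k] z])
        (use transition_mem(3)[OF k] in auto)
    then show ?thesis unfolding dchart_def using fD_eqI by metis
  qed
  have "\<omega> \<kappa>' (?\<tau> z) v (fD ?\<tau> z (X \<kappa> z)) = dchart \<kappa>' G (?\<tau> z) v" for v
  proof -
    define u where "u = fD (transition \<kappa>' \<kappa>) (?\<tau> z) v"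
    have "v = fD ?\<tau> z u" using transition_inverse_derivative[OF k z] by (simp add: u_def)
    then show ?thesis using \<omega>_transition[OF k z, of u "X \<kappa> z"] \<omega>_ham_field[OF smooth_G k(1) zi(1)] dG by simp
  qed
  then have "form_dual (\<omega> \<kappa>' (?\<tau> z)) (dchart \<kappa>' G (?\<tau> z)) = fD ?\<tau> z (X \<kappa> z)"
    by (rule form_dual_eqI[OF \<omega>_props(1)[OF k(2) zi(2)] \<omega>_props(2)[OF k(2) zi(2)] \<omega>_props(3)[OF k(2) zi(2)], rotated])
  then show ?thesis by (simp add: ham_field_def)
qed

section \<open>Integral curves: construction, uniqueness, conserved quantities\<close>

text \<open>\<open>ham_curve\<close> asks for the differential equation in every chart of the
  maximal atlas. One chart containing the curve is enough, because the field transforms as a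
  vector.\<close>

lemma curveI:
  assumes k: "\<kappa> \<in> \<A>" and z: "z ` {a..b} \<subseteq> cimg \<kappa>"
    and d: "\<And>t. t \<in> {a..b} \<Longrightarrow> (z has_vector_derivative X \<kappa> (z t)) (at t within {a..b})"
  shows "curve {a..b} (\<lambda>t. cinv \<kappa> (z t))"
  unfolding ham_curve_def
proof (intro conjI ballI impI)
  have cz: "continuous_on {a..b} z" by (rule has_vector_derivative_continuous_on) (rule d)
  show "continuous_on {a..b} (\<lambda>t. cinv \<kappa> (z t))"
    by (rule continuous_on_compose2[OF chart(4)[OF k] cz z])
  have zi: "z t \<in> cimg \<kappa>" if "t \<in> {a..b}" for t using z that by (rule subsetD[OF _ imageI])
  show "(\<lambda>t. cinv \<kappa> (z t)) ` {a..b} \<subseteq> U"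
    by (rule image_subsetI) (rule subsetD[OF chart(6)[OF k] chart_inv(3)[OF k zi]])
  fix \<kappa>' t assume k': "\<kappa>' \<in> \<A>" and t: "t \<in> {a..b}" and dom: "cinv \<kappa> (z t) \<in> cdom \<kappa>'"
  let ?\<tau> = "transition \<kappa> \<kappa>'"
  have zt: "z t \<in> overlap \<kappa> \<kappa>'" unfolding overlap_eq[OF k] using dom zi[OF t] by simp
  have "(?\<tau> has_derivative fD ?\<tau> (z t)) (at (z t))" by (rule smooth_on_derivative[OF transition_smooth[OF k k'] zt])
  then have "((?\<tau> \<circ> z) has_vector_derivative fD ?\<tau> (z t) (X \<kappa> (z t))) (at t within {a..b})"
    using vector_derivative_diff_chain_within[OF d[OF t]] has_derivative_at_withinI by blast
  moreover have "?\<tau> \<circ> z = cmap \<kappa>' \<circ> (\<lambda>t. cinv \<kappa> (z t))" by (auto simp: transition_def)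
  moreover have "cmap \<kappa>' (cinv \<kappa> (z t)) = ?\<tau> (z t)" by (simp add: transition_def)
  ultimately show "(cmap \<kappa>' \<circ> (\<lambda>t. cinv \<kappa> (z t)) has_vector_derivative X \<kappa>' (cmap \<kappa>' (cinv \<kappa> (z t)))) (at t within {a..b})"
    using ham_field_transition[OF k k' zt] by simp
qed

lemma curve_nbhd:
  assumes "curve {a..b} c" "t \<in> {a..b}" "open N" "c t \<in> N"
  shows "\<exists>d>0. \<forall>s\<in>{a..b}. \<bar>s - t\<bar> < d \<longrightarrow> c s \<in> N"
proof -
  have "continuous_on {a..b} c" using assms(1) by (simp add: ham_curve_def)
  then obtain T where T: "open T" "t \<in> T" "\<forall>s\<in>{a..b}. s \<in> T \<longrightarrow> c s \<in> N"
    using assms(2-4) unfolding continuous_on_topological by metis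
  then obtain d where "d > 0" "ball t d \<subseteq> T" using openE by blast
  then show ?thesis using T(3) by (intro exI[of _ d]) (auto simp: dist_real_def subset_iff abs_minus_commute)
qed

lemma curve_derivative:
  assumes "curve {a..b} c" "\<kappa> \<in> \<A>" "t \<in> {a..b}" "c t \<in> cdom \<kappa>"
  shows "((\<lambda>s. cmap \<kappa> (c s)) has_vector_derivative X \<kappa> (cmap \<kappa> (c t))) (at t within {a..b})"
  using assms unfolding ham_curve_def comp_def by blast

lemma curve_subset:
  assumes c: "curve {a..b} c" and s: "{a'..b'} \<subseteq> {a..b}" shows "curve {a'..b'} c"
  unfolding ham_curve_def
proof (intro conjI ballI impI)
  show "continuous_on {a'..b'} c" "c ` {a'..b'} \<subseteq> U"
    using c s continuous_on_subset unfolding ham_curve_def by blast+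
  fix \<kappa> t assume "\<kappa> \<in> \<A>" "t \<in> {a'..b'}" "c t \<in> cdom \<kappa>"
  then show "(cmap \<kappa> \<circ> c has_vector_derivative X \<kappa> (cmap \<kappa> (c t))) (at t within {a'..b'})"
    using has_vector_derivative_within_subset[OF curve_derivative[OF c] s] s unfolding comp_def by blast
qed

lemma curve_unique_local:
  assumes c: "curve {a..b} c1" "curve {a..b} c2" and s: "s \<in> {a..b}" "c1 s = c2 s"
  shows "\<exists>d>0. \<forall>t\<in>{a..b}. \<bar>t - s\<bar> < d \<longrightarrow> c1 t = c2 t"
proof -
  have "c1 s \<in> U" using c(1) s(1) unfolding ham_curve_def by blast
  then obtain \<kappa> where k: "\<kappa> \<in> \<A>" "c1 s \<in> cdom \<kappa>" using chart_at by blast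
  define z0 where "z0 = cmap \<kappa> (c1 s)"
  obtain r where r: "r > 0" "cball z0 r \<subseteq> cimg \<kappa>"
    using chart(2)[OF k(1)] k(2) open_contains_cball unfolding z0_def by blast
  obtain L where L: "L \<ge> 0" "\<And>x y. x \<in> cball z0 r \<Longrightarrow> y \<in> cball z0 r \<Longrightarrow> norm (X \<kappa> x - X \<kappa> y) \<le> L * norm (x - y)"
    using C1_lipschitz[OF smooth_onD[OF smooth_ham_field[OF k(1)]] compact_cball convex_cball r(2)] by blast
  define N where "N = {q \<in> cdom \<kappa>. cmap \<kappa> q \<in> ball z0 r}"
  have N: "open N" "c1 s \<in> N" "c2 s \<in> N"
    using open_chart_preimage[OF k(1) open_ball] k(2) r s(2) by (auto simp: N_def z0_def)
  obtain d1 where d1: "d1 > 0" "\<forall>t\<in>{a..b}. \<bar>t - s\<bar> < d1 \<longrightarrow> c1 t \<in> N" using curve_nbhd[OF c(1) s(1) N(1,2)] by blast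
  obtain d2 where d2: "d2 > 0" "\<forall>t\<in>{a..b}. \<bar>t - s\<bar> < d2 \<longrightarrow> c2 t \<in> N" using curve_nbhd[OF c(2) s(1) N(1,3)] by blast
  show ?thesis
  proof (intro exI[of _ "min d1 d2"] conjI ballI impI)
    fix t assume t: "t \<in> {a..b}" "\<bar>t - s\<bar> < min d1 d2"
    define I where "I = {a..b} \<inter> ball s (min d1 d2)"
    have I: "convex I" "s \<in> I" "t \<in> I" "I \<subseteq> {a..b}"
      using s t d1 d2 by (auto simp: I_def dist_real_def abs_minus_commute intro!: convex_Int)
    have cN: "c1 x \<in> N" "c2 x \<in> N" "x \<in> {a..b}" if "x \<in> I" for x
      using that d1 d2 by (auto simp: I_def dist_real_def abs_minus_commute)
    have "cmap \<kappa> (c1 t) = cmap \<kappa> (c2 t)"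
    proof (rule lipschitz_curves_equal[OF I(1-3), where Y="X \<kappa>" and K="cball z0 r" and L=L])
      fix x assume x: "x \<in> I"
      show "((\<lambda>s. cmap \<kappa> (c1 s)) has_vector_derivative X \<kappa> (cmap \<kappa> (c1 x))) (at x within I)"
        by (rule has_vector_derivative_within_subset[OF curve_derivative[OF c(1) k(1)] I(4)])
          (use cN[OF x] in \<open>auto simp: N_def\<close>)
      show "((\<lambda>s. cmap \<kappa> (c2 s)) has_vector_derivative X \<kappa> (cmap \<kappa> (c2 x))) (at x within I)"
        by (rule has_vector_derivative_within_subset[OF curve_derivative[OF c(2) k(1)] I(4)])
          (use cN[OF x] in \<open>auto simp: N_def\<close>)
      show "cmap \<kappa> (c1 x) \<in> cball z0 r \<and> cmap \<kappa> (c2 x) \<in> cball z0 r"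
        using cN[OF x] by (auto simp: N_def)
    qed (use s L in auto)
    then show "c1 t = c2 t" using chart(5)[OF k(1)] cN[OF I(3)] by (auto simp: N_def inj_on_def)
  qed (use d1 d2 in auto)
qed

text \<open>An open-closed argument on a connected interval: the coincidence set is relatively open
  by local uniqueness, its complement because the manifold is Hausdorff.\<close>

lemma curve_unique:
  assumes c: "curve {a..b} c1" "curve {a..b} c2" and s: "s \<in> {a..b}" "c1 s = c2 s" and t: "t \<in> {a..b}"
  shows "c1 t = c2 t"
proof (rule ccontr)
  assume ne: "c1 t \<noteq> c2 t"
  let ?E = "{x \<in> {a..b}. c1 x = c2 x}" and ?F = "{x \<in> {a..b}. c1 x \<noteq> c2 x}"
  have "openin (top_of_set {a..b}) ?E"
    unfolding openin_euclidean_subtopology_iff dist_real_def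
    using curve_unique_local[OF c] by fastforce
  moreover have "openin (top_of_set {a..b}) ?F"
    unfolding openin_euclidean_subtopology_iff dist_real_def
  proof (intro conjI ballI)
    fix x assume x: "x \<in> ?F"
    then obtain N1 N2 where N: "open N1" "open N2" "c1 x \<in> N1" "c2 x \<in> N2" "N1 \<inter> N2 = {}"
      using hausdorff[of "c1 x" "c2 x"] by auto
    obtain d1 where d1: "d1 > 0" "\<forall>t\<in>{a..b}. \<bar>t - x\<bar> < d1 \<longrightarrow> c1 t \<in> N1" using curve_nbhd[OF c(1) _ N(1,3)] x by blast
    obtain d2 where d2: "d2 > 0" "\<forall>t\<in>{a..b}. \<bar>t - x\<bar> < d2 \<longrightarrow> c2 t \<in> N2" using curve_nbhd[OF c(2) _ N(2,4)] x by blast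
    show "\<exists>e>0. \<forall>x'\<in>{a..b}. \<bar>x' - x\<bar> < e \<longrightarrow> x' \<in> ?F"
    proof (intro exI[of _ "min d1 d2"] conjI ballI impI)
      fix x' assume "x' \<in> {a..b}" "\<bar>x' - x\<bar> < min d1 d2"
      then show "x' \<in> ?F" using d1 d2 N(5) by fastforce
    qed (use d1 d2 in auto)
  qed auto
  moreover have "{a..b} \<subseteq> ?E \<union> ?F" "?E \<inter> ?F = {}" by auto
  moreover have "?E \<noteq> {}" "?F \<noteq> {}" using s t ne by auto
  moreover have "connected {a..b}" by simp
  ultimately show False unfolding connected_openin by blast
qed

lemma curve_conserved:
  assumes c: "curve {a..b} c" and f: "smooth_fun \<A> f"
    and z: "\<And>\<kappa> z. \<kappa> \<in> \<A> \<Longrightarrow> z \<in> cimg \<kappa> \<Longrightarrow> dchart \<kappa> f z (X \<kappa> z) = 0" and st: "s \<in> {a..b}" "t \<in> {a..b}"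
  shows "f (c s) = f (c t)"
proof -
  have "((\<lambda>x. f (c x)) has_derivative (\<lambda>_. 0)) (at x within {a..b})" if x: "x \<in> {a..b}" for x
  proof -
    have "c x \<in> U" using c x unfolding ham_curve_def by blast
    then obtain \<kappa> where k: "\<kappa> \<in> \<A>" "c x \<in> cdom \<kappa>" using chart_at by blast
    obtain d where d: "d > 0" "\<forall>t\<in>{a..b}. \<bar>t - x\<bar> < d \<longrightarrow> c t \<in> cdom \<kappa>"
      using curve_nbhd[OF c x chart(1)[OF k(1)] k(2)] by blast
    let ?z = "cmap \<kappa> (c x)"
    have zi: "?z \<in> cimg \<kappa>" using k by blast
    have "((f \<circ> cinv \<kappa>) has_derivative dchart \<kappa> f ?z) (at ?z)"
      unfolding dchart_def by (rule smooth_on_derivative[OF smooth_chart[OF f k(1)] zi])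
    then have "(((f \<circ> cinv \<kappa>) \<circ> (\<lambda>s. cmap \<kappa> (c s))) has_vector_derivative dchart \<kappa> f ?z (X \<kappa> ?z)) (at x within {a..b})"
      by (rule vector_derivative_diff_chain_within[OF curve_derivative[OF c k(1) x k(2)] has_derivative_at_withinI])
    then have *: "(((f \<circ> cinv \<kappa>) \<circ> (\<lambda>s. cmap \<kappa> (c s))) has_derivative (\<lambda>_. 0)) (at x within {a..b})"
      using z[OF k(1) zi] by (simp add: has_vector_derivative_def)
    show ?thesis
      by (rule has_derivative_transform_within[OF * d(1) x])
        (use d(2) chart_inv(1)[OF k(1)] in \<open>auto simp: dist_real_def\<close>)
  qed
  then have "\<exists>k. \<forall>x\<in>{a..b}. f (c x) = k" by (intro has_derivative_zero_constant) auto
  then show ?thesis using st by auto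
qed

end

lemma open_continuous_preimage:
  assumes "open S" "continuous_on S f" "open T" shows "open {x \<in> S. f x \<in> T}"
proof -
  have "{x \<in> S. f x \<in> T} = S \<inter> f -` T" by auto
  then show ?thesis using continuous_open_preimage[OF assms(2,1,3)] by simp
qed

lemma second_derivative_symmetric_vector:
  fixes f :: "'a::euclidean_space \<Rightarrow> 'b::euclidean_space"
  assumes S: "open S" and f: "smooth_on S f" and x: "x \<in> S"
  shows "fD (\<lambda>z. fD f z u) x v = fD (\<lambda>z. fD f z v) x u"
proof (rule euclidean_eqI)
  fix i :: 'b assume "i \<in> Basis"
  have fi: "fD (\<lambda>z. f z \<bullet> i) z = (\<lambda>v. fD f z v \<bullet> i)" if "z \<in> S" for z
    by (rule fD_eqI[OF has_derivative_inner_left[OF smooth_on_derivative[OF f that]]])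
  have "fD (\<lambda>z. fD (\<lambda>z. f z \<bullet> i) z u) x v = fD (\<lambda>z. fD (\<lambda>z. f z \<bullet> i) z v) x u"
    by (rule second_derivative_symmetric[OF S Ck_on_inner_left[OF S smooth_onD[OF f]] x])
  moreover have "fD (\<lambda>z. fD (\<lambda>z. f z \<bullet> i) z u) x v = fD (\<lambda>z. fD f z u) x v \<bullet> i" for u v
  proof -
    have "fD (\<lambda>z. fD (\<lambda>z. f z \<bullet> i) z u) x = fD (\<lambda>z. fD f z u \<bullet> i) x"
      by (rule fD_cong_open[OF S x]) (simp add: fi)
    also have "\<dots> = (\<lambda>v. fD (\<lambda>z. fD f z u) x v \<bullet> i)"
      by (rule fD_eqI[OF has_derivative_inner_left[OF smooth_on_derivative[OF smooth_on_partial[OF f] x]]])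
    finally show ?thesis by simp
  qed
  ultimately show "fD (\<lambda>z. fD f z u) x v \<bullet> i = fD (\<lambda>z. fD f z v) x u \<bullet> i" by simp
qed

section \<open>Derivatives of a flow\<close>

lemma flow_time_derivative:
  fixes \<Phi> :: "real \<times> 'e::euclidean_space \<Rightarrow> 'e"
  assumes \<Phi>: "smooth_on D \<Phi>" and q: "(t, p) \<in> D"
    and ode: "((\<lambda>t. \<Phi> (t, p)) has_vector_derivative Y) (at t)"
  shows "fD \<Phi> (t, p) (1, 0) = Y"
proof -
  have "((\<lambda>t. (t, p)) has_derivative (\<lambda>c. (c, 0))) (at t)" by (auto intro!: derivative_eq_intros)
  from has_derivative_compose[OF this smooth_on_derivative[OF \<Phi> q]]
  have "(\<lambda>c. fD \<Phi> (t, p) (c, 0)) = (\<lambda>c. c *\<^sub>R Y)"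
    using has_derivative_unique ode unfolding has_vector_derivative_def by blast
  then show ?thesis by (metis scaleR_one)
qed

text \<open>Symmetry of second derivatives exchanges the time derivative with the derivative in the
  initial point; what remains is the chain rule for \<open>Y\<close> after
  \<open>\<Phi>\<close>.\<close>

lemma flow_variational_equation:
  fixes \<Phi> :: "real \<times> 'e::euclidean_space \<Rightarrow> 'e"
  assumes D: "open D" and \<Phi>: "smooth_on D \<Phi>" and S: "open S" "smooth_on S Y" "\<And>q. q \<in> D \<Longrightarrow> \<Phi> q \<in> S"
    and ode: "\<And>t p. (t, p) \<in> D \<Longrightarrow> ((\<lambda>t. \<Phi> (t, p)) has_vector_derivative Y (\<Phi> (t, p))) (at t)"
    and q: "(t, p) \<in> D"
  shows "((\<lambda>t. fD \<Phi> (t, p) (0, v)) has_vector_derivative fD Y (\<Phi> (t, p)) (fD \<Phi> (t, p) (0, v))) (at t)"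
proof -
  have 1: "fD \<Phi> z (1, 0) = Y (\<Phi> z)" if "z \<in> D" for z
    using flow_time_derivative[OF \<Phi> _ ode, of "fst z" "snd z"] that by simp
  have "fD (\<lambda>z. fD \<Phi> z (0, v)) (t, p) (1, 0) = fD (\<lambda>z. fD \<Phi> z (1, 0)) (t, p) (0, v)"
    by (rule second_derivative_symmetric_vector[OF D \<Phi> q])
  also have "\<dots> = fD (\<lambda>z. Y (\<Phi> z)) (t, p) (0, v)"
    using fD_cong_open[OF D q, of "\<lambda>z. fD \<Phi> z (1, 0)" "\<lambda>z. Y (\<Phi> z)"] 1 by simp
  also have "\<dots> = fD Y (\<Phi> (t, p)) (fD \<Phi> (t, p) (0, v))"
    using fD_eqI[OF has_derivative_compose[OF smooth_on_derivative[OF \<Phi> q] smooth_on_derivative[OF S(2,3)]]] q by simp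
  finally have eq: "fD (\<lambda>z. fD \<Phi> z (0, v)) (t, p) (1, 0) = fD Y (\<Phi> (t, p)) (fD \<Phi> (t, p) (0, v))" .
  have "((\<lambda>t. (t, p)) has_derivative (\<lambda>c. (c, 0))) (at t)" by (auto intro!: derivative_eq_intros)
  from has_derivative_compose[OF this smooth_on_derivative[OF smooth_on_partial[OF \<Phi>] q]]
  have d: "((\<lambda>t. fD \<Phi> (t, p) (0, v)) has_derivative (\<lambda>c. fD (\<lambda>z. fD \<Phi> z (0, v)) (t, p) (c, 0))) (at t)" .
  have lin: "linear (fD (\<lambda>z. fD \<Phi> z (0, v)) (t, p))"
    by (rule smooth_on_linear_fD[OF smooth_on_partial[OF \<Phi>] q])
  have "fD (\<lambda>z. fD \<Phi> z (0, v)) (t, p) (c, 0) = c *\<^sub>R fD (\<lambda>z. fD \<Phi> z (0, v)) (t, p) (1, 0)" for c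
    using linear_cmul[OF lin, of c "(1, 0)"] by simp
  then show ?thesis using d eq by (simp add: has_vector_derivative_def)
qed

lemma flow_initial_derivative:
  fixes \<Phi> :: "real \<times> 'e::euclidean_space \<Rightarrow> 'f::real_normed_vector"
  assumes \<Phi>: "smooth_on D \<Phi>" and q: "(t, p) \<in> D"
  shows "((\<lambda>p. \<Phi> (t, p)) has_derivative (\<lambda>v. fD \<Phi> (t, p) (0, v))) (at p)"
proof -
  have "((\<lambda>p. (t, p)) has_derivative (\<lambda>v. (0, v))) (at p)" by (auto intro!: derivative_eq_intros)
  from has_derivative_compose[OF this smooth_on_derivative[OF \<Phi> q]] show ?thesis .
qed

lemma has_vector_derivative_Un:
  assumes "(f has_vector_derivative d) (at x within A)" "(f has_vector_derivative d) (at x within B)"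
  shows "(f has_vector_derivative d) (at x within A \<union> B)"
  using assms unfolding has_vector_derivative_def has_derivative_within Lim_within_Un by blast

text \<open>The filter is trivial there, so every vector is a derivative. This lets a concatenated
  curve be treated on the union of two closed intervals without distinguishing the position of
  \<open>x\<close>.\<close>

lemma has_vector_derivative_outside_closed:
  assumes "closed A" "x \<notin> A" shows "(f has_vector_derivative d) (at x within A)"
proof -
  have "at x within A = bot" using assms by (simp add: at_within_eq_bot_iff closure_closed)
  then show ?thesis by (simp add: has_vector_derivative_def has_derivative_def bounded_linear_scaleR_left)
qed

section \<open>The Hamiltonian flow preserves the symplectic form\<close>

context ham_system
begin

text \<open>Cartan's formula for the Lie derivative of \<open>\<omega>\<close> along
  \<open>X\<close>, evaluated on constant fields. The contraction of \<open>\<omega>\<close> with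
  \<open>X\<close> is \<open>dG\<close> up to sign, closed by symmetry of second derivatives, and
  \<open>\<omega>\<close> itself is closed.\<close>

lemma lie_derivative_\<omega>:
  assumes k: "\<kappa> \<in> \<A>" and z: "z \<in> cimg \<kappa>"
  shows "fD (\<lambda>y. \<omega> \<kappa> y V W) z (X \<kappa> z) + \<omega> \<kappa> z (fD (X \<kappa>) z V) W + \<omega> \<kappa> z V (fD (X \<kappa>) z W) = 0"
proof -
  note o = chart(2)[OF k] and wp = \<omega>_props[OF k]
  note bil = wp(1)[OF z]
  let ?D = "\<lambda>v u. fD (\<lambda>x. dchart \<kappa> G x v) z u"
  \<comment> \<open>The defining identity \<open>\<omega> (v, X) = dG v\<close> with constant
    \<open>v\<close>, differentiated in direction \<open>h\<close>.\<close>
  have key: "?D v h = fD (\<lambda>y. \<omega> \<kappa> y v (X \<kappa> z)) z h + \<omega> \<kappa> z v (fD (X \<kappa>) z h)" for v h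
  proof -
    have "((\<lambda>x. \<omega> \<kappa> x v (X \<kappa> x)) has_derivative
       (\<lambda>h. fD (\<lambda>y. \<omega> \<kappa> y v (X \<kappa> z)) z h + \<omega> \<kappa> z 0 (X \<kappa> z) + \<omega> \<kappa> z v (fD (X \<kappa>) z h))) (at z)"
      by (rule has_derivative_bilinear_family[OF o wp(1,4) has_derivative_ident z has_derivative_const
          smooth_on_derivative[OF smooth_ham_field[OF k] z]])
    then have "((\<lambda>x. dchart \<kappa> G x v) has_derivative
       (\<lambda>h. fD (\<lambda>y. \<omega> \<kappa> y v (X \<kappa> z)) z h + \<omega> \<kappa> z 0 (X \<kappa> z) + \<omega> \<kappa> z v (fD (X \<kappa>) z h))) (at z)"
      by (rule has_derivative_transform_within_open[OF _ o z]) (rule \<omega>_ham_field[OF smooth_G k])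
    from fD_eqI[OF this] show ?thesis by (simp add: bilinear_lzero[OF bil])
  qed
  have sym: "?D V W = ?D W V" unfolding dchart_def
    by (rule second_derivative_symmetric[OF o smooth_onD[OF smooth_chart[OF smooth_G k]] z])
  have sk: "\<omega> \<kappa> z v w = - \<omega> \<kappa> z w v" for v w by (rule skew_swap[OF bil wp(2)[OF z]])
  have skD: "fD (\<lambda>y. \<omega> \<kappa> y v w) z u = - fD (\<lambda>y. \<omega> \<kappa> y w v) z u" for u v w
  proof -
    have "((\<lambda>y. - \<omega> \<kappa> y w v) has_derivative (\<lambda>u. - fD (\<lambda>y. \<omega> \<kappa> y w v) z u)) (at z)"
      by (rule has_derivative_minus[OF smooth_on_derivative[OF wp(4) z]])
    then have "((\<lambda>y. \<omega> \<kappa> y v w) has_derivative (\<lambda>u. - fD (\<lambda>y. \<omega> \<kappa> y w v) z u)) (at z)"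
      by (rule has_derivative_transform_within_open[OF _ o z]) (use skew_swap[OF wp(1,2), of _ v w] in auto)
    from fD_eqI[OF this] show ?thesis by simp
  qed
  have "fD (\<lambda>y. \<omega> \<kappa> y V W) z (X \<kappa> z) + fD (\<lambda>y. \<omega> \<kappa> y W (X \<kappa> z)) z V + fD (\<lambda>y. \<omega> \<kappa> y (X \<kappa> z) V) z W = 0"
    by (rule \<omega>_closed[OF k z])
  then show ?thesis
    using key[of V W] key[of W V] sym sk[of "fD (X \<kappa>) z V" W] skD[of "X \<kappa> z" V W] by linarith
qed

text \<open>By the variational equation the time derivative of the pulled-back form is the Lie
  derivative of \<open>\<omega>\<close> on the transported vectors, which is zero; at time 0 the
  flow is the identity.\<close>

lemma flow_symplectic:
  assumes k: "\<kappa> \<in> \<A>" and a: "0 < a" and B: "open B" and \<Phi>: "smooth_on ({-a<..<a} \<times> B) \<Phi>"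
    and \<Phi>0: "\<And>p. p \<in> B \<Longrightarrow> \<Phi> (0, p) = p"
    and mem: "\<And>t p. t \<in> {-a<..<a} \<Longrightarrow> p \<in> B \<Longrightarrow> \<Phi> (t, p) \<in> cimg \<kappa>"
    and ode: "\<And>t p. t \<in> {-a<..<a} \<Longrightarrow> p \<in> B \<Longrightarrow>
       ((\<lambda>t. \<Phi> (t, p)) has_vector_derivative X \<kappa> (\<Phi> (t, p))) (at t)"
    and t: "t \<in> {-a<..<a}" and p: "p \<in> B"
  shows "\<omega> \<kappa> (\<Phi> (t, p)) (fD \<Phi> (t, p) (0, v)) (fD \<Phi> (t, p) (0, w)) = \<omega> \<kappa> p v w"
proof -
  let ?J = "{-a<..<a}"
  have D: "open (?J \<times> B)" by (rule open_Times[OF _ B]) simp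
  note o = chart(2)[OF k] and wp = \<omega>_props[OF k]
  define h where "h = (\<lambda>t. \<omega> \<kappa> (\<Phi> (t, p)) (fD \<Phi> (t, p) (0, v)) (fD \<Phi> (t, p) (0, w)))"
  have "(h has_derivative (\<lambda>_. 0)) (at s within ?J)" if s: "s \<in> ?J" for s
  proof -
    have sp: "(s, p) \<in> ?J \<times> B" using s p by simp
    let ?z = "\<Phi> (s, p)"
    have mz: "?z \<in> cimg \<kappa>" by (rule mem[OF s p])
    have var: "((\<lambda>t. fD \<Phi> (t, p) (0, v)) has_derivative (\<lambda>c. c *\<^sub>R fD (X \<kappa>) ?z (fD \<Phi> (s, p) (0, v)))) (at s)" for v
      unfolding has_vector_derivative_def[symmetric]
      by (rule flow_variational_equation[OF D \<Phi> o smooth_ham_field[OF k] _ _ sp]) (use mem ode in auto)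
    have y: "((\<lambda>t. \<Phi> (t, p)) has_derivative (\<lambda>c. c *\<^sub>R X \<kappa> ?z)) (at s)"
      using ode[OF s p] by (simp add: has_vector_derivative_def)
    let ?V = "fD \<Phi> (s, p) (0, v)" and ?W = "fD \<Phi> (s, p) (0, w)"
    have "(h has_derivative (\<lambda>c. fD (\<lambda>y. \<omega> \<kappa> y ?V ?W) ?z (c *\<^sub>R X \<kappa> ?z) +
        \<omega> \<kappa> ?z (c *\<^sub>R fD (X \<kappa>) ?z ?V) ?W + \<omega> \<kappa> ?z ?V (c *\<^sub>R fD (X \<kappa>) ?z ?W))) (at s)"
      unfolding h_def by (rule has_derivative_bilinear_family[OF o wp(1,4) y mz var var])
    moreover have "fD (\<lambda>y. \<omega> \<kappa> y ?V ?W) ?z (c *\<^sub>R X \<kappa> ?z) +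
        \<omega> \<kappa> ?z (c *\<^sub>R fD (X \<kappa>) ?z ?V) ?W + \<omega> \<kappa> ?z ?V (c *\<^sub>R fD (X \<kappa>) ?z ?W) = 0" for c
    proof -
      have "fD (\<lambda>y. \<omega> \<kappa> y ?V ?W) ?z (c *\<^sub>R X \<kappa> ?z) +
        \<omega> \<kappa> ?z (c *\<^sub>R fD (X \<kappa>) ?z ?V) ?W + \<omega> \<kappa> ?z ?V (c *\<^sub>R fD (X \<kappa>) ?z ?W) =
        c * (fD (\<lambda>y. \<omega> \<kappa> y ?V ?W) ?z (X \<kappa> ?z) + \<omega> \<kappa> ?z (fD (X \<kappa>) ?z ?V) ?W + \<omega> \<kappa> ?z ?V (fD (X \<kappa>) ?z ?W))"
        by (simp add: linear_cmul[OF smooth_on_linear_fD[OF wp(4) mz]] bilinear_lmul[OF wp(1)[OF mz]]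
          bilinear_rmul[OF wp(1)[OF mz]] distrib_left)
      also have "\<dots> = 0" by (simp add: lie_derivative_\<omega>[OF k mz])
      finally show ?thesis .
    qed
    ultimately show ?thesis using has_derivative_at_withinI by simp
  qed
  then have "\<exists>c. \<forall>s\<in>?J. h s = c" by (intro has_derivative_zero_constant) auto
  then have "h t = h 0" using t a by auto
  moreover have "fD \<Phi> (0, p) (0, v) = v" for v
  proof -
    have "(0, p) \<in> ?J \<times> B" using a p by simp
    from flow_initial_derivative[OF \<Phi> this]
    have "((\<lambda>p. p) has_derivative (\<lambda>v. fD \<Phi> (0, p) (0, v))) (at p)"
      by (rule has_derivative_transform_within_open[OF _ B p]) (rule \<Phi>0)
    from has_derivative_unique[OF this has_derivative_ident] show ?thesis by metis
  qed
  ultimately show ?thesis using \<Phi>0[OF p] by (simp add: h_def)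
qed

text \<open>At the junction both one-sided velocities are the value of the field at the common
  point, so the two derivatives fit together.\<close>

lemma curve_concat:
  assumes c1: "curve {a..b} c1" and c2: "curve {b..d} c2" and eq: "c1 b = c2 b" and ab: "a \<le> b" "b \<le> d"
  shows "curve {a..d} (\<lambda>t. if t \<le> b then c1 t else c2 t)" (is "curve _ ?c")
  unfolding ham_curve_def
proof (intro conjI ballI impI)
  have un: "{a..d} = {a..b} \<union> {b..d}" using ab by auto
  have e1: "?c t = c1 t" if "t \<in> {a..b}" for t using that by simp
  have e2: "?c t = c2 t" if "t \<in> {b..d}" for t using that eq by auto
  have cc: "continuous_on {a..b} c1" "continuous_on {b..d} c2" using c1 c2 by (simp_all add: ham_curve_def)
  have "continuous_on {a..b} ?c" by (rule continuous_on_eq[OF cc(1) e1[symmetric]])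
  moreover have "continuous_on {b..d} ?c" by (rule continuous_on_eq[OF cc(2) e2[symmetric]])
  ultimately show "continuous_on {a..d} ?c" unfolding un by (intro continuous_on_closed_Un) auto
  have cU: "c1 t \<in> U" if "t \<in> {a..b}" for t using c1 that unfolding ham_curve_def by blast
  have cU2: "c2 t \<in> U" if "t \<in> {b..d}" for t using c2 that unfolding ham_curve_def by blast
  show "?c ` {a..d} \<subseteq> U"
  proof (rule image_subsetI)
    fix t assume "t \<in> {a..d}"
    then show "?c t \<in> U" using cU[of t] cU2[of t] by auto
  qed
  fix \<kappa> t assume k: "\<kappa> \<in> \<A>" and t: "t \<in> {a..d}" and dom: "?c t \<in> cdom \<kappa>"
  have "((\<lambda>t. cmap \<kappa> (?c t)) has_vector_derivative X \<kappa> (cmap \<kappa> (?c t))) (at t within {a..b})"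
  proof (cases "t \<in> {a..b}")
    case True
    then have "c1 t \<in> cdom \<kappa>" using dom e1 by metis
    from curve_derivative[OF c1 k True this]
    have "((\<lambda>t. cmap \<kappa> (c1 t)) has_vector_derivative X \<kappa> (cmap \<kappa> (?c t))) (at t within {a..b})"
      unfolding e1[OF True] .
    then show ?thesis by (rule has_vector_derivative_transform[OF True, rotated]) (simp add: e1)
  qed (rule has_vector_derivative_outside_closed, auto)
  moreover have "((\<lambda>t. cmap \<kappa> (?c t)) has_vector_derivative X \<kappa> (cmap \<kappa> (?c t))) (at t within {b..d})"
  proof (cases "t \<in> {b..d}")
    case True
    then have "c2 t \<in> cdom \<kappa>" using dom e2 by metis
    from curve_derivative[OF c2 k True this]
    have "((\<lambda>t. cmap \<kappa> (c2 t)) has_vector_derivative X \<kappa> (cmap \<kappa> (?c t))) (at t within {b..d})"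
      unfolding e2[OF True] .
    then show ?thesis by (rule has_vector_derivative_transform[OF True, rotated]) (simp add: e2)
  qed (rule has_vector_derivative_outside_closed, auto)
  ultimately show "(cmap \<kappa> \<circ> ?c has_vector_derivative X \<kappa> (cmap \<kappa> (?c t))) (at t within {a..d})"
    unfolding un comp_def by (rule has_vector_derivative_Un)
qed

section \<open>Symplectic transport along an integral curve\<close>

text \<open>The tube \<open>Q\<close> around the graph of \<open>\<gamma>\<close> controls the intermediate times in a way that is stable
  under composition.\<close>

definition transport :: "(real \<Rightarrow> 'm) \<Rightarrow> real \<Rightarrow> real \<Rightarrow> bool" where
  "transport \<gamma> a b \<longleftrightarrow> (\<forall>\<kappa>1\<in>\<A>. \<forall>\<kappa>2\<in>\<A>. \<forall>Q. \<gamma> a \<in> cdom \<kappa>1 \<and> \<gamma> b \<in> cdom \<kappa>2 \<and> open Q \<and> (\<forall>t\<in>{a..b}. (t, \<gamma> t) \<in> Q) \<longrightarrow>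
    (\<exists>W M. open W \<and> cmap \<kappa>1 (\<gamma> a) \<in> W \<and> W \<subseteq> cimg \<kappa>1 \<and> smooth_on W M \<and> M ` W \<subseteq> cimg \<kappa>2 \<and>
       M (cmap \<kappa>1 (\<gamma> a)) = cmap \<kappa>2 (\<gamma> b) \<and>
       (\<forall>z\<in>W. \<forall>v w. \<omega> \<kappa>2 (M z) (fD M z v) (fD M z w) = \<omega> \<kappa>1 z v w) \<and>
       (\<forall>z\<in>W. \<exists>c. curve {a..b} c \<and> c a = cinv \<kappa>1 z \<and> c b = cinv \<kappa>2 (M z) \<and> (\<forall>t\<in>{a..b}. (t, c t) \<in> Q))))"

text \<open>As \<open>transport\<close> quantifies over all charts at both ends, any chart around
  the middle point serves as target of the first half and source of the second.\<close>

lemma transport_trans: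
  assumes ab: "a \<le> b" "b \<le> d" and b: "\<gamma> b \<in> U" and t1: "transport \<gamma> a b" and t2: "transport \<gamma> b d"
  shows "transport \<gamma> a d"
  unfolding transport_def
proof (intro ballI allI impI, elim conjE)
  fix \<kappa>1 \<kappa>2 Q assume k: "\<kappa>1 \<in> \<A>" "\<kappa>2 \<in> \<A>" and ga: "\<gamma> a \<in> cdom \<kappa>1" and gd: "\<gamma> d \<in> cdom \<kappa>2"
    and Q: "open Q" "\<forall>t\<in>{a..d}. (t, \<gamma> t) \<in> Q"
  obtain \<kappa> where k': "\<kappa> \<in> \<A>" "\<gamma> b \<in> cdom \<kappa>" using chart_at[OF b] by blast
  have Q1: "\<forall>t\<in>{a..b}. (t, \<gamma> t) \<in> Q" and Q2: "\<forall>t\<in>{b..d}. (t, \<gamma> t) \<in> Q" using Q(2) ab by auto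
  obtain W1 M1 where W1: "open W1" "cmap \<kappa>1 (\<gamma> a) \<in> W1" "W1 \<subseteq> cimg \<kappa>1" "smooth_on W1 M1" "M1 ` W1 \<subseteq> cimg \<kappa>"
    "M1 (cmap \<kappa>1 (\<gamma> a)) = cmap \<kappa> (\<gamma> b)" "\<forall>z\<in>W1. \<forall>v w. \<omega> \<kappa> (M1 z) (fD M1 z v) (fD M1 z w) = \<omega> \<kappa>1 z v w"
    "\<forall>z\<in>W1. \<exists>c. curve {a..b} c \<and> c a = cinv \<kappa>1 z \<and> c b = cinv \<kappa> (M1 z) \<and> (\<forall>t\<in>{a..b}. (t, c t) \<in> Q)"
    using t1[unfolded transport_def, rule_format, OF k(1) k'(1), of Q] ga k'(2) Q(1) Q1 by blast
  obtain W2 M2 where W2: "open W2" "cmap \<kappa> (\<gamma> b) \<in> W2" "W2 \<subseteq> cimg \<kappa>" "smooth_on W2 M2" "M2 ` W2 \<subseteq> cimg \<kappa>2"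
    "M2 (cmap \<kappa> (\<gamma> b)) = cmap \<kappa>2 (\<gamma> d)" "\<forall>z\<in>W2. \<forall>v w. \<omega> \<kappa>2 (M2 z) (fD M2 z v) (fD M2 z w) = \<omega> \<kappa> z v w"
    "\<forall>z\<in>W2. \<exists>c. curve {b..d} c \<and> c b = cinv \<kappa> z \<and> c d = cinv \<kappa>2 (M2 z) \<and> (\<forall>t\<in>{b..d}. (t, c t) \<in> Q)"
    using t2[unfolded transport_def, rule_format, OF k'(1) k(2), of Q] gd k'(2) Q(1) Q2 by blast
  define W where "W = {z \<in> W1. M1 z \<in> W2}"
  have W: "open W" unfolding W_def by (rule open_continuous_preimage[OF W1(1) smooth_on_continuous[OF W1(4)] W2(1)])
  have W1s: "W \<subseteq> W1" by (auto simp: W_def)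
  have sm: "smooth_on W (\<lambda>z. M2 (M1 z))"
    by (rule smooth_on_compose[OF W W2(1) smooth_on_subset[OF W1(4) W1s] W2(4)]) (auto simp: W_def)
  have der: "fD (\<lambda>z. M2 (M1 z)) z v = fD M2 (M1 z) (fD M1 z v)" if "z \<in> W" for z v
    using fD_eqI[OF has_derivative_compose[OF smooth_on_derivative[OF W1(4)] smooth_on_derivative[OF W2(4)]]] that
    by (simp add: W_def)
  show "\<exists>W M. open W \<and> cmap \<kappa>1 (\<gamma> a) \<in> W \<and> W \<subseteq> cimg \<kappa>1 \<and> smooth_on W M \<and> M ` W \<subseteq> cimg \<kappa>2 \<and>
       M (cmap \<kappa>1 (\<gamma> a)) = cmap \<kappa>2 (\<gamma> d) \<and>
       (\<forall>z\<in>W. \<forall>v w. \<omega> \<kappa>2 (M z) (fD M z v) (fD M z w) = \<omega> \<kappa>1 z v w) \<and>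
       (\<forall>z\<in>W. \<exists>c. curve {a..d} c \<and> c a = cinv \<kappa>1 z \<and> c d = cinv \<kappa>2 (M z) \<and> (\<forall>t\<in>{a..d}. (t, c t) \<in> Q))"
  proof (intro exI[of _ W] exI[of _ "\<lambda>z. M2 (M1 z)"] conjI ballI allI W sm)
    show "cmap \<kappa>1 (\<gamma> a) \<in> W" using W1(2,6) W2(2) by (simp add: W_def)
    show "W \<subseteq> cimg \<kappa>1" using W1s W1(3) by blast
    show "(\<lambda>z. M2 (M1 z)) ` W \<subseteq> cimg \<kappa>2" using W2(5) by (auto simp: W_def)
    show "M2 (M1 (cmap \<kappa>1 (\<gamma> a))) = cmap \<kappa>2 (\<gamma> d)" using W1(6) W2(6) by simp
  next
    fix z v w assume z: "z \<in> W"
    then have zz: "z \<in> W1" "M1 z \<in> W2" by (simp_all add: W_def)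
    show "\<omega> \<kappa>2 (M2 (M1 z)) (fD (\<lambda>z. M2 (M1 z)) z v) (fD (\<lambda>z. M2 (M1 z)) z w) = \<omega> \<kappa>1 z v w"
      unfolding der[OF z] using W1(7)[rule_format, OF zz(1), of v w]
        W2(7)[rule_format, OF zz(2), of "fD M1 z v" "fD M1 z w"] by (simp only:)
  next
    fix z assume z: "z \<in> W"
    then obtain c1 where c1: "curve {a..b} c1" "c1 a = cinv \<kappa>1 z" "c1 b = cinv \<kappa> (M1 z)" "\<forall>t\<in>{a..b}. (t, c1 t) \<in> Q"
      using W1(8) by (auto simp: W_def)
    from z obtain c2 where c2: "curve {b..d} c2" "c2 b = cinv \<kappa> (M1 z)" "c2 d = cinv \<kappa>2 (M2 (M1 z))" "\<forall>t\<in>{b..d}. (t, c2 t) \<in> Q"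
      using W2(8) by (auto simp: W_def)
    have "curve {a..d} (\<lambda>t. if t \<le> b then c1 t else c2 t)"
      by (rule curve_concat[OF c1(1) c2(1) _ ab]) (simp add: c1 c2)
    then show "\<exists>c. curve {a..d} c \<and> c a = cinv \<kappa>1 z \<and> c d = cinv \<kappa>2 (M2 (M1 z)) \<and> (\<forall>t\<in>{a..d}. (t, c t) \<in> Q)"
      using ab c1 c2 by (intro exI[of _ "\<lambda>t. if t \<le> b then c1 t else c2 t"]) auto
  qed
qed

text \<open>Near \<open>\<gamma> x\<close> everything happens inside one chart
  \<open>\<kappa>\<close>, where the local flow supplies the map. The conclusion, for all short
  intervals around \<open>x\<close>, has the form of the local hypothesis of the bisection principle
  \<open>Bolzano\<close>.\<close>

lemma transport_local:
  assumes g: "curve {0..T} \<gamma>" and x: "x \<in> {0..T}"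
  shows "\<exists>d>0. \<forall>a b. 0 \<le> a \<and> b \<le> T \<and> a \<le> x \<and> x \<le> b \<and> b - a < d \<longrightarrow> transport \<gamma> a b"
proof -
  have "\<gamma> x \<in> U" using g x unfolding ham_curve_def by blast
  then obtain \<kappa> where k: "\<kappa> \<in> \<A>" "\<gamma> x \<in> cdom \<kappa>" using chart_at by blast
  define z0 where "z0 = cmap \<kappa> (\<gamma> x)"
  obtain r where r: "r > 0" "cball z0 r \<subseteq> cimg \<kappa>"
    using chart(2)[OF k(1)] k(2) open_contains_cball unfolding z0_def by blast
  obtain L where L: "L \<ge> 0" "\<And>x y. x \<in> cball z0 r \<Longrightarrow> y \<in> cball z0 r \<Longrightarrow> norm (X \<kappa> x - X \<kappa> y) \<le> L * norm (x - y)"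
    and flow: "\<And>a \<rho>. a > 0 \<Longrightarrow> \<rho> > 0 \<Longrightarrow> (\<rho> + norm (X \<kappa> z0) * a) * exp (L * a) < r \<Longrightarrow>
      (\<exists>\<Phi>. smooth_on ({-a<..<a} \<times> ball z0 \<rho>) \<Phi> \<and>
        (\<forall>p\<in>ball z0 \<rho>. \<Phi> (0, p) = p \<and> (\<forall>t\<in>{-a<..<a}. \<Phi> (t, p) \<in> ball z0 r \<and>
           ((\<lambda>t. \<Phi> (t, p)) has_vector_derivative X \<kappa> (\<Phi> (t, p))) (at t))))"
    using local_flow[OF chart(2)[OF k(1)] smooth_ham_field[OF k(1)] r] by blast
  \<comment> \<open>As \<open>a\<close> tends to 0 the bound in \<open>local_flow\<close> with
    \<open>\<rho> = r/8\<close> tends to \<open>r/8\<close>, so some positive \<open>a0\<close> is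
    admissible.\<close>
  have "((\<lambda>a. (r/8 + norm (X \<kappa> z0) * a) * exp (L * a)) \<longlongrightarrow> (r/8 + norm (X \<kappa> z0) * 0) * exp (L * 0)) (at_right 0)"
    by (intro tendsto_intros)
  moreover have "(r/8 + norm (X \<kappa> z0) * 0) * exp (L * 0) < r" using r by simp
  ultimately have "eventually (\<lambda>a. (r/8 + norm (X \<kappa> z0) * a) * exp (L * a) < r) (at_right 0)" by (rule order_tendstoD)
  then have "eventually (\<lambda>a. (r/8 + norm (X \<kappa> z0) * a) * exp (L * a) < r \<and> a > 0) (at_right 0)"
    using eventually_conj eventually_at_right_less by blast
  then obtain a0 where a0: "a0 > 0" "(r/8 + norm (X \<kappa> z0) * a0) * exp (L * a0) < r"
    using eventually_happens'[OF trivial_limit_at_right_real] by blast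
  let ?B = "ball z0 (r/8)" and ?J = "{-a0<..<a0}"
  obtain \<Phi> where \<Phi>: "smooth_on (?J \<times> ?B) \<Phi>" "\<And>p. p \<in> ?B \<Longrightarrow> \<Phi> (0, p) = p"
    "\<And>t p. t \<in> ?J \<Longrightarrow> p \<in> ?B \<Longrightarrow> \<Phi> (t, p) \<in> ball z0 r"
    "\<And>t p. t \<in> ?J \<Longrightarrow> p \<in> ?B \<Longrightarrow> ((\<lambda>t. \<Phi> (t, p)) has_vector_derivative X \<kappa> (\<Phi> (t, p))) (at t)"
    using flow[OF a0(1) _ a0(2)] r(1) by auto
  have \<Phi>i: "\<Phi> (t, p) \<in> cimg \<kappa>" if "t \<in> ?J" "p \<in> ?B" for t p using \<Phi>(3)[OF that] r(2) by auto
  have \<Phi>d: "((\<lambda>t. \<Phi> (t - a, p)) has_vector_derivative X \<kappa> (\<Phi> (t - a, p))) (at t within Y)" if "t - a \<in> ?J" "p \<in> ?B" for t a p Y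
  proof -
    have "((\<lambda>t. t - a) has_vector_derivative 1) (at t)"
      unfolding has_real_derivative_iff_has_vector_derivative[symmetric] by (auto intro!: derivative_eq_intros)
    from vector_diff_chain_at[OF this \<Phi>(4)[OF that]] show ?thesis
      by (simp add: comp_def has_vector_derivative_at_within)
  qed
  define N where "N = {q \<in> cdom \<kappa>. cmap \<kappa> q \<in> ?B}"
  have N: "open N" unfolding N_def by (rule open_chart_preimage[OF k(1) open_ball])
  have xN: "\<gamma> x \<in> N" using k(2) r by (simp add: N_def z0_def)
  obtain d0 where d0: "d0 > 0" "\<forall>s\<in>{0..T}. \<bar>s - x\<bar> < d0 \<longrightarrow> \<gamma> s \<in> N" using curve_nbhd[OF g x N xN] by blast
  show ?thesis
  proof (intro exI[of _ "min d0 a0"] conjI allI impI)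
    fix a b assume ab: "0 \<le> a \<and> b \<le> T \<and> a \<le> x \<and> x \<le> b \<and> b - a < min d0 a0"
    define \<zeta> where "\<zeta> = (\<lambda>s. cmap \<kappa> (\<gamma> s))"
    have gN: "\<gamma> s \<in> N" if "s \<in> {a..b}" for s using d0(2) that ab by auto
    have gk: "\<gamma> s \<in> cdom \<kappa>" "\<zeta> s \<in> ?B" if "s \<in> {a..b}" for s using gN[OF that] by (auto simp: N_def \<zeta>_def)
    have J: "s - a \<in> ?J" if "s \<in> {a..b}" for s using that ab by auto
    have abI: "a \<in> {a..b}" "b \<in> {a..b}" using ab by auto
    \<comment> \<open>The given curve and the flow line from \<open>\<zeta> a\<close> solve the same
      Lipschitz equation in the chart.\<close>
    have \<zeta>\<Phi>: "\<Phi> (s - a, \<zeta> a) = \<zeta> s" if s: "s \<in> {a..b}" for s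
    proof (rule lipschitz_curves_equal[where I="{a..b}" and Y="X \<kappa>" and K="cball z0 r" and L=L and s=a])
      fix y assume y: "y \<in> {a..b}"
      show "((\<lambda>s. \<Phi> (s - a, \<zeta> a)) has_vector_derivative X \<kappa> (\<Phi> (y - a, \<zeta> a))) (at y within {a..b})"
        by (rule \<Phi>d[OF J[OF y] gk(2)[OF abI(1)]])
      have "curve {a..b} \<gamma>" by (rule curve_subset[OF g]) (use ab in auto)
      from curve_derivative[OF this k(1) y gk(1)[OF y]]
      show "(\<zeta> has_vector_derivative X \<kappa> (\<zeta> y)) (at y within {a..b})" by (simp add: \<zeta>_def)
      show "\<Phi> (y - a, \<zeta> a) \<in> cball z0 r \<and> \<zeta> y \<in> cball z0 r"
        using \<Phi>(3)[OF J[OF y] gk(2)[OF abI(1)]] gk(2)[OF y] r(1) by auto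
    qed (use L \<Phi>(2)[OF gk(2)[OF abI(1)]] s ab in auto)
    show "transport \<gamma> a b" unfolding transport_def
    proof (intro ballI allI impI, elim conjE)
      fix \<kappa>1 \<kappa>2 Q assume k12: "\<kappa>1 \<in> \<A>" "\<kappa>2 \<in> \<A>" and ga: "\<gamma> a \<in> cdom \<kappa>1" and gb: "\<gamma> b \<in> cdom \<kappa>2"
        and Q: "open Q" "\<forall>t\<in>{a..b}. (t, \<gamma> t) \<in> Q"
      define D where "D = {y::R4 \<times> real. fst y \<in> ?B \<and> snd y - a \<in> ?J}"
      have "D = ?B \<times> {a - a0<..<a + a0}" unfolding D_def by force
      then have D: "open D" by (simp add: open_Times)
      have "continuous_on D (\<lambda>y. \<Phi> (snd y - a, fst y))"
        by (rule continuous_on_compose2[OF smooth_on_continuous[OF \<Phi>(1)]]) (auto simp: D_def intro!: continuous_intros)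
      then have "continuous_on D (\<lambda>y. cinv \<kappa> (\<Phi> (snd y - a, fst y)))"
        by (rule continuous_on_compose2[OF chart(4)[OF k(1)]]) (use \<Phi>i in \<open>auto simp: D_def\<close>)
      then have cont: "continuous_on D (\<lambda>y. (snd y, cinv \<kappa> (\<Phi> (snd y - a, fst y))))"
        by (intro continuous_on_Pair continuous_on_snd continuous_on_id)
      define O' where "O' = {y \<in> D. (snd y, cinv \<kappa> (\<Phi> (snd y - a, fst y))) \<in> Q}"
      have O: "open O'" unfolding O'_def by (rule open_continuous_preimage[OF D cont Q(1)])
      have "{\<zeta> a} \<times> {a..b} \<subseteq> O'"
      proof (rule subsetI)
        fix y assume "y \<in> {\<zeta> a} \<times> {a..b}"
        then obtain t where y: "y = (\<zeta> a, t)" and t: "t \<in> {a..b}" by blast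
        have "cinv \<kappa> (\<Phi> (t - a, \<zeta> a)) = \<gamma> t" using \<zeta>\<Phi>[OF t] chart_inv(1)[OF k(1) gk(1)[OF t]] by (simp add: \<zeta>_def)
        then show "y \<in> O'" unfolding y using Q(2) t J[OF t] gk(2)[OF abI(1)] by (simp add: O'_def D_def)
      qed
      \<comment> \<open>Compactness of the time interval turns staying in \<open>Q\<close> for all
        times into an open condition on the initial point.\<close>
      then have "\<exists>V. \<zeta> a \<in> V \<and> open V \<and> V \<times> {a..b} \<subseteq> O'"
        by (rule Elementary_Topology.tube_lemma[OF compact_Icc O])
      then obtain V0 where V0: "\<zeta> a \<in> V0" "open V0" "V0 \<times> {a..b} \<subseteq> O'" by blast
      define m where "m = (\<lambda>p. \<Phi> (b - a, p))"
      have bJ: "b - a \<in> ?J" by (rule J[OF abI(2)])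
      have msm: "smooth_on ?B m"
      proof -
        have 1: "smooth_on ?B (\<lambda>p. (b - a, p))" by (intro smooth_onI Ck_intros) auto
        have 2: "open (?J \<times> ?B)" by (rule open_Times) auto
        have 3: "(\<lambda>p. (b - a, p)) ` ?B \<subseteq> ?J \<times> ?B" by (rule image_subsetI) (use bJ in simp)
        show ?thesis unfolding m_def by (rule smooth_on_compose[OF open_ball 2 1 \<Phi>(1) 3])
      qed
      have md: "(m has_derivative (\<lambda>v. fD \<Phi> (b - a, p) (0, v))) (at p)" if "p \<in> ?B" for p
        unfolding m_def by (rule flow_initial_derivative[OF \<Phi>(1)]) (use bJ that in simp)
      have m\<omega>: "\<omega> \<kappa> (m p) (fD \<Phi> (b - a, p) (0, v)) (fD \<Phi> (b - a, p) (0, w)) = \<omega> \<kappa> p v w" if "p \<in> ?B" for p v w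
        unfolding m_def by (rule flow_symplectic[OF k(1) a0(1) open_ball \<Phi>(1,2) \<Phi>i \<Phi>(4) bJ that])
      define W3 where "W3 = {p \<in> ?B \<inter> V0. m p \<in> overlap \<kappa> \<kappa>2}"
      have W3: "open W3" unfolding W3_def
        by (rule open_continuous_preimage[OF open_Int[OF open_ball V0(2)] continuous_on_subset[OF smooth_on_continuous[OF msm]] open_overlap[OF k(1) k12(2)]]) auto
      let ?\<tau>1 = "transition \<kappa>1 \<kappa>" and ?\<tau>2 = "transition \<kappa> \<kappa>2"
      have sm3: "smooth_on W3 (\<lambda>p. ?\<tau>2 (m p))"
        by (rule smooth_on_compose[OF W3 open_overlap[OF k(1) k12(2)] smooth_on_subset[OF msm] transition_smooth[OF k(1) k12(2)]])
          (auto simp: W3_def)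
      define W where "W = {z \<in> overlap \<kappa>1 \<kappa>. ?\<tau>1 z \<in> W3}"
      have W: "open W" unfolding W_def
        by (rule open_continuous_preimage[OF open_overlap[OF k12(1) k(1)] smooth_on_continuous[OF transition_smooth[OF k12(1) k(1)]] W3])
      define M where "M = (\<lambda>z. ?\<tau>2 (m (?\<tau>1 z)))"
      have smM: "smooth_on W M" unfolding M_def
        by (rule smooth_on_compose[OF W W3 smooth_on_subset[OF transition_smooth[OF k12(1) k(1)]] sm3]) (auto simp: W_def)
      have Wm: "z \<in> overlap \<kappa>1 \<kappa>" "?\<tau>1 z \<in> ?B" "?\<tau>1 z \<in> V0" "m (?\<tau>1 z) \<in> overlap \<kappa> \<kappa>2" if "z \<in> W" for z
        using that by (simp_all add: W_def W3_def)
      have dM: "fD M z v = fD ?\<tau>2 (m (?\<tau>1 z)) (fD \<Phi> (b - a, ?\<tau>1 z) (0, fD ?\<tau>1 z v))" if z: "z \<in> W" for z v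
      proof -
        have "((\<lambda>z. m (?\<tau>1 z)) has_derivative (\<lambda>v. fD \<Phi> (b - a, ?\<tau>1 z) (0, fD ?\<tau>1 z v))) (at z)"
          by (rule has_derivative_compose[OF smooth_on_derivative[OF transition_smooth[OF k12(1) k(1)] Wm(1)[OF z]] md[OF Wm(2)[OF z]]])
        from has_derivative_compose[OF this smooth_on_derivative[OF transition_smooth[OF k(1) k12(2)] Wm(4)[OF z]]]
        have "(M has_derivative (\<lambda>v. fD ?\<tau>2 (m (?\<tau>1 z)) (fD \<Phi> (b - a, ?\<tau>1 z) (0, fD ?\<tau>1 z v)))) (at z)"
          unfolding M_def .
        from fD_eqI[OF this] show ?thesis by simp
      qed
      have za: "cmap \<kappa>1 (\<gamma> a) \<in> overlap \<kappa>1 \<kappa>" "?\<tau>1 (cmap \<kappa>1 (\<gamma> a)) = \<zeta> a"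
        using ga gk(1)[OF abI(1)] chart_inv(1)[OF k12(1) ga] by (auto simp: transition_def \<zeta>_def)
      have zb: "m (\<zeta> a) = \<zeta> b" unfolding m_def by (rule \<zeta>\<Phi>[OF abI(2)])
      have zb2: "\<zeta> b \<in> overlap \<kappa> \<kappa>2" "?\<tau>2 (\<zeta> b) = cmap \<kappa>2 (\<gamma> b)"
        using gb gk(1)[OF abI(2)] chart_inv(1)[OF k(1) gk(1)[OF abI(2)]] by (auto simp: transition_def \<zeta>_def)
      show "\<exists>W M. open W \<and> cmap \<kappa>1 (\<gamma> a) \<in> W \<and> W \<subseteq> cimg \<kappa>1 \<and> smooth_on W M \<and> M ` W \<subseteq> cimg \<kappa>2 \<and>
         M (cmap \<kappa>1 (\<gamma> a)) = cmap \<kappa>2 (\<gamma> b) \<and>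
         (\<forall>z\<in>W. \<forall>v w. \<omega> \<kappa>2 (M z) (fD M z v) (fD M z w) = \<omega> \<kappa>1 z v w) \<and>
         (\<forall>z\<in>W. \<exists>c. curve {a..b} c \<and> c a = cinv \<kappa>1 z \<and> c b = cinv \<kappa>2 (M z) \<and> (\<forall>t\<in>{a..b}. (t, c t) \<in> Q))"
      proof (intro exI[of _ W] exI[of _ M] conjI ballI allI W smM)
        show "cmap \<kappa>1 (\<gamma> a) \<in> W" using za zb zb2 gk(2)[OF abI(1)] V0(1) by (simp add: W_def W3_def)
        show "W \<subseteq> cimg \<kappa>1" using Wm(1) by blast
        show "M (cmap \<kappa>1 (\<gamma> a)) = cmap \<kappa>2 (\<gamma> b)" using za zb zb2 by (simp add: M_def)
        show "M ` W \<subseteq> cimg \<kappa>2"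
        proof (rule image_subsetI)
          fix z assume "z \<in> W"
          from transition_mem(1)[OF k(1) k12(2) Wm(4)[OF this]] show "M z \<in> cimg \<kappa>2" by (auto simp: M_def)
        qed
      next
        fix z v w assume z: "z \<in> W"
        have "\<omega> \<kappa>2 (M z) (fD M z v) (fD M z w) = \<omega> \<kappa> (m (?\<tau>1 z)) (fD \<Phi> (b - a, ?\<tau>1 z) (0, fD ?\<tau>1 z v)) (fD \<Phi> (b - a, ?\<tau>1 z) (0, fD ?\<tau>1 z w))"
          unfolding dM[OF z] unfolding M_def by (rule \<omega>_transition[OF k(1) k12(2) Wm(4)[OF z]])
        also have "\<dots> = \<omega> \<kappa> (?\<tau>1 z) (fD ?\<tau>1 z v) (fD ?\<tau>1 z w)" by (rule m\<omega>[OF Wm(2)[OF z]])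
        also have "\<dots> = \<omega> \<kappa>1 z v w" by (rule \<omega>_transition[OF k12(1) k(1) Wm(1)[OF z]])
        finally show "\<omega> \<kappa>2 (M z) (fD M z v) (fD M z w) = \<omega> \<kappa>1 z v w" .
      next
        fix z assume z: "z \<in> W"
        define p where "p = ?\<tau>1 z"
        have pB: "p \<in> ?B" using Wm(2)[OF z] by (simp add: p_def)
        have "curve {a..b} (\<lambda>t. cinv \<kappa> (\<Phi> (t - a, p)))"
        proof (rule curveI[OF k(1)])
          show "(\<lambda>t. \<Phi> (t - a, p)) ` {a..b} \<subseteq> cimg \<kappa>" using \<Phi>i[OF J pB] by blast
          fix t assume "t \<in> {a..b}"
          then show "((\<lambda>t. \<Phi> (t - a, p)) has_vector_derivative X \<kappa> (\<Phi> (t - a, p))) (at t within {a..b})"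
            by (intro \<Phi>d J pB)
        qed
        moreover have "cinv \<kappa> (\<Phi> (a - a, p)) = cinv \<kappa>1 z"
          using \<Phi>(2)[OF pB] transition_mem(3)[OF k12(1) k(1) Wm(1)[OF z]] by (simp add: p_def)
        moreover have "cinv \<kappa> (\<Phi> (b - a, p)) = cinv \<kappa>2 (M z)"
          using transition_mem(3)[OF k(1) k12(2) Wm(4)[OF z]] by (simp add: p_def M_def m_def)
        moreover have "(t, cinv \<kappa> (\<Phi> (t - a, p))) \<in> Q" if "t \<in> {a..b}" for t
        proof -
          have "(p, t) \<in> O'" using V0(3) Wm(3)[OF z] that by (auto simp: p_def)
          then show ?thesis by (simp add: O'_def)
        qed
        ultimately show "\<exists>c. curve {a..b} c \<and> c a = cinv \<kappa>1 z \<and> c b = cinv \<kappa>2 (M z) \<and> (\<forall>t\<in>{a..b}. (t, c t) \<in> Q)"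
          by (intro exI[of _ "\<lambda>t. cinv \<kappa> (\<Phi> (t - a, p))"]) auto
      qed
    qed
  qed (use d0 a0 in auto)
qed

text \<open>Bisection chains the local statement. The restriction to subintervals of
  \<open>{0..T}\<close> is part of the predicate, because the hypotheses of \<open>Bolzano\<close>
  range over all intervals.\<close>

lemma transport_curve:
  assumes g: "curve {0..T} \<gamma>" and T: "0 \<le> T"
  shows "transport \<gamma> 0 T"
proof -
  have "0 \<le> (0::real) \<and> T \<le> T \<longrightarrow> transport \<gamma> 0 T"
  proof (rule Bolzano[OF T, where P="\<lambda>a b. 0 \<le> a \<and> b \<le> T \<longrightarrow> transport \<gamma> a b"])
    fix a b d assume "0 \<le> a \<and> b \<le> T \<longrightarrow> transport \<gamma> a b" "0 \<le> b \<and> d \<le> T \<longrightarrow> transport \<gamma> b d" and ab: "a \<le> b" "b \<le> d"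
    moreover have "\<gamma> b \<in> U" if "0 \<le> a" "d \<le> T" using g that ab unfolding ham_curve_def by auto
    ultimately show "0 \<le> a \<and> d \<le> T \<longrightarrow> transport \<gamma> a d" using transport_trans[OF ab] by auto
  next
    fix x assume "0 \<le> x" "x \<le> T"
    then show "\<exists>d>0. \<forall>a b. a \<le> x \<and> x \<le> b \<and> b - a < d \<longrightarrow> 0 \<le> a \<and> b \<le> T \<longrightarrow> transport \<gamma> a b"
      using transport_local[OF g, of x] by (metis atLeastAtMost_iff)
  qed
  then show ?thesis by simp
qed

end

section \<open>A discrete gradient for the parabolic normal form\<close>

text \<open>If \<open>f p\<close> were non-zero, \<open>c\<close> would vanish on a neighbourhood of
  \<open>p\<close>, and then so would its derivative. This allows cancelling a factor that may
  itself have zeros.\<close>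

lemma eq_zero_of_mult_submersion:
  assumes W: "open W" and f: "continuous_on W f" and d: "\<And>p. p \<in> W \<Longrightarrow> fD c p v \<noteq> (0::real)"
    and z: "\<And>p. p \<in> W \<Longrightarrow> f p * c p = (0::real)" and p: "p \<in> W"
  shows "f p = 0"
proof (rule ccontr)
  assume ne: "f p \<noteq> 0"
  let ?V = "{q \<in> W. f q \<noteq> 0}"
  have "fD c p = fD (\<lambda>_. 0) p"
    by (rule fD_cong_open[OF open_nonzero[OF W f]]) (use p ne z in auto)
  then show False using d[OF p] by simp
qed

text \<open>The conditions on \<open>e\<close> and \<open>v\<close> say that \<open>x + x'\<close> and \<open>l - (y\<^sup>2 + yy' + y'\<^sup>2)\<close> are functionally
  independent at \<open>p0\<close>.\<close>

theorem discrete_gradient: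
  fixes x y l x' y' :: "'a::euclidean_space \<Rightarrow> real"
  assumes S: "open S" and p0: "p0 \<in> S"
    and sm: "smooth_on S x" "smooth_on S y" "smooth_on S l" "smooth_on S x'" "smooth_on S y'"
    and H: "\<And>p. p \<in> S \<Longrightarrow> (x' p)^2 - (y' p)^3 + l p * y' p = (x p)^2 - (y p)^3 + l p * y p"
    and zero: "x p0 = 0" "y p0 = 0" "l p0 = 0" "x' p0 = 0" "y' p0 = 0"
    and e: "fD l p0 e \<noteq> 0" and v: "fD l p0 v = 0" "fD x p0 v + fD x' p0 v \<noteq> 0"
  shows "\<exists>W \<tau>. open W \<and> p0 \<in> W \<and> W \<subseteq> S \<and> smooth_on W \<tau> \<and>
     (\<forall>p\<in>W. x' p - x p = \<tau> p * (l p - ((y p)^2 + y p * y' p + (y' p)^2)) \<and> y' p - y p = - \<tau> p * (x p + x' p))"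
proof -
  define a where "a = (\<lambda>p. x p + x' p)"
  define b where "b = (\<lambda>p. l p - ((y p)^2 + y p * y' p + (y' p)^2))"
  define f where "f = (\<lambda>p. x' p - x p)"
  define g where "g = (\<lambda>p. y' p - y p)"
  have smk: "Ck_on k S x" "Ck_on k S y" "Ck_on k S l" "Ck_on k S x'" "Ck_on k S y'" for k
    using sm smooth_onD by blast+
  have asm: "smooth_on S a" and bsm: "smooth_on S b" and fsm: "smooth_on S f" and gsm: "smooth_on S g"
    unfolding a_def b_def f_def g_def by (intro smooth_onI Ck_intros S smk)+
  \<comment> \<open>The difference of the two values of the normal form factors as
    \<open>f * a + g * b\<close>.\<close>
  have fa: "f p * a p = - (g p * b p)" if "p \<in> S" for p
    using H[OF that] unfolding f_def a_def g_def b_def by algebra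
  have d: "(x has_derivative fD x p0) (at p0)" "(y has_derivative fD y p0) (at p0)" "(l has_derivative fD l p0) (at p0)"
    "(x' has_derivative fD x' p0) (at p0)" "(y' has_derivative fD y' p0) (at p0)"
    using smooth_on_derivative[OF _ p0] sm by blast+
  \<comment> \<open>The quadratic terms of \<open>b\<close> have zero differential at
    \<open>p0\<close>, where \<open>y\<close> and \<open>y'\<close> vanish.\<close>
  have "(b has_derivative fD l p0) (at p0)" unfolding b_def
    by (auto intro!: derivative_eq_intros d simp: zero)
  then have fDb: "fD b p0 = fD l p0" by (rule fD_eqI)
  have "(a has_derivative (\<lambda>v. fD x p0 v + fD x' p0 v)) (at p0)" unfolding a_def
    by (intro has_derivative_add d)
  then have fDa: "fD a p0 = (\<lambda>v. fD x p0 v + fD x' p0 v)" by (rule fD_eqI)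
  have b0: "b p0 = 0" by (simp add: b_def zero)
  obtain W0 r \<tau> where W0: "open W0" "p0 \<in> W0" "W0 \<subseteq> S" "smooth_on W0 r" "r p0 = 0" "smooth_on W0 \<tau>"
    "\<And>p. p \<in> W0 \<Longrightarrow> p - r p *\<^sub>R e \<in> S \<and> b (p - r p *\<^sub>R e) = 0 \<and> (f (p - r p *\<^sub>R e) = 0 \<longrightarrow> f p = \<tau> p * b p)"
    using smooth_division[OF S fsm bsm p0 b0, of e] e fDb by auto
  \<comment> \<open>\<open>\<pi>\<close> moves points along \<open>e\<close> onto the hypersurface
    \<open>b = 0\<close>.\<close>
  define \<pi> where "\<pi> = (\<lambda>p. p - r p *\<^sub>R e)"
  have \<pi>sm: "smooth_on W0 \<pi>" unfolding \<pi>_def by (intro smooth_onI Ck_intros W0 smooth_onD[OF W0(4)])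
  have \<pi>S: "\<pi> ` W0 \<subseteq> S" using W0(7) by (auto simp: \<pi>_def)
  have \<pi>0: "\<pi> p0 = p0" by (simp add: \<pi>_def W0)
  have d\<pi>: "(\<pi> has_derivative (\<lambda>v. v - fD r p0 v *\<^sub>R e)) (at p0)" unfolding \<pi>_def
    by (intro has_derivative_diff has_derivative_ident has_derivative_scaleR_left smooth_on_derivative[OF W0(4,2)])
  have lin: "linear (fD l p0)" by (rule smooth_on_linear_fD[OF sm(3) p0])
  have db1: "((\<lambda>p. b (\<pi> p)) has_derivative (\<lambda>v. fD b p0 (v - fD r p0 v *\<^sub>R e))) (at p0)"
    using has_derivative_compose[OF d\<pi>, of b "fD b p0"] smooth_on_derivative[OF bsm p0] \<pi>0 by simp
  have db2: "((\<lambda>p. b (\<pi> p)) has_derivative (\<lambda>v. 0)) (at p0)"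
    by (rule has_derivative_transform_within_open[OF has_derivative_const[of 0] W0(1,2)]) (use W0(7) in \<open>auto simp: \<pi>_def\<close>)
  \<comment> \<open>Differentiating \<open>b (\<pi> p) = 0\<close> along \<open>v\<close> shows that
    \<open>r\<close> is stationary in this direction. Hence \<open>a (\<pi> p)\<close> has the same
    derivative along \<open>v\<close> as \<open>a\<close>, which is non-zero.\<close>
  have "fD l p0 (v - fD r p0 v *\<^sub>R e) = 0" using fun_cong[OF has_derivative_unique[OF db1 db2], of v] fDb by simp
  then have "fD l p0 v - fD r p0 v * fD l p0 e = 0" by (simp add: linear_diff[OF lin] linear_cmul[OF lin])
  then have r0: "fD r p0 v = 0" using v(1) e by simp
  have "((\<lambda>p. a (\<pi> p)) has_derivative (\<lambda>v. fD a p0 (v - fD r p0 v *\<^sub>R e))) (at p0)"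
    using has_derivative_compose[OF d\<pi>, of a "fD a p0"] smooth_on_derivative[OF asm p0] \<pi>0 by simp
  from fD_eqI[OF this] have a\<pi>0: "fD (\<lambda>p. a (\<pi> p)) p0 v \<noteq> 0" using v(2) r0 fDa by simp
  have a\<pi>: "smooth_on W0 (\<lambda>p. a (\<pi> p))" by (rule smooth_on_compose[OF W0(1) S \<pi>sm asm \<pi>S])
  define W1 where "W1 = {p \<in> W0. fD (\<lambda>p. a (\<pi> p)) p v \<noteq> 0}"
  have W1: "open W1" unfolding W1_def by (rule open_nonzero[OF W0(1) smooth_on_continuous[OF smooth_on_partial[OF a\<pi>]]])
  have f\<pi>: "continuous_on W0 (\<lambda>p. f (\<pi> p))"
    by (rule smooth_on_continuous[OF smooth_on_compose[OF W0(1) S \<pi>sm fsm \<pi>S]])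
  \<comment> \<open>On \<open>b = 0\<close> the factorisation leaves \<open>f * a = 0\<close>. Since
    \<open>a\<close> after \<open>\<pi>\<close> has a non-zero derivative, it can be cancelled, and
    \<open>f\<close> vanishes at \<open>\<pi> p\<close> as the division theorem requires.\<close>
  have "f (\<pi> p) = 0" if "p \<in> W1" for p
  proof (rule eq_zero_of_mult_submersion[where f="\<lambda>p. f (\<pi> p)", OF W1 _ _ _ that])
    show "continuous_on W1 (\<lambda>p. f (\<pi> p))" by (rule continuous_on_subset[OF f\<pi>]) (auto simp: W1_def)
    fix p assume p: "p \<in> W1"
    then show "fD (\<lambda>p. a (\<pi> p)) p v \<noteq> 0" by (simp add: W1_def)
    have "\<pi> p \<in> S" "b (\<pi> p) = 0" using p W0(7) by (auto simp: W1_def \<pi>_def)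
    then show "f (\<pi> p) * a (\<pi> p) = 0" using fa by simp
  qed
  then have fb: "f p = \<tau> p * b p" if "p \<in> W1" for p using that W0(7) by (simp add: W1_def \<pi>_def)
  define W where "W = {p \<in> W1. fD b p e \<noteq> 0}"
  have W1S: "W1 \<subseteq> S" and W1W0: "W1 \<subseteq> W0" using W0(3) by (auto simp: W1_def)
  have W: "open W" unfolding W_def
    by (rule open_nonzero[OF W1 continuous_on_subset[OF smooth_on_continuous[OF smooth_on_partial[OF bsm]] W1S]])
  have "W \<subseteq> W1" by (auto simp: W_def)
  \<comment> \<open>With \<open>f = \<tau> * b\<close> the factorisation becomes
    \<open>(g + \<tau> * a) * b = 0\<close>; now \<open>b\<close> is cancelled, using its derivative
    along \<open>e\<close>.\<close>
  have ga: "g p = - \<tau> p * a p" if p: "p \<in> W" for p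
  proof -
    have cont: "continuous_on W (\<lambda>p. g p + \<tau> p * a p)"
      using continuous_on_subset[OF smooth_on_continuous[OF gsm], of W] continuous_on_subset[OF smooth_on_continuous[OF asm], of W]
        continuous_on_subset[OF smooth_on_continuous[OF W0(6)], of W] \<open>W \<subseteq> W1\<close> W1S W1W0
      by (intro continuous_intros) auto
    have "g p + \<tau> p * a p = 0"
    proof (rule eq_zero_of_mult_submersion[where f="\<lambda>p. g p + \<tau> p * a p", OF W cont _ _ p])
      fix q assume q: "q \<in> W"
      then show "fD b q e \<noteq> 0" by (simp add: W_def)
      have q': "q \<in> W1" "q \<in> S" using q \<open>W \<subseteq> W1\<close> W1S by auto
      show "(g q + \<tau> q * a q) * b q = 0" using fa[OF q'(2)] fb[OF q'(1)] by algebra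
    qed
    then show ?thesis by simp
  qed
  have "p0 \<in> W" using W0(2) a\<pi>0 fDb e by (simp add: W_def W1_def)
  moreover have "smooth_on W \<tau>" using smooth_on_subset[OF W0(6)] \<open>W \<subseteq> W1\<close> W1W0 by blast
  moreover have "f p = \<tau> p * b p" if "p \<in> W" for p using fb that \<open>W \<subseteq> W1\<close> by blast
  ultimately show ?thesis using W ga \<open>W \<subseteq> W1\<close> W1S unfolding f_def g_def a_def b_def
    by (intro exI[of _ W] exI[of _ \<tau>]) auto
qed

text \<open>Subtracting the equations and eliminating \<open>y1 - y2\<close> leaves
  \<open>x1 - x2\<close> times \<open>1 - \<tau>^2 * (y + y1 + y2)\<close>. So the coefficient
  determines the image point as long as the second factor is non-zero.\<close>

lemma discrete_gradient_unique:
  fixes x y l \<tau> :: real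
  assumes "x1 - x = \<tau> * (l - (y^2 + y * y1 + y1^2))" "y1 - y = - \<tau> * (x + x1)"
    and "x2 - x = \<tau> * (l - (y^2 + y * y2 + y2^2))" "y2 - y = - \<tau> * (x + x2)"
    and small: "\<bar>\<tau>^2 * (y + y1 + y2)\<bar> < 1"
  shows "x1 = x2 \<and> y1 = y2"
proof -
  have "(x1 - x2) * (1 - \<tau>^2 * (y + y1 + y2)) = 0" using assms(1-4) by algebra
  moreover have "1 - \<tau>^2 * (y + y1 + y2) \<noteq> 0" using small by linarith
  ultimately have "x1 = x2" by simp
  moreover have "y1 - y2 = - \<tau> * (x1 - x2)" using assms(2,4) by algebra
  ultimately show ?thesis by simp
qed

section \<open>The potential of a first integral times the Hamiltonian form\<close>

definition parabolic_H :: "R3 \<Rightarrow> real" where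
  "parabolic_H = (\<lambda>(x, y, l). x^2 - y^3 + l * y)"

text \<open>Poincare's lemma on the slices. The homotopy contracts only \<open>(x, y)\<close>, so
  \<open>l\<close> remains a parameter in which \<open>K\<close> is smooth. The hypothesis
  \<open>inv\<close> says that \<open>T dH\<close> is closed on the slices. Doubling the radius
  gives room for \<open>s\<close> in the open interval from -1 to 2.\<close>

lemma parabolic_potential:
  fixes T :: "R3 \<Rightarrow> real"
  assumes T: "smooth_on (ball 0 (2 * \<rho>)) T" and \<rho>: "\<rho> > 0"
    and inv: "\<And>x y l. (x, y, l) \<in> ball 0 (2 * \<rho>) \<Longrightarrow>
       fD T (x, y, l) (1, 0, 0) * (l - 3 * y^2) = fD T (x, y, l) (0, 1, 0) * (2 * x)"
  shows "\<exists>K. smooth_on (ball 0 \<rho>) K \<and> (\<forall>x y l. (x, y, l) \<in> ball 0 \<rho> \<longrightarrow>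
      fD K (x, y, l) (1, 0, 0) = T (x, y, l) * (2 * x) \<and>
      fD K (x, y, l) (0, 1, 0) = T (x, y, l) * (l - 3 * y^2))"
proof -
  let ?B = "ball (0::R3) \<rho>" and ?J = "{-1<..<2::real}"
  have D: "open (?B \<times> ?J)" by (intro open_Times) auto
  define m where "m = (\<lambda>z::R3 \<times> real. (snd z * fst (fst z), snd z * fst (snd (fst z)), snd (snd (fst z))))"
  have mem: "m z \<in> ball 0 (2 * \<rho>)" if z: "z \<in> ?B \<times> ?J" for z
  proof -
    obtain x y l s where zz: "z = ((x, y, l), s)" by (metis surj_pair)
    have s: "s^2 \<le> 2^2" using z unfolding zz by (intro abs_le_square_iff[THEN iffD1]) auto
    have "norm (m z) = sqrt (s^2 * x^2 + (s^2 * y^2 + l^2))"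
      by (simp add: zz m_def norm_Pair power_mult_distrib)
    also have "\<dots> \<le> sqrt (2^2 * x^2 + (2^2 * y^2 + 2^2 * l^2))"
      using s by (intro real_sqrt_le_mono add_mono mult_right_mono) auto
    also have "\<dots> = sqrt (2^2 * (x^2 + (y^2 + l^2)))" by (simp only: distrib_left)
    also have "\<dots> = 2 * sqrt (x^2 + (y^2 + l^2))" by (simp only: real_sqrt_mult real_sqrt_abs abs_numeral)
    also have "\<dots> = 2 * norm (x, y, l)" by (simp add: norm_Pair)
    also have "\<dots> < 2 * \<rho>" using z by (simp add: zz)
    finally show ?thesis by simp
  qed
  have msm: "smooth_on (?B \<times> ?J) m" unfolding m_def by (intro smooth_onI Ck_intros D)
  \<comment> \<open>This is \<open>dH\<close> at \<open>(s x, s y, l)\<close> applied to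
    \<open>(x, y)\<close>.\<close>
  define h where "h = (\<lambda>z::R3 \<times> real. 2 * snd z * (fst (fst z))^2 +
     (snd (snd (fst z)) - 3 * (snd z)^2 * (fst (snd (fst z)))^2) * fst (snd (fst z)))"
  define f where "f = (\<lambda>z. T (m z) * h z)"
  have Tm: "smooth_on (?B \<times> ?J) (\<lambda>z. T (m z))"
    by (rule smooth_on_compose[OF D open_ball msm T]) (use mem in blast)
  have hk: "Ck_on k (?B \<times> ?J) h" for k unfolding h_def by (intro Ck_intros D)
  have fsm: "smooth_on (?B \<times> ?J) f" unfolding f_def
    by (intro smooth_onI Ck_on_mult D hk smooth_onD[OF Tm])
  define K where "K = (\<lambda>p. integral {0..1} (\<lambda>s. f (p, s)))"
  have Jo: "open ?J" "{0..1} \<subseteq> ?J" by auto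
  have Ksm: "smooth_on ?B K" unfolding K_def
    by (intro smooth_onI Ck_on_parameter_integral[OF open_ball Jo smooth_onD[OF fsm]])
  have dK: "fD K p = (\<lambda>v. integral {0..1} (\<lambda>s. fD f (p, s) (v, 0)))" if "p \<in> ?B" for p
    unfolding K_def by (rule fD_eqI[OF has_derivative_parameter_integral[OF open_ball Jo smooth_onD[OF fsm] that]])
  have main: "fD K (x, y, l) (1, 0, 0) = T (x, y, l) * (2 * x) \<and> fD K (x, y, l) (0, 1, 0) = T (x, y, l) * (l - 3 * y^2)"
    if p: "(x, y, l) \<in> ?B" for x y l
  proof -
    define Tx where "Tx = (\<lambda>s. fD T (s * x, s * y, l) (1, 0, 0))"
    define Ty where "Ty = (\<lambda>s. fD T (s * x, s * y, l) (0, 1, 0))"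
    define Ts where "Ts = (\<lambda>s. T (s * x, s * y, l))"
    have ps: "((x, y, l), s) \<in> ?B \<times> ?J" if "s \<in> {0..1}" for s using p that by auto
    have ms: "(s * x, s * y, l) \<in> ball 0 (2 * \<rho>)" if "s \<in> {0..1}" for s using mem[OF ps[OF that]] by (simp add: m_def)
    have dT: "(T has_derivative fD T (s * x, s * y, l)) (at (s * x, s * y, l))" if "s \<in> {0..1}" for s
      by (rule smooth_on_derivative[OF T ms[OF that]])
    have lin: "fD T (s * x, s * y, l) (a, b, 0) = a * Tx s + b * Ty s" if s: "s \<in> {0..1}" for s a b
    proof -
      have l: "linear (fD T (s * x, s * y, l))" by (rule smooth_on_linear_fD[OF T ms[OF s]])
      have "(a, b, 0) = a *\<^sub>R (1, 0, 0) + b *\<^sub>R (0, 1, 0::real)" by simp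
      then show ?thesis unfolding Tx_def Ty_def by (simp only: linear_add[OF l] linear_cmul[OF l] real_scaleR_def)
    qed
    have dTs: "(Ts has_real_derivative (x * Tx s + y * Ty s)) (at s)" if s: "s \<in> {0..1}" for s
    proof -
      have "((\<lambda>s. (s * x, s * y, l)) has_derivative (\<lambda>h. (h * x, h * y, 0))) (at s)"
        by (auto intro!: derivative_eq_intros)
      from has_derivative_compose[OF this dT[OF s]]
      have "(Ts has_derivative (\<lambda>h. fD T (s * x, s * y, l) (h * x, h * y, 0))) (at s)" by (simp add: Ts_def)
      moreover have "(\<lambda>h. fD T (s * x, s * y, l) (h * x, h * y, 0)) = (*) (x * Tx s + y * Ty s)"
        by (rule ext) (simp add: lin[OF s] algebra_simps)
      ultimately show ?thesis by (simp add: has_field_derivative_def)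
    qed
    have inv': "Tx s * (l - 3 * (s * y)^2) = Ty s * (2 * (s * x))" if "s \<in> {0..1}" for s
      unfolding Tx_def Ty_def by (rule inv[OF ms[OF that]])
    have df: "fD f ((x, y, l), s) ((a, b, 0), 0) = (s * a * Tx s + s * b * Ty s) * (2 * s * x^2 + (l - 3 * s^2 * y^2) * y) +
        Ts s * (4 * s * x * a + (l - 9 * s^2 * y^2) * b)" if s: "s \<in> {0..1}" for s a b
    proof -
      have 1: "((\<lambda>c. ((x + c * a, y + c * b, l), s)) has_derivative (\<lambda>c. ((c * a, c * b, 0), 0))) (at 0)"
        by (auto intro!: derivative_eq_intros)
      have "(f has_derivative fD f ((x, y, l), s)) (at ((x, y, l), s))" by (rule smooth_on_derivative[OF fsm ps[OF s]])
      then have 2: "((\<lambda>c. f ((x + c * a, y + c * b, l), s)) has_derivative (\<lambda>c. fD f ((x, y, l), s) ((c * a, c * b, 0), 0))) (at 0)"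
        using has_derivative_compose[OF 1, of f "fD f ((x, y, l), s)"] by simp
      have 3: "((\<lambda>c. (s * (x + c * a), s * (y + c * b), l)) has_derivative (\<lambda>c. (c * (s * a), c * (s * b), 0))) (at 0)"
        by (auto intro!: derivative_eq_intros)
      have "((\<lambda>c. T (s * (x + c * a), s * (y + c * b), l)) has_derivative (\<lambda>c. fD T (s * x, s * y, l) (c * (s * a), c * (s * b), 0))) (at 0)"
        using has_derivative_compose[OF 3, of T "fD T (s * x, s * y, l)"] dT[OF s] by simp
      moreover have "(\<lambda>c. fD T (s * x, s * y, l) (c * (s * a), c * (s * b), 0)) = (*) (s * a * Tx s + s * b * Ty s)"
        by (rule ext) (simp add: lin[OF s] algebra_simps)
      ultimately have 4: "((\<lambda>c. T (s * (x + c * a), s * (y + c * b), l)) has_real_derivative (s * a * Tx s + s * b * Ty s)) (at 0)"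
        by (simp add: has_field_derivative_def)
      have 5: "((\<lambda>c. 2 * s * (x + c * a)^2 + (l - 3 * s^2 * (y + c * b)^2) * (y + c * b)) has_real_derivative
          (4 * s * x * a + (l - 9 * s^2 * y^2) * b)) (at 0)"
        by (rule derivative_eq_intros refl | simp add: algebra_simps power2_eq_square)+
      have "((\<lambda>c. f ((x + c * a, y + c * b, l), s)) has_real_derivative
         ((s * a * Tx s + s * b * Ty s) * (2 * s * x^2 + (l - 3 * s^2 * y^2) * y) + Ts s * (4 * s * x * a + (l - 9 * s^2 * y^2) * b))) (at 0)"
        using DERIV_mult[OF 4 5] by (simp add: f_def m_def h_def Ts_def mult.commute)
      from fun_cong[OF has_derivative_unique[OF 2 this[unfolded has_field_derivative_def]], of 1]
      show ?thesis by (simp only: mult_1_left mult_1_right)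
    qed
    have ftc: "integral {0..1} q' = q 1 - q 0" if "\<And>s. s \<in> {0..1} \<Longrightarrow> (q has_real_derivative q' s) (at s)" for q q' :: "real \<Rightarrow> real"
      by (rule integral_unique[OF fundamental_theorem_of_calculus])
        (use that in \<open>auto simp: has_real_derivative_iff_has_vector_derivative[symmetric] intro: has_field_derivative_at_within\<close>)
    \<comment> \<open>By closedness the integrand is the \<open>s\<close>-derivative of
      \<open>s\<close> times the \<open>dx\<close>-coefficient of \<open>T dH\<close> at the scaled
      point; the \<open>dy\<close>-coefficient is treated in the same way below.\<close>
    have "integral {0..1} (\<lambda>s. fD f ((x, y, l), s) ((1, 0, 0), 0)) = 1 * Ts 1 * (2 * 1 * x) - 0 * Ts 0 * (2 * 0 * x)"
    proof (rule ftc)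
      fix s :: real assume s: "s \<in> {0..1}"
      have "((\<lambda>s. s * Ts s * (2 * s * x)) has_real_derivative (Ts s + s * (x * Tx s + y * Ty s)) * (2 * s * x) + s * Ts s * (2 * x)) (at s)"
        by (rule derivative_eq_intros dTs[OF s] refl | simp add: algebra_simps)+
      moreover have "(Ts s + s * (x * Tx s + y * Ty s)) * (2 * s * x) + s * Ts s * (2 * x) = fD f ((x, y, l), s) ((1, 0, 0), 0)"
        unfolding df[OF s] using inv'[OF s] by algebra
      ultimately show "((\<lambda>s. s * Ts s * (2 * s * x)) has_real_derivative fD f ((x, y, l), s) ((1, 0, 0), 0)) (at s)" by simp
    qed
    moreover have "integral {0..1} (\<lambda>s. fD f ((x, y, l), s) ((0, 1, 0), 0)) = 1 * Ts 1 * (l - 3 * (1 * y)^2) - 0 * Ts 0 * (l - 3 * (0 * y)^2)"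
    proof (rule ftc)
      fix s :: real assume s: "s \<in> {0..1}"
      have "((\<lambda>s. s * Ts s * (l - 3 * (s * y)^2)) has_real_derivative
          (Ts s + s * (x * Tx s + y * Ty s)) * (l - 3 * (s * y)^2) + s * Ts s * (- 6 * s * y^2)) (at s)"
        by (rule derivative_eq_intros dTs[OF s] refl | simp add: algebra_simps power2_eq_square)+
      moreover have "(Ts s + s * (x * Tx s + y * Ty s)) * (l - 3 * (s * y)^2) + s * Ts s * (- 6 * s * y^2) = fD f ((x, y, l), s) ((0, 1, 0), 0)"
        unfolding df[OF s] using inv'[OF s] by algebra
      ultimately show "((\<lambda>s. s * Ts s * (l - 3 * (s * y)^2)) has_real_derivative fD f ((x, y, l), s) ((0, 1, 0), 0)) (at s)" by simp
    qed
    ultimately show ?thesis by (simp add: dK[OF p] Ts_def)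
  qed
  show ?thesis using Ksm main by blast
qed

section \<open>Return maps as time-one maps\<close>

text \<open>The Hamiltonian field of \<open>parabolic_H\<close> on the slices with respect to
  \<open>g dx \<and> dy\<close>, in the sign convention of \<open>form_dual\<close>.\<close>

definition parabolic_field :: "(R3 \<Rightarrow> real) \<Rightarrow> R3 \<Rightarrow> R3" where
  "parabolic_field g = (\<lambda>(x, y, l). (- (l - 3 * y^2) / g (x, y, l), 2 * x / g (x, y, l), 0))"

lemma parabolic_H_derivative:
  "(parabolic_H has_derivative (\<lambda>(a, b, c). 2 * x * a + (l - 3 * y^2) * b + y * c)) (at (x, y, l))"
proof -
  have "((\<lambda>p::R3. (fst p)^2 - (fst (snd p))^3 + snd (snd p) * fst (snd p)) has_derivative
      (\<lambda>v. 2 * x * fst v + (l - 3 * y^2) * fst (snd v) + y * snd (snd v))) (at (x, y, l))"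
    by (auto intro!: derivative_eq_intros simp: algebra_simps power2_eq_square fun_eq_iff)
  then show ?thesis by (simp add: parabolic_H_def case_prod_beta')
qed

lemma form_dual_plane:
  fixes \<alpha> :: "real \<times> real \<Rightarrow> real"
  assumes c: "c \<noteq> 0" and \<alpha>: "linear \<alpha>"
  shows "form_dual (\<lambda>v w. c * wedge fst snd v w) \<alpha> = (- \<alpha> (0, 1) / c, \<alpha> (1, 0) / c)"
  unfolding form_dual_def
proof (rule the_equality)
  show "\<forall>v. c * wedge fst snd v (- \<alpha> (0, 1) / c, \<alpha> (1, 0) / c) = \<alpha> v"
  proof
    fix v :: "real \<times> real"
    have "v = fst v *\<^sub>R (1, 0) + snd v *\<^sub>R (0, 1)" by (cases v) simp
    then have "\<alpha> v = fst v * \<alpha> (1, 0) + snd v * \<alpha> (0, 1)"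
      by (metis linear_add[OF \<alpha>] linear_cmul[OF \<alpha>] real_scaleR_def)
    then show "c * wedge fst snd v (- \<alpha> (0, 1) / c, \<alpha> (1, 0) / c) = \<alpha> v"
      using c by (simp add: wedge_def field_simps)
  qed
next
  fix X :: "real \<times> real" assume X: "\<forall>v. c * wedge fst snd v X = \<alpha> v"
  have "c * snd X = \<alpha> (1, 0)" "- c * fst X = \<alpha> (0, 1)"
    using X[rule_format, of "(1, 0)"] X[rule_format, of "(0, 1)"] by (simp_all add: wedge_def)
  then show "X = (- \<alpha> (0, 1) / c, \<alpha> (1, 0) / c)" using c by (simp add: prod_eq_iff field_simps)
qed

lemma slice_ham_field_eq:
  assumes K: "(K has_derivative fD K (x, y, l)) (at (x, y, l))" and g: "g (x, y, l) \<noteq> 0"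
  shows "slice_ham_field g K (x, y, l) =
     (- fD K (x, y, l) (0, 1, 0) / g (x, y, l), fD K (x, y, l) (1, 0, 0) / g (x, y, l), 0)"
proof -
  let ?k = "\<lambda>(x', y'). K (x', y', l)"
  have "((\<lambda>w::real \<times> real. (fst w, snd w, l)) has_derivative (\<lambda>w. (fst w, snd w, 0))) (at (x, y))"
    by (auto intro!: derivative_eq_intros)
  from has_derivative_compose[OF this, of K "fD K (x, y, l)"] K
  have d: "(?k has_derivative (\<lambda>w. fD K (x, y, l) (fst w, snd w, 0))) (at (x, y))" by (simp add: case_prod_beta')
  have "linear (fD ?k (x, y))"
    unfolding fD_eqI[OF d] by (rule bounded_linear.linear[OF has_derivative_bounded_linear[OF d]])
  from form_dual_plane[OF g this] show ?thesis
    by (simp add: slice_ham_field_def fD_eqI[OF d])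
qed

text \<open>Uniqueness for linear equations with time-dependent coefficients. It serves to identify
  a solution of the variational equation with an explicit candidate.\<close>

lemma equal_linear_curves:
  fixes Z W :: "real \<Rightarrow> 'e::real_normed_vector"
  assumes I: "convex I" "s \<in> I" "t \<in> I" and eq: "Z s = W s" and B: "0 \<le> B"
    and Z: "\<And>x. x \<in> I \<Longrightarrow> (Z has_vector_derivative A x (Z x)) (at x within I)"
    and W: "\<And>x. x \<in> I \<Longrightarrow> (W has_vector_derivative A x (W x)) (at x within I)"
    and A: "\<And>x. x \<in> I \<Longrightarrow> linear (A x)" "\<And>x v. x \<in> I \<Longrightarrow> norm (A x v) \<le> B * norm v"
  shows "Z t = W t"
proof -
  have "norm (Z t - W t) \<le> (norm (Z s - W s) + 0 * \<bar>t - s\<bar>) * exp (B * \<bar>t - s\<bar>)"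
  proof (rule gronwall[OF I])
    fix x assume x: "x \<in> I"
    show "((\<lambda>x. Z x - W x) has_vector_derivative A x (Z x) - A x (W x)) (at x within I)"
      by (rule has_vector_derivative_diff[OF Z[OF x] W[OF x]])
    show "norm (A x (Z x) - A x (W x)) \<le> B * norm (Z x - W x) + 0"
      using A(2)[OF x, of "Z x - W x"] by (simp add: linear_diff[OF A(1)[OF x]])
  qed (use B in auto)
  then show ?thesis using eq by simp
qed

text \<open>The properties of the return map from which the time-one representation is derived, free
  of the manifold and the orbit. \<open>area\<close> is the invariance of
  \<open>g dx \<and> dy\<close> on vectors tangent to the slices.\<close>

locale parabolic_return =
  fixes N :: "R3 set" and g :: "R3 \<Rightarrow> real" and \<mu> :: "R3 \<Rightarrow> R3"
  assumes N: "open N" "0 \<in> N" and g: "smooth_on N g" "\<And>p. p \<in> N \<Longrightarrow> g p \<noteq> 0"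
    and \<mu>: "smooth_on N \<mu>" "\<mu> 0 = 0"
    and H: "\<And>p. p \<in> N \<Longrightarrow> parabolic_H (\<mu> p) = parabolic_H p"
    and lam: "\<And>p. p \<in> N \<Longrightarrow> snd (snd (\<mu> p)) = snd (snd p)"
    and area: "\<And>p a b c d. p \<in> N \<Longrightarrow> g (\<mu> p) *
       (fst (fD \<mu> p (a, b, 0)) * fst (snd (fD \<mu> p (c, d, 0))) - fst (fD \<mu> p (c, d, 0)) * fst (snd (fD \<mu> p (a, b, 0))))
       = g p * (a * d - c * b)"
begin

abbreviation "X \<equiv> parabolic_field g"

lemma d\<mu>: "p \<in> N \<Longrightarrow> (\<mu> has_derivative fD \<mu> p) (at p)"
  by (rule smooth_on_derivative[OF \<mu>(1)])

lemma lin\<mu>: "p \<in> N \<Longrightarrow> linear (fD \<mu> p)"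
  by (rule smooth_on_linear_fD[OF \<mu>(1)])

lemma g\<mu>: "p \<in> N \<Longrightarrow> g (\<mu> p) \<noteq> 0"
  using area[of p 1 0 0 1] g(2)[of p] by auto

lemma lam_derivative:
  assumes "p \<in> N" shows "snd (snd (fD \<mu> p v)) = snd (snd v)"
proof -
  have "((\<lambda>p. snd (snd (\<mu> p))) has_derivative (\<lambda>v. snd (snd (fD \<mu> p v)))) (at p)"
    by (intro has_derivative_snd d\<mu> assms)
  moreover have "((\<lambda>p. snd (snd (\<mu> p))) has_derivative (\<lambda>v. snd (snd v))) (at p)"
    by (rule has_derivative_transform_within_open[OF _ N(1) assms lam[symmetric]])
      (intro has_derivative_snd has_derivative_ident)
  ultimately show ?thesis using has_derivative_unique by metis
qed

lemma smooth_X: "smooth_on N X"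
proof (rule smooth_onI)
  fix k
  have "Ck_on k N (\<lambda>p. (- (snd (snd p) - 3 * (fst (snd p))^2) / g p, 2 * fst p / g p, 0::real))"
    by (intro Ck_intros Ck_on_divide N smooth_onD[OF g(1)] g(2))
  then show "Ck_on k N X" by (simp add: parabolic_field_def case_prod_beta')
qed

lemma X_zero: "X 0 = 0"
  by (simp add: parabolic_field_def zero_prod_def)

text \<open>A map that preserves an area form and a function preserves the Hamiltonian field of the
  function. In coordinates: invariance of \<open>dH\<close> expresses the partial derivatives at
  \<open>p\<close> through those at \<open>\<mu> p\<close>, and the slice derivative has determinant
  \<open>g p / g (\<mu> p)\<close>.\<close>

lemma \<mu>_preserves_X:
  assumes p: "p \<in> N" shows "fD \<mu> p (X p) = X (\<mu> p)"
proof -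
  obtain x y l where pe: "p = (x, y, l)" by (metis surj_pair)
  obtain x' y' where \<mu>e: "\<mu> p = (x', y', l)" using lam[OF p] pe by (metis prod.collapse snd_conv)
  obtain a c where V1: "fD \<mu> p (1, 0, 0) = (a, c, 0)" using lam_derivative[OF p, of "(1, 0, 0)"] by (metis prod.collapse snd_conv)
  obtain b d where V2: "fD \<mu> p (0, 1, 0) = (b, d, 0)" using lam_derivative[OF p, of "(0, 1, 0)"] by (metis prod.collapse snd_conv)
  define P Q P' Q' where "P = 2 * x" and "Q = l - 3 * y^2" and "P' = 2 * x'" and "Q' = l - 3 * y'^2"
  have "((\<lambda>p. parabolic_H (\<mu> p)) has_derivative (\<lambda>v. (\<lambda>(a, b, c). P' * a + Q' * b + y' * c) (fD \<mu> p v))) (at p)"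
    using has_derivative_compose[OF d\<mu>[OF p], of parabolic_H] parabolic_H_derivative[of x' l y'] unfolding \<mu>e P'_def Q'_def by blast
  moreover have "((\<lambda>p. parabolic_H (\<mu> p)) has_derivative (\<lambda>(a, b, c). P * a + Q * b + y * c)) (at p)"
    unfolding P_def Q_def
    by (rule has_derivative_transform_within_open[OF parabolic_H_derivative[of x l y, folded pe] N(1) p H[symmetric]])
  ultimately have eq: "(\<lambda>v. (\<lambda>(a, b, c). P' * a + Q' * b + y' * c) (fD \<mu> p v)) = (\<lambda>(a, b, c). P * a + Q * b + y * c)"
    by (rule has_derivative_unique)
  have 1: "P = P' * a + Q' * c" using fun_cong[OF eq, of "(1, 0, 0)"] by (simp add: V1)
  have 2: "Q = P' * b + Q' * d" using fun_cong[OF eq, of "(0, 1, 0)"] by (simp add: V2)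
  have ar: "g (\<mu> p) * (a * d - b * c) = g p" using area[OF p, of 1 0 0 1] by (simp add: V1 V2)
  have "X p = (- Q / g p) *\<^sub>R (1, 0, 0) + (P / g p) *\<^sub>R (0, 1, 0)"
    by (simp add: pe parabolic_field_def P_def Q_def)
  then have "fD \<mu> p (X p) = (- Q / g p) *\<^sub>R (a, c, 0) + (P / g p) *\<^sub>R (b, d, 0)"
    by (simp only: linear_add[OF lin\<mu>[OF p]] linear_cmul[OF lin\<mu>[OF p]] V1 V2)
  also have "\<dots> = ((- Q * a + P * b) / g p, (- Q * c + P * d) / g p, 0)" by (simp add: add_divide_distrib diff_divide_distrib)
  also have "- Q * a + P * b = - Q' * (a * d - b * c)" unfolding 1 2 by algebra
  also have "- Q * c + P * d = P' * (a * d - b * c)" unfolding 1 2 by algebra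
  also have "(- Q' * (a * d - b * c) / g p, P' * (a * d - b * c) / g p, 0::real) = (- Q' / g (\<mu> p), P' / g (\<mu> p), 0)"
    using ar g(2)[OF p] g\<mu>[OF p] by (auto simp: field_simps)
  also have "\<dots> = X (\<mu> p)" by (simp add: \<mu>e parabolic_field_def P'_def Q'_def)
  finally show ?thesis .
qed

text \<open>The alternative is that \<open>d\<mu>(0)\<close> is lower triangular on the slice with diagonal \<open>(-1, -1)\<close>. It is excluded by
  \<open>y'\<^sup>3 = y\<^sup>3 + x'\<^sup>2 > 0\<close> on the half-line \<open>x = l = 0\<close>, \<open>y > 0\<close>.\<close>

lemma \<mu>_transversal: "\<exists>a b. a + fst (fD \<mu> 0 (a, b, 0)) \<noteq> 0"
proof (rule ccontr)
  assume "\<not> ?thesis"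
  then have n: "a + fst (fD \<mu> 0 (a, b, 0)) = 0" for a b by blast
  define d where "d = fst (snd (fD \<mu> 0 (0, 1, 0)))"
  have "fst (fD \<mu> 0 (1, 0, 0)) = - 1" "fst (fD \<mu> 0 (0, 1, 0)) = 0" using n[of 1 0] n[of 0 1] by auto
  \<comment> \<open>At the fixed point the slice derivative has determinant 1, so the first row
    \<open>(-1, 0)\<close> forces the second diagonal entry \<open>d\<close> to be -1.\<close>
  then have "- (g 0 * d) = g 0" using area[OF N(2), of 1 0 0 1] \<mu>(2) by (simp add: d_def)
  then have "g 0 * (d + 1) = 0" unfolding distrib_left by linarith
  then have "d = - 1" using g(2)[OF N(2)] by simp
  define w where "w = (\<lambda>y. fst (snd (\<mu> (0, y, 0))))"
  have z: "(0, 0, 0) = (0::R3)" by (simp add: zero_prod_def)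
  have "((\<lambda>y. (0::real, y, 0::real)) has_derivative (\<lambda>h. (0, h, 0))) (at 0)" by (auto intro!: derivative_eq_intros)
  from has_derivative_compose[OF this, of \<mu> "fD \<mu> 0"] d\<mu>[OF N(2)]
  have "((\<lambda>y. \<mu> (0, y, 0)) has_derivative (\<lambda>h. fD \<mu> 0 (0, h, 0))) (at 0)" by (simp add: z)
  then have "(w has_derivative (\<lambda>h. fst (snd (fD \<mu> 0 (0, h, 0))))) (at 0)"
    unfolding w_def by (intro has_derivative_fst has_derivative_snd)
  moreover have "fst (snd (fD \<mu> 0 (0, h, 0))) = d * h" for h
    using linear_cmul[OF lin\<mu>[OF N(2)], of h "(0, 1, 0)"] by (simp add: d_def)
  ultimately have "(w has_real_derivative d) (at 0)" by (simp add: has_field_derivative_def)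
  then obtain e where e: "e > 0" "\<And>h. 0 < h \<Longrightarrow> h < e \<Longrightarrow> w (0 + h) < w 0"
    using DERIV_neg_dec_right[of w d 0] \<open>d = - 1\<close> by auto
  obtain e' where e': "e' > 0" "ball 0 e' \<subseteq> N" using N openE by blast
  define h where "h = min e e' / 2"
  have h: "0 < h" "h < e" "h < e'" using e e' by (auto simp: h_def)
  have "(0, h, 0) \<in> ball (0::R3) e'" using h by (simp add: norm_Pair)
  then have hN: "(0, h, 0) \<in> N" using e' by blast
  obtain u where "\<mu> (0, h, 0) = (u, w h, 0)" using lam[OF hN] unfolding w_def by (metis prod.collapse snd_conv)
  then have "u^2 - (w h)^3 = - (h^3)" using H[OF hN] by (simp add: parabolic_H_def)
  moreover have "h^3 > 0" "u^2 \<ge> 0" using h by auto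
  ultimately have "(w h)^3 > 0" by linarith
  then have "w h > 0" by (simp add: zero_less_power_eq)
  then show False using e(2)[OF h(1,2)] \<mu>(2) by (simp add: w_def z)
qed

theorem time_one_map:
  "\<exists>K D W. open D \<and> D \<subseteq> N \<and> smooth_on D K \<and> open W \<and> 0 \<in> W \<and> W \<subseteq> D \<and>
     (\<forall>p\<in>W. time_one_image (slice_ham_field g K) D p (\<mu> p))"
proof -
  define cx cy cl :: "R3 \<Rightarrow> real" where "cx = fst" and "cy = (\<lambda>p. fst (snd p))" and "cl = (\<lambda>p. snd (snd p))"
  have Hc: "parabolic_H q = (cx q)^2 - (cy q)^3 + cl q * cy q" for q
    by (cases q) (simp add: parabolic_H_def cx_def cy_def cl_def)
  have c0: "cx 0 = 0" "cy 0 = 0" "cl 0 = 0" by (simp_all add: cx_def cy_def cl_def)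
  have blc: "bounded_linear cx" "bounded_linear cy" "bounded_linear cl" unfolding cx_def cy_def cl_def
    by (intro bounded_linear_fst bounded_linear_snd bounded_linear_compose[OF bounded_linear_fst bounded_linear_snd]
       bounded_linear_compose[OF bounded_linear_snd bounded_linear_snd])+
  have fDc: "fD (\<lambda>p. c (f p)) p = (\<lambda>v. c (f' v))" if "bounded_linear c" "(f has_derivative f') (at p)"
    for c :: "R3 \<Rightarrow> real" and f :: "'z::real_normed_vector \<Rightarrow> R3" and f' p
    by (rule fD_eqI[OF bounded_linear.has_derivative[OF that]])
  have smc: "smooth_on S (\<lambda>p. c (f p))" if "open S" "bounded_linear c" "smooth_on S f"
    for c :: "R3 \<Rightarrow> real" and f :: "'z::real_normed_vector \<Rightarrow> R3" and S
    by (intro smooth_onI bounded_linear.Ck_on_compose[OF that(2,1)] smooth_onD[OF that(3)])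
  have idsm: "smooth_on S (\<lambda>p::'z::real_normed_vector. p)" if "open S" for S by (intro smooth_onI Ck_on_id that)

  \<comment> \<open>The discrete gradient of the return map\<close>
  obtain a0 b0 where ab: "a0 + fst (fD \<mu> 0 (a0, b0, 0)) \<noteq> 0" using \<mu>_transversal by blast
  \<comment> \<open>\<open>e\<close> is the \<open>\<lambda>\<close> direction, in which the factor
    \<open>b\<close> has derivative 1 at the origin; \<open>(a0, b0, 0)\<close> is a slice direction
    in which \<open>x + x'\<close> varies.\<close>
  have "\<exists>W \<tau>. open W \<and> 0 \<in> W \<and> W \<subseteq> N \<and> smooth_on W \<tau> \<and>
     (\<forall>p\<in>W. cx (\<mu> p) - cx p = \<tau> p * (cl p - ((cy p)^2 + cy p * cy (\<mu> p) + (cy (\<mu> p))^2)) \<and>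
        cy (\<mu> p) - cy p = - \<tau> p * (cx p + cx (\<mu> p)))"
  proof (rule discrete_gradient[OF N, where e="(0, 0, 1)" and v="(a0, b0, 0)"])
    show "smooth_on N cx" "smooth_on N cy" "smooth_on N cl" using smc[OF N(1) _ idsm[OF N(1)]] blc by blast+
    show "smooth_on N (\<lambda>p. cx (\<mu> p))" "smooth_on N (\<lambda>p. cy (\<mu> p))" using smc[OF N(1) _ \<mu>(1)] blc by blast+
    show "(cx (\<mu> p))^2 - (cy (\<mu> p))^3 + cl p * cy (\<mu> p) = (cx p)^2 - (cy p)^3 + cl p * cy p" if "p \<in> N" for p
      using H[OF that] lam[OF that] unfolding Hc by (simp add: cl_def)
    have fDcl: "fD cl 0 = cl" using fDc[OF blc(3) has_derivative_ident] by simp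
    show "fD cl 0 (0, 0, 1) \<noteq> 0" "fD cl 0 (a0, b0, 0) = 0" unfolding fDcl by (simp_all add: cl_def)
    have "fD cx 0 = cx" using fDc[OF blc(1) has_derivative_ident] by simp
    moreover have "fD (\<lambda>p. cx (\<mu> p)) 0 = (\<lambda>v. cx (fD \<mu> 0 v))" by (rule fDc[OF blc(1) d\<mu>[OF N(2)]])
    ultimately show "fD cx 0 (a0, b0, 0) + fD (\<lambda>p. cx (\<mu> p)) 0 (a0, b0, 0) \<noteq> 0" using ab by (simp add: cx_def)
  qed (simp_all add: c0 \<mu>(2))
  then obtain W\<mu> \<tau> where W\<mu>: "open W\<mu>" "0 \<in> W\<mu>" "W\<mu> \<subseteq> N" "smooth_on W\<mu> \<tau>"
    "\<And>p. p \<in> W\<mu> \<Longrightarrow> cx (\<mu> p) - cx p = \<tau> p * (cl p - ((cy p)^2 + cy p * cy (\<mu> p) + (cy (\<mu> p))^2))"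
    "\<And>p. p \<in> W\<mu> \<Longrightarrow> cy (\<mu> p) - cy p = - \<tau> p * (cx p + cx (\<mu> p))" by blast

  \<comment> \<open>The flow of \<open>H\<close> near its equilibrium\<close>
  \<comment> \<open>The transit time expected at the origin, the solution of
    \<open>- T0 / g 0 = \<tau> 0\<close>.\<close>
  define T0 where "T0 = - (g 0 * \<tau> 0)"
  \<comment> \<open>The flow has to exist up to time \<open>T0\<close>, which need not be small; as
    \<open>X 0 = 0\<close>, shrinking the ball of initial points achieves this.\<close>
  define a where "a = \<bar>T0\<bar> + 1"
  have a: "a > 0" "T0 \<in> {-a<..<a}" by (auto simp: a_def)
  obtain r where r: "r > 0" "cball 0 r \<subseteq> N" using N open_contains_cball by blast
  obtain L where L: "L \<ge> 0" "\<And>x y. x \<in> cball 0 r \<Longrightarrow> y \<in> cball 0 r \<Longrightarrow> norm (X x - X y) \<le> L * norm (x - y)"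
    and flow: "\<And>a \<rho>. a > 0 \<Longrightarrow> \<rho> > 0 \<Longrightarrow> (\<rho> + norm (X 0) * a) * exp (L * a) < r \<Longrightarrow>
      (\<exists>\<Phi>. smooth_on ({-a<..<a} \<times> ball 0 \<rho>) \<Phi> \<and>
        (\<forall>p\<in>ball 0 \<rho>. \<Phi> (0, p) = p \<and> (\<forall>t\<in>{-a<..<a}. \<Phi> (t, p) \<in> ball 0 r \<and>
           ((\<lambda>t. \<Phi> (t, p)) has_vector_derivative X (\<Phi> (t, p))) (at t))))"
    using local_flow[OF N(1) smooth_X r] by blast
  \<comment> \<open>Chosen so that the bound in \<open>local_flow\<close> equals
    \<open>r / 2\<close>.\<close>
  define \<rho> where "\<rho> = r / (2 * exp (L * a))"
  have \<rho>: "\<rho> > 0" using r by (simp add: \<rho>_def)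
  have "(\<rho> + norm (X 0) * a) * exp (L * a) = r / 2" by (simp add: X_zero \<rho>_def)
  also have "\<dots> < r" using r by simp
  finally have small: "(\<rho> + norm (X 0) * a) * exp (L * a) < r" .
  let ?J = "{-a<..<a}" and ?B = "ball (0::R3) \<rho>"
  let ?D = "?J \<times> ?B"
  obtain \<Phi> where \<Phi>: "smooth_on ?D \<Phi>" "\<And>p. p \<in> ?B \<Longrightarrow> \<Phi> (0, p) = p"
    "\<And>t p. t \<in> ?J \<Longrightarrow> p \<in> ?B \<Longrightarrow> \<Phi> (t, p) \<in> ball 0 r"
    "\<And>t p. t \<in> ?J \<Longrightarrow> p \<in> ?B \<Longrightarrow> ((\<lambda>t. \<Phi> (t, p)) has_vector_derivative X (\<Phi> (t, p))) (at t)"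
    using flow[OF a(1) \<rho> small] by blast
  have D: "open ?D" by (intro open_Times) auto
  have J: "convex ?J" "0 \<in> ?J" using a by auto
  have B0: "0 \<in> ?B" using \<rho> by simp
  have \<Phi>r: "\<Phi> (t, p) \<in> cball 0 r" "\<Phi> (t, p) \<in> N" if "t \<in> ?J" "p \<in> ?B" for t p
  proof -
    show "\<Phi> (t, p) \<in> cball 0 r" using \<Phi>(3)[OF that] by (simp add: less_imp_le)
    then show "\<Phi> (t, p) \<in> N" using r(2) by blast
  qed
  have \<Phi>d: "((\<lambda>t. \<Phi> (t, p)) has_vector_derivative X (\<Phi> (t, p))) (at t within Y)" if "t \<in> ?J" "p \<in> ?B" for t p Y
    by (rule has_vector_derivative_at_within[OF \<Phi>(4)[OF that]])
  have cons: "f (\<Phi> (t, p)) = f p"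
    if "t \<in> ?J" "p \<in> ?B" and f: "\<And>q. \<exists>f'. (f has_derivative f') (at q) \<and> f' (X q) = 0"
    for f :: "R3 \<Rightarrow> real" and t p
  proof -
    have "((\<lambda>t. f (\<Phi> (t, p))) has_derivative (\<lambda>_. 0)) (at s within ?J)" if s: "s \<in> ?J" for s
    proof -
      obtain f' where f': "(f has_derivative f') (at (\<Phi> (s, p)))" "f' (X (\<Phi> (s, p))) = 0" using f by blast
      have "((f \<circ> (\<lambda>t. \<Phi> (t, p))) has_vector_derivative f' (X (\<Phi> (s, p)))) (at s within ?J)"
        by (rule vector_derivative_diff_chain_within[OF \<Phi>d[OF s \<open>p \<in> ?B\<close>] has_derivative_at_withinI[OF f'(1)]])
      then show ?thesis using f'(2) by (simp add: has_vector_derivative_def comp_def)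
    qed
    then have "\<exists>k. \<forall>s\<in>?J. f (\<Phi> (s, p)) = k" by (intro has_derivative_zero_constant[OF J(1)]) auto
    then obtain k where k: "\<And>s. s \<in> ?J \<Longrightarrow> f (\<Phi> (s, p)) = k" by blast
    show ?thesis using k[OF \<open>t \<in> ?J\<close>] k[OF J(2)] \<Phi>(2)[OF \<open>p \<in> ?B\<close>] by simp
  qed
  have \<Phi>l: "cl (\<Phi> (t, p)) = cl p" if "t \<in> ?J" "p \<in> ?B" for t p
  proof (rule cons[OF that])
    fix q :: R3
    show "\<exists>f'. (cl has_derivative f') (at q) \<and> f' (X q) = 0"
      by (intro exI[of _ cl] conjI bounded_linear_imp_has_derivative[OF blc(3)])
        (simp add: cl_def parabolic_field_def case_prod_beta')
  qed
  have \<Phi>H: "parabolic_H (\<Phi> (t, p)) = parabolic_H p" if "t \<in> ?J" "p \<in> ?B" for t p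
  proof (rule cons[OF that])
    fix q :: R3
    obtain x y l where "q = (x, y, l)" by (metis surj_pair)
    then show "\<exists>f'. (parabolic_H has_derivative f') (at q) \<and> f' (X q) = 0"
      using parabolic_H_derivative[of x l y]
      by (intro exI[of _ "\<lambda>(a, b, c). 2 * x * a + (l - 3 * y^2) * b + y * c"]) (simp add: parabolic_field_def divide_inverse algebra_simps)
  qed
  have \<Phi>0: "\<Phi> (t, 0) = 0" if t: "t \<in> ?J" for t
  proof (rule lipschitz_curves_equal[OF J t, where w="\<lambda>_. 0" and Y=X and K="cball 0 r" and L=L])
    fix x assume x: "x \<in> ?J"
    show "((\<lambda>t. \<Phi> (t, 0)) has_vector_derivative X (\<Phi> (x, 0))) (at x within ?J)" by (rule \<Phi>d[OF x B0])
    show "((\<lambda>t. 0) has_vector_derivative X 0) (at x within ?J)" by (simp add: X_zero)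
    show "\<Phi> (x, 0) \<in> cball 0 r \<and> 0 \<in> cball (0::R3) r" using \<Phi>r(1)[OF x B0] r by simp
  qed (use L \<Phi>(2)[OF B0] in auto)
  obtain Bd where Bd: "Bd \<ge> 0" "\<And>z v. z \<in> cball 0 r \<Longrightarrow> norm (fD X z v) \<le> Bd * norm v"
    using C1_compact_bound[OF smooth_onD[OF smooth_X] compact_cball r(2)] by blast
  have var: "((\<lambda>t. fD \<Phi> (t, p) (0, v)) has_vector_derivative fD X (\<Phi> (t, p)) (fD \<Phi> (t, p) (0, v))) (at t within Y)"
    if "t \<in> ?J" "p \<in> ?B" for t p v Y
  proof (rule has_vector_derivative_at_within, rule flow_variational_equation[OF D \<Phi>(1) N(1) smooth_X])
    show "\<Phi> q \<in> N" if "q \<in> ?D" for q using \<Phi>r(2)[of "fst q" "snd q"] that by (simp add: mem_Times_iff)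
    show "((\<lambda>t. \<Phi> (t, p)) has_vector_derivative X (\<Phi> (t, p))) (at t)" if "(t, p) \<in> ?D" for t p
      using \<Phi>(4)[of t p] that by (simp only: mem_Times_iff fst_conv snd_conv)
  qed (use that in simp)
  have linX: "linear (fD X z)" if "z \<in> N" for z by (rule smooth_on_linear_fD[OF smooth_X that])
  have \<Phi>init: "fD \<Phi> (0, p) (0, v) = v" if p: "p \<in> ?B" for p v
  proof -
    have "(0, p) \<in> ?D" using J p by simp
    from flow_initial_derivative[OF \<Phi>(1) this]
    have "((\<lambda>p. p) has_derivative (\<lambda>v. fD \<Phi> (0, p) (0, v))) (at p)"
      by (rule has_derivative_transform_within_open[OF _ open_ball p]) (rule \<Phi>(2))
    from fun_cong[OF has_derivative_unique[OF this has_derivative_ident], of v] show ?thesis .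
  qed
  \<comment> \<open>Both sides solve the variational equation along the flow line and agree at time
    0.\<close>
  have \<Phi>X: "fD \<Phi> (t, p) (0, X p) = X (\<Phi> (t, p))" if t: "t \<in> ?J" and p: "p \<in> ?B" for t p
  proof (rule equal_linear_curves[OF J t, where A="\<lambda>t. fD X (\<Phi> (t, p))" and B=Bd])
    show "fD \<Phi> (0, p) (0, X p) = X (\<Phi> (0, p))" using \<Phi>init[OF p] \<Phi>(2)[OF p] by simp
    fix s assume s: "s \<in> ?J"
    show "((\<lambda>t. fD \<Phi> (t, p) (0, X p)) has_vector_derivative fD X (\<Phi> (s, p)) (fD \<Phi> (s, p) (0, X p))) (at s within ?J)"
      by (rule var[OF s p])
    show "((\<lambda>t. X (\<Phi> (t, p))) has_vector_derivative fD X (\<Phi> (s, p)) (X (\<Phi> (s, p)))) (at s within ?J)"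
      using vector_derivative_diff_chain_within[OF \<Phi>d[OF s p] has_derivative_at_withinI[OF smooth_on_derivative[OF smooth_X \<Phi>r(2)[OF s p]]]]
      by (simp only: comp_def)
    show "linear (fD X (\<Phi> (s, p)))" by (rule linX[OF \<Phi>r(2)[OF s p]])
    show "norm (fD X (\<Phi> (s, p)) v) \<le> Bd * norm v" for v by (rule Bd(2)[OF \<Phi>r(1)[OF s p]])
  qed (rule Bd)

  \<comment> \<open>The linearised flow and its discrete gradient\<close>
  have g0: "g 0 \<noteq> 0" by (rule g(2)[OF N(2)])
  \<comment> \<open>The numerators vanish at the origin, so the derivative of \<open>g\<close> drops
    out.\<close>
  have fDX0: "fD X 0 = (\<lambda>v. (- snd (snd v) / g 0, 2 * fst v / g 0, 0))"
  proof (rule fD_eqI)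
    have dg: "(g has_derivative fD g 0) (at 0)" by (rule smooth_on_derivative[OF g(1) N(2)])
    have "((\<lambda>p::R3. (- (snd (snd p) - 3 * (fst (snd p))^2) / g p, 2 * fst p / g p, 0::real)) has_derivative
        (\<lambda>v. (- snd (snd v) / g 0, 2 * fst v / g 0, 0))) (at 0)"
      using g0 by (auto intro!: derivative_eq_intros dg simp: fun_eq_iff field_simps power2_eq_square)
    then show "(X has_derivative (\<lambda>v. (- snd (snd v) / g 0, 2 * fst v / g 0, 0))) (at 0)"
      by (simp add: parabolic_field_def case_prod_beta')
  qed
  \<comment> \<open>The linearisation is nilpotent on the slice, so its solution is affine in
    \<open>t\<close>.\<close>
  have \<Phi>lin: "fD \<Phi> (t, 0) (0, (1, 0, 0)) = (1, 2 * t / g 0, 0)" if t: "t \<in> ?J" for t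
  proof (rule equal_linear_curves[OF J t, where A="\<lambda>t. fD X 0" and B=Bd])
    show "fD \<Phi> (0, 0) (0, (1, 0, 0)) = (1, 2 * 0 / g 0, 0)" using \<Phi>init[OF B0] by simp
    fix s assume s: "s \<in> ?J"
    show "((\<lambda>t. fD \<Phi> (t, 0) (0, (1, 0, 0))) has_vector_derivative fD X 0 (fD \<Phi> (s, 0) (0, (1, 0, 0)))) (at s within ?J)"
      using var[OF s B0, of "(1, 0, 0)" ?J] \<Phi>0[OF s] by simp
    have "((\<lambda>t. (1::real, 2 * t / g 0, 0::real)) has_derivative (\<lambda>h. (0, 2 * h / g 0, 0))) (at s within ?J)"
      using g0 by (auto intro!: derivative_eq_intros)
    then show "((\<lambda>t. (1, 2 * t / g 0, 0)) has_vector_derivative fD X 0 (1, 2 * s / g 0, 0)) (at s within ?J)"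
      by (simp add: has_vector_derivative_def fDX0 mult.commute)
    show "linear (fD X 0)" by (rule linX[OF N(2)])
    show "norm (fD X 0 v) \<le> Bd * norm v" for v using Bd(2)[of 0] r by simp
  qed (rule Bd)
  have D0: "(t, 0) \<in> ?D" if "t \<in> ?J" for t using that B0 by simp
  have d\<Phi>: "(\<Phi> has_derivative fD \<Phi> q) (at q)" if "q \<in> ?D" for q by (rule smooth_on_derivative[OF \<Phi>(1) that])
  have sndD: "smooth_on ?D (\<lambda>q::real \<times> R3. snd q)" by (intro smooth_onI Ck_intros D)
  have dsnd: "((\<lambda>q::real \<times> R3. snd q) has_derivative (\<lambda>v. snd v)) (at q)" for q
    by (intro has_derivative_snd has_derivative_ident)
  \<comment> \<open>Time is one more parameter here. In direction \<open>(1, 0, 0)\<close> of the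
    initial point the sum \<open>x + x'\<close> has derivative 2.\<close>
  have "\<exists>W \<sigma>. open W \<and> (T0, 0) \<in> W \<and> W \<subseteq> ?D \<and> smooth_on W \<sigma> \<and>
     (\<forall>q\<in>W. cx (\<Phi> q) - cx (snd q) = \<sigma> q * (cl (snd q) - ((cy (snd q))^2 + cy (snd q) * cy (\<Phi> q) + (cy (\<Phi> q))^2)) \<and>
        cy (\<Phi> q) - cy (snd q) = - \<sigma> q * (cx (snd q) + cx (\<Phi> q)))"
  proof (rule discrete_gradient[OF D D0[OF a(2)], where e="(0, (0, 0, 1))" and v="(0, (1, 0, 0))"])
    show "smooth_on ?D (\<lambda>q. cx (snd q))" "smooth_on ?D (\<lambda>q. cy (snd q))" "smooth_on ?D (\<lambda>q. cl (snd q))"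
      using smc[OF D _ sndD] blc by blast+
    show "smooth_on ?D (\<lambda>q. cx (\<Phi> q))" "smooth_on ?D (\<lambda>q. cy (\<Phi> q))" using smc[OF D _ \<Phi>(1)] blc by blast+
    show "(cx (\<Phi> q))^2 - (cy (\<Phi> q))^3 + cl (snd q) * cy (\<Phi> q) = (cx (snd q))^2 - (cy (snd q))^3 + cl (snd q) * cy (snd q)"
      if "q \<in> ?D" for q
      using \<Phi>H[of "fst q" "snd q"] \<Phi>l[of "fst q" "snd q"] that unfolding Hc by (auto simp: mem_Times_iff)
    show "fD (\<lambda>q. cl (snd q)) (T0, 0) (0, (0, 0, 1)) \<noteq> 0" "fD (\<lambda>q. cl (snd q)) (T0, 0) (0, (1, 0, 0)) = 0"
      unfolding fDc[OF blc(3) dsnd] by (simp_all add: cl_def)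
    show "fD (\<lambda>q. cx (snd q)) (T0, 0) (0, (1, 0, 0)) + fD (\<lambda>q. cx (\<Phi> q)) (T0, 0) (0, (1, 0, 0)) \<noteq> 0"
      unfolding fDc[OF blc(1) dsnd] fDc[OF blc(1) d\<Phi>[OF D0[OF a(2)]]] \<Phi>lin[OF a(2)] by (simp add: cx_def)
  qed (simp_all add: c0 \<Phi>0[OF a(2)])
  then obtain W\<sigma> \<sigma> where W\<sigma>: "open W\<sigma>" "(T0, 0) \<in> W\<sigma>" "W\<sigma> \<subseteq> ?D" "smooth_on W\<sigma> \<sigma>"
    "\<And>q. q \<in> W\<sigma> \<Longrightarrow> cx (\<Phi> q) - cx (snd q) = \<sigma> q * (cl (snd q) - ((cy (snd q))^2 + cy (snd q) * cy (\<Phi> q) + (cy (\<Phi> q))^2))"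
    "\<And>q. q \<in> W\<sigma> \<Longrightarrow> cy (\<Phi> q) - cy (snd q) = - \<sigma> q * (cx (snd q) + cx (\<Phi> q))" by blast
  \<comment> \<open>The \<open>y\<close>-equation of the discrete gradient is differentiated at the
    equilibrium in the \<open>x\<close> direction. The term containing the derivative of
    \<open>\<sigma>\<close> has the factor \<open>x + x' = 0\<close> and disappears.\<close>
  have \<sigma>0: "\<sigma> (t, 0) = - t / g 0" if q: "(t, 0) \<in> W\<sigma>" for t
  proof -
    have t: "t \<in> ?J" and qD: "(t, 0) \<in> ?D" using q W\<sigma>(3) by auto
    let ?v = "(0, (1, 0, 0)) :: real \<times> R3"
    have 1: "((\<lambda>q. cy (\<Phi> q) - cy (snd q)) has_derivative (\<lambda>v. cy (fD \<Phi> (t, 0) v) - cy (snd v))) (at (t, 0))"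
      by (intro has_derivative_diff bounded_linear.has_derivative[OF blc(2)] d\<Phi>[OF qD] dsnd)
    have d\<sigma>: "(\<sigma> has_derivative fD \<sigma> (t, 0)) (at (t, 0))" by (rule smooth_on_derivative[OF W\<sigma>(4) q])
    have "((\<lambda>q. - \<sigma> q * (cx (snd q) + cx (\<Phi> q))) has_derivative
       (\<lambda>v. - \<sigma> (t, 0) * (cx (snd v) + cx (fD \<Phi> (t, 0) v)) + - fD \<sigma> (t, 0) v * (cx (snd (t, 0)) + cx (\<Phi> (t, 0))))) (at (t, 0))"
      by (intro has_derivative_mult has_derivative_minus has_derivative_add bounded_linear.has_derivative[OF blc(1)] d\<Phi>[OF qD] dsnd d\<sigma>)
    then have 2: "((\<lambda>q. cy (\<Phi> q) - cy (snd q)) has_derivative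
       (\<lambda>v. - \<sigma> (t, 0) * (cx (snd v) + cx (fD \<Phi> (t, 0) v)) + - fD \<sigma> (t, 0) v * (cx (snd (t, 0)) + cx (\<Phi> (t, 0))))) (at (t, 0))"
      by (rule has_derivative_transform_within_open[OF _ W\<sigma>(1) q W\<sigma>(6)[symmetric]])
    from fun_cong[OF has_derivative_unique[OF 1 2], of ?v]
    have "2 * t / g 0 = - \<sigma> (t, 0) * 2" by (simp add: \<Phi>lin[OF t] \<Phi>0[OF t] c0) (simp add: cx_def cy_def)
    then show ?thesis by simp
  qed

  \<comment> \<open>The transit time as an implicit function\<close>
  define SF where "SF = {q \<in> W\<sigma>. snd q \<in> W\<mu>}"
  have SF: "open SF" unfolding SF_def
    by (rule open_continuous_preimage[OF W\<sigma>(1) _ W\<mu>(1)]) (intro continuous_intros)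
  have "smooth_on SF (\<lambda>q. snd q)" by (intro smooth_onI Ck_intros SF)
  then have \<tau>s: "smooth_on SF (\<lambda>q. \<tau> (snd q))"
    by (rule smooth_on_compose[OF SF W\<mu>(1) _ W\<mu>(4)]) (auto simp: SF_def)
  have \<sigma>s: "smooth_on SF \<sigma>" by (rule smooth_on_subset[OF W\<sigma>(4)]) (auto simp: SF_def)
  define F where "F = (\<lambda>q. \<sigma> q - \<tau> (snd q))"
  have Fs: "smooth_on SF F" unfolding F_def by (intro smooth_onI Ck_on_diff SF smooth_onD[OF \<sigma>s] smooth_onD[OF \<tau>s])
  have SF0: "(T0, 0) \<in> SF" using W\<sigma>(2) W\<mu>(2) by (simp add: SF_def)
  have F0: "F (T0, 0) = 0" unfolding F_def \<sigma>0[OF W\<sigma>(2)] using g0 by (simp add: T0_def)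
  \<comment> \<open>On the axis \<open>p = 0\<close> the function \<open>F\<close> equals
    \<open>- t / g 0 - \<tau> 0\<close>, so its time derivative is \<open>- 1 / g 0\<close>.\<close>
  have Fnz: "fD F (T0, 0) (1, 0) \<noteq> 0"
  proof -
    have l: "((\<lambda>t::real. (t, 0::R3)) has_derivative (\<lambda>h. (h, 0))) (at T0)" by (auto intro!: derivative_eq_intros)
    have 1: "((\<lambda>t. F (t, 0)) has_derivative (\<lambda>h. fD F (T0, 0) (h, 0))) (at T0)"
      using has_derivative_compose[OF l smooth_on_derivative[OF Fs SF0]] .
    let ?V = "{t. (t, 0) \<in> SF}"
    have "continuous_on UNIV (\<lambda>t::real. (t, 0::R3))" by (intro continuous_intros)
    from open_continuous_preimage[OF open_UNIV this SF] have V: "open ?V" by simp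
    have "((\<lambda>t. - t / g 0 - \<tau> 0) has_derivative (\<lambda>h. - h / g 0)) (at T0)"
      using g0 by (auto intro!: derivative_eq_intros)
    then have 2: "((\<lambda>t. F (t, 0)) has_derivative (\<lambda>h. - h / g 0)) (at T0)"
      by (rule has_derivative_transform_within_open[OF _ V]) (use SF0 \<sigma>0 in \<open>auto simp: F_def SF_def\<close>)
    from fun_cong[OF has_derivative_unique[OF 1 2], of 1] show ?thesis using g0 by simp
  qed
  obtain WT T where WT: "open WT" "0 \<in> WT" "smooth_on WT T" "T 0 = T0"
    "\<And>p. p \<in> WT \<Longrightarrow> (T p, p) \<in> SF" "\<And>p. p \<in> WT \<Longrightarrow> F (T p, p) = 0"
    using implicit_function_smooth[OF SF Fs SF0 F0 Fnz] by blast
  have TD: "(T p, p) \<in> ?D" "T p \<in> ?J" "p \<in> ?B" "p \<in> W\<mu>" "p \<in> N" "(T p, p) \<in> W\<sigma>" if "p \<in> WT" for p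
    using WT(5)[OF that] W\<sigma>(3) W\<mu>(3) by (auto simp: SF_def)
  have pairT: "smooth_on WT (\<lambda>p. (T p, p))" by (intro smooth_onI Ck_intros WT smooth_onD[OF WT(3)])
  have \<Phi>Ts: "smooth_on WT (\<lambda>p. \<Phi> (T p, p))"
    by (rule smooth_on_compose[OF WT(1) D pairT \<Phi>(1)]) (use TD(1) in blast)
  \<comment> \<open>The quantity whose modulus \<open>discrete_gradient_unique\<close> requires to
    be below 1; it is 0 at the origin.\<close>
  define s where "s = (\<lambda>p. (\<tau> p)^2 * (cy p + cy (\<mu> p) + cy (\<Phi> (T p, p))))"
  have "continuous_on WT s" unfolding s_def
  proof (intro continuous_intros)
    show "continuous_on WT \<tau>" by (rule continuous_on_subset[OF smooth_on_continuous[OF W\<mu>(4)]]) (use TD(4) in blast)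
    show "continuous_on WT cy" by (rule linear_continuous_on[OF blc(2)])
    show "continuous_on WT (\<lambda>p. cy (\<mu> p))"
      by (rule continuous_on_subset[OF smooth_on_continuous[OF smc[OF N(1) blc(2) \<mu>(1)]]]) (use TD(5) in blast)
    show "continuous_on WT (\<lambda>p. cy (\<Phi> (T p, p)))" by (rule smooth_on_continuous[OF smc[OF WT(1) blc(2) \<Phi>Ts]])
  qed
  then have "open {p \<in> WT. s p \<in> {-1<..<1}}" by (rule open_continuous_preimage[OF WT(1)]) simp
  moreover define W1 where "W1 = {p \<in> WT. s p \<in> {-1<..<1}}"
  ultimately have W1: "open W1" by simp
  have W1WT: "W1 \<subseteq> WT" by (auto simp: W1_def)
  have zW1: "0 \<in> W1" using WT \<Phi>0[OF a(2)] by (simp add: W1_def s_def c0 \<mu>(2))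
  have \<mu>\<Phi>: "\<mu> p = \<Phi> (T p, p)" if p: "p \<in> W1" for p
  proof -
    have pT: "p \<in> WT" using p W1WT by blast
    note t = TD[OF pT]
    have \<sigma>\<tau>: "\<sigma> (T p, p) = \<tau> p" using WT(6)[OF pT] by (simp add: F_def)
    have "cx (\<mu> p) = cx (\<Phi> (T p, p)) \<and> cy (\<mu> p) = cy (\<Phi> (T p, p))"
    proof (rule discrete_gradient_unique)
      show "cx (\<mu> p) - cx p = \<tau> p * (cl p - ((cy p)^2 + cy p * cy (\<mu> p) + (cy (\<mu> p))^2))" by (rule W\<mu>(5)[OF t(4)])
      show "cy (\<mu> p) - cy p = - \<tau> p * (cx p + cx (\<mu> p))" by (rule W\<mu>(6)[OF t(4)])
      show "cx (\<Phi> (T p, p)) - cx p = \<tau> p * (cl p - ((cy p)^2 + cy p * cy (\<Phi> (T p, p)) + (cy (\<Phi> (T p, p)))^2))"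
        using W\<sigma>(5)[OF t(6)] \<sigma>\<tau> by simp
      show "cy (\<Phi> (T p, p)) - cy p = - \<tau> p * (cx p + cx (\<Phi> (T p, p)))" using W\<sigma>(6)[OF t(6)] \<sigma>\<tau> by simp
      show "\<bar>(\<tau> p)^2 * (cy p + cy (\<mu> p) + cy (\<Phi> (T p, p)))\<bar> < 1" using p by (simp add: W1_def s_def abs_less_iff)
    qed
    moreover have "cl (\<mu> p) = cl (\<Phi> (T p, p))" using lam[OF t(5)] \<Phi>l[OF t(2,3)] by (simp add: cl_def)
    ultimately show ?thesis by (simp add: cx_def cy_def cl_def prod_eq_iff)
  qed
  \<comment> \<open>\<open>\<mu> p = \<Phi> (T p, p)\<close> is differentiated along
    \<open>X\<close>. As \<open>\<mu>\<close> and the flow both preserve \<open>X\<close>, only the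
    product of \<open>fD T p (X p)\<close> and \<open>X (\<mu> p)\<close> remains, and it must
    vanish.\<close>
  have TX: "fD T p (X p) = 0" if p: "p \<in> W1" for p
  proof -
    have pT: "p \<in> WT" using p W1WT by blast
    note t = TD[OF pT]
    have "((\<lambda>p. (T p, p)) has_derivative (\<lambda>v. (fD T p v, v))) (at p)"
      by (intro has_derivative_Pair smooth_on_derivative[OF WT(3) pT] has_derivative_ident)
    from has_derivative_compose[OF this d\<Phi>[OF t(1)]]
    have "((\<lambda>p. \<Phi> (T p, p)) has_derivative (\<lambda>v. fD \<Phi> (T p, p) (fD T p v, v))) (at p)" .
    then have "(\<mu> has_derivative (\<lambda>v. fD \<Phi> (T p, p) (fD T p v, v))) (at p)"
      by (rule has_derivative_transform_within_open[OF _ W1 p \<mu>\<Phi>[symmetric]])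
    from fD_eqI[OF this] have "fD \<mu> p (X p) = fD \<Phi> (T p, p) (fD T p (X p), X p)" by simp
    also have "(fD T p (X p), X p) = fD T p (X p) *\<^sub>R (1, 0) + (0, X p)" by simp
    also have "fD \<Phi> (T p, p) \<dots> = fD T p (X p) *\<^sub>R fD \<Phi> (T p, p) (1, 0) + fD \<Phi> (T p, p) (0, X p)"
      by (simp only: linear_add[OF smooth_on_linear_fD[OF \<Phi>(1) t(1)]] linear_cmul[OF smooth_on_linear_fD[OF \<Phi>(1) t(1)]])
    also have "\<dots> = fD T p (X p) *\<^sub>R X (\<mu> p) + X (\<mu> p)"
      using flow_time_derivative[OF \<Phi>(1) t(1) \<Phi>(4)[OF t(2,3)]] \<Phi>X[OF t(2,3)] \<mu>\<Phi>[OF p] by simp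
    finally have eq: "fD T p (X p) *\<^sub>R X (\<mu> p) = 0" using \<mu>_preserves_X[OF t(5)] by simp
    show ?thesis
    proof (cases "X (\<mu> p) = 0")
      \<comment> \<open>The slice derivative of \<open>\<mu>\<close> is invertible by
        \<open>area\<close>, so here \<open>X p = 0\<close>.\<close>
      case True
      obtain c d where Xp: "X p = (c, d, 0)" by (simp add: parabolic_field_def case_prod_beta')
      have z: "fD \<mu> p (c, d, 0) = 0" using \<mu>_preserves_X[OF t(5)] True Xp by simp
      have "d = 0" "c = 0"
        using area[OF t(5), of c d 1 0, unfolded z] area[OF t(5), of c d 0 1, unfolded z] g(2)[OF t(5)] by simp_all
      then have "X p = 0" by (simp add: Xp zero_prod_def)
      then show ?thesis using linear_0[OF smooth_on_linear_fD[OF WT(3) pT]] by simp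
    qed (use eq in simp)
  qed

  \<comment> \<open>The potential and its time-one map\<close>
  obtain \<epsilon> where \<epsilon>: "\<epsilon> > 0" "ball 0 \<epsilon> \<subseteq> W1" using W1 zW1 openE by blast
  \<comment> \<open>\<open>parabolic_potential\<close> needs its hypotheses on the ball of twice the
    radius.\<close>
  define \<delta> where "\<delta> = \<epsilon> / 2"
  have \<delta>: "\<delta> > 0" "ball 0 (2 * \<delta>) \<subseteq> W1" using \<epsilon> by (simp_all add: \<delta>_def)
  have Ts: "smooth_on (ball 0 (2 * \<delta>)) T" using smooth_on_subset[OF WT(3)] \<delta>(2) W1WT by blast
  have "\<exists>K. smooth_on (ball 0 \<delta>) K \<and> (\<forall>x y l. (x, y, l) \<in> ball 0 \<delta> \<longrightarrow>
      fD K (x, y, l) (1, 0, 0) = T (x, y, l) * (2 * x) \<and> fD K (x, y, l) (0, 1, 0) = T (x, y, l) * (l - 3 * y^2))"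
  proof (rule parabolic_potential[OF Ts \<delta>(1)])
    fix x y l :: real assume "(x, y, l) \<in> ball 0 (2 * \<delta>)"
    then have p: "(x, y, l) \<in> W1" and pT: "(x, y, l) \<in> WT" using \<delta>(2) W1WT by blast+
    let ?p = "(x, y, l)"
    note gp = g(2)[OF TD(5)[OF pT]] and lT = smooth_on_linear_fD[OF WT(3) pT]
    have "X ?p = (- (l - 3 * y^2) / g ?p) *\<^sub>R (1, 0, 0) + (2 * x / g ?p) *\<^sub>R (0, 1, 0)"
      by (simp add: parabolic_field_def)
    then have "fD T ?p (X ?p) = (- (l - 3 * y^2) / g ?p) * fD T ?p (1, 0, 0) + (2 * x / g ?p) * fD T ?p (0, 1, 0)"
      by (simp only: linear_add[OF lT] linear_cmul[OF lT] real_scaleR_def)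
    then show "fD T ?p (1, 0, 0) * (l - 3 * y^2) = fD T ?p (0, 1, 0) * (2 * x)"
      using TX[OF p] gp by (simp add: field_simps)
  qed
  then obtain K where K: "smooth_on (ball 0 \<delta>) K"
    "\<And>x y l. (x, y, l) \<in> ball 0 \<delta> \<Longrightarrow> fD K (x, y, l) (1, 0, 0) = T (x, y, l) * (2 * x)"
    "\<And>x y l. (x, y, l) \<in> ball 0 \<delta> \<Longrightarrow> fD K (x, y, l) (0, 1, 0) = T (x, y, l) * (l - 3 * y^2)" by blast
  let ?E = "ball (0::R3) \<delta>"
  have EW1: "?E \<subseteq> W1" using \<delta> by (intro order_trans[OF _ \<delta>(2)] subset_ball) simp
  have EWT: "?E \<subseteq> WT" using EW1 W1WT by blast
  \<comment> \<open>The slice differential of \<open>K\<close> is \<open>T dH\<close>, so its field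
    is that of \<open>H\<close> with the speed factor \<open>T\<close>.\<close>
  have field: "slice_ham_field g K q = T q *\<^sub>R X q" if q: "q \<in> ?E" for q
  proof -
    obtain x y l where qe: "q = (x, y, l)" by (metis surj_pair)
    have "g q \<noteq> 0" using TD(5) EWT q g(2) by blast
    then show ?thesis
      using slice_ham_field_eq[of K x y l g] smooth_on_derivative[OF K(1) q] K(2,3)[of x y l] q
      by (simp add: qe parabolic_field_def) (simp add: divide_inverse algebra_simps)
  qed
  \<comment> \<open>\<open>O1\<close> and \<open>O2\<close> consist of pairs of an initial point and
    a fraction of the transit time at which the flow is defined and lies in \<open>?E\<close>. The
    tube lemma at the origin then gives initial points whose whole path stays in
    \<open>?E\<close>.\<close>
  define O1 where "O1 = {z::R3 \<times> real. fst z \<in> ?E \<and> snd z * T (fst z) \<in> ?J}"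
  have o: "open (?E \<times> (UNIV::real set))" by (intro open_Times) auto
  have cT: "continuous_on ?E T" by (rule smooth_on_continuous[OF smooth_on_subset[OF WT(3) EWT]])
  have cTz: "continuous_on (?E \<times> UNIV) (\<lambda>z. snd z * T (fst z))"
    by (intro continuous_intros continuous_on_compose2[OF cT]) auto
  have "O1 = {z \<in> ?E \<times> UNIV. snd z * T (fst z) \<in> ?J}" by (auto simp: O1_def)
  then have O1: "open O1" using open_continuous_preimage[OF o cTz, of ?J] by simp
  have "continuous_on O1 (\<lambda>z. (snd z * T (fst z), fst z))"
    by (intro continuous_intros continuous_on_subset[OF cTz]) (auto simp: O1_def)
  then have c\<Phi>: "continuous_on O1 (\<lambda>z. \<Phi> (snd z * T (fst z), fst z))"
    by (rule continuous_on_compose2[OF smooth_on_continuous[OF \<Phi>(1)]]) (use TD(3) EWT in \<open>auto simp: O1_def\<close>)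
  define O2 where "O2 = {z \<in> O1. \<Phi> (snd z * T (fst z), fst z) \<in> ?E}"
  have O2: "open O2" unfolding O2_def by (rule open_continuous_preimage[OF O1 c\<Phi> open_ball])
  have sT0: "t * T0 \<in> ?J" if "t \<in> {0..1}" for t
  proof -
    have "\<bar>t * T0\<bar> \<le> 1 * \<bar>T0\<bar>" unfolding abs_mult using that by (intro mult_right_mono) auto
    then show ?thesis by (auto simp: a_def abs_le_iff)
  qed
  have "{0} \<times> {0..1} \<subseteq> O2"
  proof (rule subsetI)
    fix z assume "z \<in> {0::R3} \<times> {0..1::real}"
    then obtain t where z: "z = (0, t)" "t \<in> {0..1}" by blast
    then show "z \<in> O2" using sT0[OF z(2)] \<Phi>0[OF sT0[OF z(2)]] \<delta>(1) WT(4) by (simp add: O2_def O1_def)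
  qed
  then have "\<exists>V. 0 \<in> V \<and> open V \<and> V \<times> {0..1} \<subseteq> O2"
    by (rule Elementary_Topology.tube_lemma[OF compact_Icc O2])
  then obtain V where V: "0 \<in> V" "open V" "V \<times> {0..1} \<subseteq> O2" by blast
  define W where "W = V \<inter> ?E"
  have "time_one_image (slice_ham_field g K) ?E p (\<mu> p)" if p: "p \<in> W" for p
  proof -
    have pE: "p \<in> ?E" and pW1: "p \<in> W1" and pT: "p \<in> WT" using p EW1 EWT by (auto simp: W_def)
    note pB = TD(3)[OF pT]
    \<comment> \<open>The trajectory of \<open>H\<close> run at constant speed \<open>T p\<close>.
      As \<open>T\<close> is constant along it, this is a trajectory of the field of
      \<open>K\<close>.\<close>
    define \<gamma> where "\<gamma> = (\<lambda>t. \<Phi> (t * T p, p))"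
    have in2: "t * T p \<in> ?J" "\<gamma> t \<in> ?E" if "t \<in> {0..1}" for t
    proof -
      have "(p, t) \<in> O2" using V(3) p that by (auto simp: W_def)
      then show "t * T p \<in> ?J" "\<gamma> t \<in> ?E" by (simp_all add: O2_def O1_def \<gamma>_def)
    qed
    have d: "(\<gamma> has_vector_derivative T p *\<^sub>R X (\<gamma> t)) (at t within {0..1})" if t: "t \<in> {0..1}" for t
    proof -
      have "((\<lambda>t. t * T p) has_vector_derivative T p) (at t within {0..1})"
        by (auto intro!: derivative_eq_intros simp: has_vector_derivative_def)
      from vector_diff_chain_within[OF this \<Phi>d[OF in2(1)[OF t] pB]] show ?thesis
        by (simp add: comp_def \<gamma>_def)
    qed
    have Tc: "T (\<gamma> t) = T p" if t: "t \<in> {0..1}" for t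
    proof -
      have "((\<lambda>t. T (\<gamma> t)) has_derivative (\<lambda>_. 0)) (at u within {0..1})" if u: "u \<in> {0..1}" for u
      proof -
        have uW: "\<gamma> u \<in> W1" and uT: "\<gamma> u \<in> WT" using in2(2)[OF u] EW1 EWT by blast+
        have "((T \<circ> \<gamma>) has_vector_derivative fD T (\<gamma> u) (T p *\<^sub>R X (\<gamma> u))) (at u within {0..1})"
          by (rule vector_derivative_diff_chain_within[OF d[OF u] has_derivative_at_withinI[OF smooth_on_derivative[OF WT(3) uT]]])
        then show ?thesis
          by (simp add: linear_cmul[OF smooth_on_linear_fD[OF WT(3) uT]] TX[OF uW] has_vector_derivative_def comp_def)
      qed
      then have "\<exists>k. \<forall>u\<in>{0..1}. T (\<gamma> u) = k" by (intro has_derivative_zero_constant) auto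
      then have "T (\<gamma> t) = T (\<gamma> 0)" using t by auto
      then show ?thesis using \<Phi>(2)[OF pB] by (simp add: \<gamma>_def)
    qed
    show ?thesis unfolding time_one_image_def
    proof (intro exI[of _ \<gamma>] conjI ballI)
      show "\<gamma> 0 = p" using \<Phi>(2)[OF pB] by (simp add: \<gamma>_def)
      show "\<gamma> 1 = \<mu> p" using \<mu>\<Phi>[OF pW1] by (simp add: \<gamma>_def)
      fix t :: real assume t: "t \<in> {0..1}"
      show "\<gamma> t \<in> ?E" by (rule in2(2)[OF t])
      show "(\<gamma> has_vector_derivative slice_ham_field g K (\<gamma> t)) (at t within {0..1})"
        using d[OF t] field[OF in2(2)[OF t]] Tc[OF t] by simp
    qed
  qed
  moreover have "?E \<subseteq> N" using EWT TD(5) by blast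
  moreover have "open W" "0 \<in> W" "W \<subseteq> ?E" using V \<delta> by (auto simp: W_def)
  ultimately show ?thesis using K(1) by (intro exI[of _ K] exI[of _ ?E] exI[of _ W]) auto
qed

end

section \<open>The first return map\<close>

definition emb :: "R3 \<Rightarrow> real \<Rightarrow> R4" where
  "emb p \<phi> = (fst p, fst (snd p), snd (snd p), \<phi>)"

definition pr :: "R4 \<Rightarrow> R3" where
  "pr z = (fst z, fst (snd z), fst (snd (snd z)))"

lemma pr_emb [simp]: "pr (emb p \<phi>) = p" "dphi (emb p \<phi>) = \<phi>"
  by (simp_all add: pr_def emb_def dphi_def)

lemma emb_pr [simp]: "emb (pr z) (dphi z) = z"
  by (simp add: pr_def emb_def dphi_def)

lemma emb_inject [simp]: "emb p s = emb q t \<longleftrightarrow> p = q \<and> s = t"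
  by (auto simp: emb_def prod_eq_iff)

lemma emb_zero [simp]: "emb 0 0 = 0"
  by (simp add: emb_def zero_prod_def)

lemma norm_emb_0: "norm (emb p 0) = norm p"
  by (cases p) (simp add: emb_def norm_Pair)

lemma norm_emb: "norm (emb p t) \<le> norm p + \<bar>t\<bar>"
proof -
  have "emb p t = emb p 0 + (0, 0, 0, t)" by (simp add: emb_def)
  then have "norm (emb p t) \<le> norm (emb p 0) + norm (0::real, 0::real, 0::real, t)" by (metis norm_triangle_ineq)
  then show ?thesis by (simp add: norm_emb_0 norm_Pair)
qed

lemma bounded_linear_pr: "bounded_linear pr"
  unfolding pr_def
  by (intro bounded_linear_Pair bounded_linear_fst bounded_linear_compose[OF bounded_linear_fst bounded_linear_snd]
    bounded_linear_compose[OF bounded_linear_fst bounded_linear_compose[OF bounded_linear_snd bounded_linear_snd]])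

lemma bounded_linear_dphi: "bounded_linear dphi"
  unfolding dphi_def
  by (intro bounded_linear_compose[OF bounded_linear_snd bounded_linear_compose[OF bounded_linear_snd bounded_linear_snd]])

lemma bounded_linear_emb: "bounded_linear (\<lambda>p. emb p 0)"
  unfolding emb_def
  by (intro bounded_linear_Pair bounded_linear_fst bounded_linear_compose[OF bounded_linear_fst bounded_linear_snd]
    bounded_linear_compose[OF bounded_linear_snd bounded_linear_snd] bounded_linear_zero)

lemma section_point_emb: "section_point \<kappa> p = cinv \<kappa> (emb p 0)"
  by (simp add: section_point_def emb_def case_prod_beta')

lemma section3_emb: "p \<in> section3 \<kappa> \<longleftrightarrow> emb p 0 \<in> cimg \<kappa>"
  by (simp add: section3_def emb_def case_prod_beta')

locale parabolic_chart = ham_system U \<A> \<omega> G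
  for U :: "'m::{t2_space,second_countable_topology} set" and \<A> \<omega> G +
  fixes Ht :: "'m \<Rightarrow> real" and \<kappa> :: "'m chart" and h :: "real \<times> real \<Rightarrow> real" and g A B :: "R3 \<Rightarrow> real"
  assumes smooth_Ht: "smooth_fun \<A> Ht" and commute: "poisson_commute \<A> \<omega> Ht G"
    and \<kappa>: "\<kappa> \<in> \<A>" "0 \<in> cimg \<kappa>" and smooth_g: "smooth_on (pr ` cimg \<kappa>) g"
    and H_chart: "\<And>z. z \<in> cimg \<kappa> \<Longrightarrow> h (Ht (cinv \<kappa> z), G (cinv \<kappa> z)) = parabolic_H (pr z)"
    and G_chart: "\<And>z. z \<in> cimg \<kappa> \<Longrightarrow> G (cinv \<kappa> z) = dlam z"
    and \<omega>_chart: "\<And>z v w. z \<in> cimg \<kappa> \<Longrightarrow> \<omega> \<kappa> z v w = g (pr z) * wedge dx dy v w +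
       wedge dlam (\<lambda>u. dphi u + A (pr z) * dx u + B (pr z) * dy u) v w"
begin

text \<open>Of the coordinate differentials only \<open>dphi\<close> is non-zero on the last basis
  vector, so pairing with it returns \<open>dlam\<close>, which is the differential of
  \<open>G\<close> in the chart.\<close>

lemma X_chart: assumes z: "z \<in> cimg \<kappa>" shows "X \<kappa> z = (0, 0, 0, 1)"
proof -
  have "bounded_linear dlam" unfolding dlam_def
    by (intro bounded_linear_compose[OF bounded_linear_fst bounded_linear_compose[OF bounded_linear_snd bounded_linear_snd]])
  then have "((G \<circ> cinv \<kappa>) has_derivative dlam) (at z)"
    by (rule has_derivative_transform_within_open[OF bounded_linear_imp_has_derivative chart(2)[OF \<kappa>(1)] z])
      (simp add: G_chart)
  then have G: "dchart \<kappa> G z = dlam" unfolding dchart_def by (rule fD_eqI)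
  show ?thesis unfolding ham_field_def G
  proof (rule form_dual_eqI)
    show "bilinear (\<omega> \<kappa> z)" "\<omega> \<kappa> z v v = 0" "v \<noteq> 0 \<Longrightarrow> \<exists>w. \<omega> \<kappa> z v w \<noteq> 0" for v
      using \<omega>_props[OF \<kappa>(1)] z by blast+
    show "\<omega> \<kappa> z v (0, 0, 0, 1) = dlam v" for v
      by (simp add: \<omega>_chart[OF z] wedge_def dx_def dy_def dlam_def dphi_def)
  qed
qed

text \<open>If \<open>g\<close> vanished, the vector \<open>(1, 0, 0, - A)\<close>, annihilated by
  \<open>dlam\<close> and by \<open>dphi + A dx + B dy\<close>, would lie in the kernel of
  \<open>\<omega>\<close>.\<close>

lemma g_nonzero: assumes z: "z \<in> cimg \<kappa>" shows "g (pr z) \<noteq> 0"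
proof
  assume g: "g (pr z) = 0"
  let ?v = "(1, 0, 0, - A (pr z)) :: R4"
  have "?v \<noteq> 0" by (simp add: zero_prod_def)
  then obtain w where "\<omega> \<kappa> z ?v w \<noteq> 0" using \<omega>_props(3)[OF \<kappa>(1) z] by blast
  then show False by (simp add: \<omega>_chart[OF z] g wedge_def dx_def dy_def dlam_def dphi_def)
qed

lemma conserved:
  assumes c: "curve {a..b} c" and st: "s \<in> {a..b}" "t \<in> {a..b}"
  shows "G (c s) = G (c t)" "Ht (c s) = Ht (c t)"
proof -
  have 1: "dchart \<kappa>' G z (X \<kappa>' z) = 0" if "\<kappa>' \<in> \<A>" "z \<in> cimg \<kappa>'" for \<kappa>' z
    using \<omega>_ham_field[OF smooth_G that, of "X \<kappa>' z"] \<omega>_props(2)[OF that] by simp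
  have 2: "dchart \<kappa>' Ht z (X \<kappa>' z) = 0" if "\<kappa>' \<in> \<A>" "z \<in> cimg \<kappa>'" for \<kappa>' z
    using \<omega>_ham_field[OF smooth_Ht that, of "X \<kappa>' z"] commute that
      skew_swap[OF \<omega>_props(1,2)[OF that], of "X \<kappa>' z" "ham_field \<omega> Ht \<kappa>' z"]
    unfolding poisson_commute_def by simp
  show "G (c s) = G (c t)" by (rule curve_conserved[OF c smooth_G 1 st])
  show "Ht (c s) = Ht (c t)" by (rule curve_conserved[OF c smooth_Ht 2 st])
qed

lemma straight_curve:
  assumes "\<And>t. t \<in> {a..b} \<Longrightarrow> emb p (t + s) \<in> cimg \<kappa>"
  shows "curve {a..b} (\<lambda>t. cinv \<kappa> (emb p (t + s)))"
proof (rule curveI[OF \<kappa>(1)])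
  show "(\<lambda>t. emb p (t + s)) ` {a..b} \<subseteq> cimg \<kappa>" using assms by blast
  fix t assume t: "t \<in> {a..b}"
  have "((\<lambda>t. emb p (t + s)) has_derivative (\<lambda>h. (0, 0, 0, h))) (at t within {a..b})"
    unfolding emb_def by (auto intro!: derivative_eq_intros)
  then show "((\<lambda>t. emb p (t + s)) has_vector_derivative X \<kappa> (emb p (t + s))) (at t within {a..b})"
    by (simp add: has_vector_derivative_def X_chart[OF assms[OF t]])
qed

text \<open>The flow is \<open>\<partial>/\<partial>\<phi>\<close> in the chart, so the return map is the \<open>(x, y, \<lambda>)\<close>-part of the
  transport \<open>M\<close> along the periodic orbit up to a time \<open>T0 - \<delta>\<close> shortly before the return. Stopping
  early makes it unnecessary to distinguish return times above and below \<open>T0\<close>.\<close>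

lemma return_map:
  assumes \<mu>: "first_return_map U \<A> \<omega> G \<kappa> \<mu>"
  shows "\<exists>N W M. open N \<and> 0 \<in> N \<and> N \<subseteq> section3 \<kappa> \<and>
     open W \<and> (\<forall>p\<in>N. emb p 0 \<in> W) \<and> W \<subseteq> cimg \<kappa> \<and> smooth_on W M \<and> M ` W \<subseteq> cimg \<kappa> \<and>
     (\<forall>z\<in>W. \<forall>v w. \<omega> \<kappa> (M z) (fD M z v) (fD M z w) = \<omega> \<kappa> z v w) \<and>
     (\<forall>z\<in>W. \<exists>a b c. a \<le> b \<and> curve {a..b} c \<and> c a = cinv \<kappa> z \<and> c b = cinv \<kappa> (M z)) \<and>
     (\<forall>p\<in>N. \<mu> p = pr (M (emb p 0)))"
proof -
  note inv = chart_inv[OF \<kappa>(1)]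
  have inj: "z = z'" if "cinv \<kappa> z = cinv \<kappa> z'" "z \<in> cimg \<kappa>" "z' \<in> cimg \<kappa>" for z z' using inv(2) that by metis
  note d = \<mu>[unfolded first_return_map_def]
  have m0: "\<mu> 0 = 0" "isCont \<mu> 0" by (rule conjunct1[OF d], rule conjunct1[OF conjunct2[OF d]])
  from conjunct2[OF conjunct2[OF d]] obtain N0 V where N0V: "open N0 \<and> N0 \<subseteq> section3 \<kappa> \<and> open V \<and> 0 \<in> V \<and> V \<subseteq> N0 \<and>
    (\<forall>p\<in>V. \<mu> p \<in> N0 \<and> (\<exists>T>0. \<exists>\<gamma>. curve {0..T} \<gamma> \<and>
              \<gamma> 0 = section_point \<kappa> p \<and> \<gamma> T = section_point \<kappa> (\<mu> p) \<and>
              (\<forall>t\<in>{0<..<T}. \<gamma> t \<notin> section_point \<kappa> ` N0)))" by (elim exE)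
  then have N0: "open N0" "N0 \<subseteq> section3 \<kappa>" and V: "open V" "0 \<in> V" "V \<subseteq> N0"
    and ret: "\<And>p. p \<in> V \<Longrightarrow> \<mu> p \<in> N0 \<and> (\<exists>T>0. \<exists>\<gamma>. curve {0..T} \<gamma> \<and>
              \<gamma> 0 = section_point \<kappa> p \<and> \<gamma> T = section_point \<kappa> (\<mu> p) \<and>
              (\<forall>t\<in>{0<..<T}. \<gamma> t \<notin> section_point \<kappa> ` N0))"
    by (simp_all only:)
  obtain T0 \<gamma>0 where T0: "T0 > 0" and g0: "curve {0..T0} \<gamma>0" "\<gamma>0 0 = cinv \<kappa> 0" "\<gamma>0 T0 = cinv \<kappa> 0"
    "\<And>t. t \<in> {0<..<T0} \<Longrightarrow> \<gamma>0 t \<notin> section_point \<kappa> ` N0"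
    using ret[OF V(2)] by (auto simp: m0 section_point_emb)
  have nP: "\<gamma>0 t \<noteq> cinv \<kappa> 0" if "t \<in> {0<..<T0}" for t
  proof -
    have "section_point \<kappa> 0 \<in> section_point \<kappa> ` N0" using V by blast
    then show ?thesis using g0(4)[OF that] by (auto simp: section_point_emb)
  qed
  obtain \<epsilon>0 where e0: "\<epsilon>0 > 0" "ball 0 \<epsilon>0 \<subseteq> cimg \<kappa>" using chart(2)[OF \<kappa>(1)] \<kappa>(2) openE by blast
  have box: "emb p t \<in> cimg \<kappa>" if "norm p < \<epsilon>0/2" "\<bar>t\<bar> < \<epsilon>0/2" for p t
  proof -
    have "emb p t \<in> ball 0 \<epsilon>0" using norm_emb[of p t] that by simp
    then show ?thesis by (rule subsetD[OF e0(2)])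
  qed
  \<comment> \<open>Small compared with the coordinate box, so that for times of order
    \<open>\<delta>\<close> the flow is a straight line in the chart, and compared with
    \<open>T0\<close>, so that \<open>\<delta> \<le> T1\<close>.\<close>
  define \<delta> where "\<delta> = min (\<epsilon>0/4) (T0/4)"
  have \<delta>: "\<delta> > 0" "\<delta> \<le> \<epsilon>0/4" "\<delta> \<le> T0/4" using e0 T0 by (auto simp: \<delta>_def)
  define T1 where "T1 = T0 - \<delta>"
  have T1: "0 \<le> T1" "T1 < T0" "\<delta> \<le> T1" using \<delta> T0 by (auto simp: T1_def)
  \<comment> \<open>Followed backwards from the moment of return, the orbit is a straight line in
    the \<open>\<phi>\<close> direction.\<close>
  have g1: "\<gamma>0 T1 = cinv \<kappa> (emb 0 (- \<delta>))"
  proof -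
    have "curve {T1..T0} \<gamma>0" by (rule curve_subset[OF g0(1)]) (use T1 in auto)
    moreover have "curve {T1..T0} (\<lambda>t. cinv \<kappa> (emb 0 (t + (- T0))))"
      by (rule straight_curve, rule box) (use e0 \<delta> in \<open>auto simp: T1_def\<close>)
    ultimately have "\<gamma>0 T1 = cinv \<kappa> (emb 0 (T1 + (- T0)))"
      by (rule curve_unique[where s=T0]) (use T1 g0 in auto)
    then show ?thesis by (simp add: T1_def)
  qed
  have d\<delta>: "emb 0 (- \<delta>) \<in> cimg \<kappa>" by (rule box) (use e0 \<delta> in auto)
  \<comment> \<open>By the first-return property the orbit misses the base point between the times
    \<open>\<delta>\<close> and \<open>T1\<close>. This arc is compact, hence closed, so the orbit
    misses a whole closed coordinate ball around it, whose image is \<open>N'\<close>.\<close>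
  have "continuous_on {0..T0} \<gamma>0" using g0(1) by (simp add: ham_curve_def)
  then have "continuous_on {\<delta>..T1} \<gamma>0" by (rule continuous_on_subset) (use \<delta> T1 in auto)
  then have "compact (\<gamma>0 ` {\<delta>..T1})" by (rule compact_continuous_image) simp
  then have "open (- (\<gamma>0 ` {\<delta>..T1}))" by (intro open_Compl compact_imp_closed)
  then have "open {z \<in> cimg \<kappa>. cinv \<kappa> z \<in> - (\<gamma>0 ` {\<delta>..T1})}"
    by (rule open_continuous_preimage[OF chart(2)[OF \<kappa>(1)] chart(4)[OF \<kappa>(1)]])
  moreover have "0 \<in> {z \<in> cimg \<kappa>. cinv \<kappa> z \<in> - (\<gamma>0 ` {\<delta>..T1})}"
  proof -
    have ne: "\<gamma>0 t \<noteq> cinv \<kappa> 0" if "t \<in> {\<delta>..T1}" for t by (rule nP) (use that \<delta> T1 in auto)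
    have "cinv \<kappa> 0 \<notin> \<gamma>0 ` {\<delta>..T1}" by (rule notI, erule imageE) (use ne in metis)
    then show ?thesis by (intro CollectI conjI \<kappa>(2) ComplI) (erule (1) notE)
  qed
  ultimately obtain \<epsilon>2 where e2: "\<epsilon>2 > 0" "cball 0 \<epsilon>2 \<subseteq> {z \<in> cimg \<kappa>. cinv \<kappa> z \<in> - (\<gamma>0 ` {\<delta>..T1})}"
    using open_contains_cball by meson
  define N' where "N' = cinv \<kappa> ` cball 0 \<epsilon>2"
  have "compact N'" unfolding N'_def
    by (intro compact_continuous_image continuous_on_subset[OF chart(4)[OF \<kappa>(1)]] compact_cball) (use e2 in auto)
  then have "closed N'" by (rule compact_imp_closed)
  then have "open ({..<\<delta>} \<times> UNIV \<union> UNIV \<times> (- N'))" by (intro open_Un open_Times) auto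
  \<comment> \<open>A curve in this tube stays outside \<open>N'\<close> from time
    \<open>\<delta>\<close> on; \<open>transport\<close> extends this property from the orbit to
    nearby curves.\<close>
  moreover define Q where "Q = {..<\<delta>} \<times> UNIV \<union> UNIV \<times> (- N')"
  ultimately have Q: "open Q" by simp
  have gQ: "\<forall>t\<in>{0..T1}. (t, \<gamma>0 t) \<in> Q"
  proof
    fix t assume t: "t \<in> {0..T1}"
    have "\<gamma>0 t \<notin> N'" if l: "\<delta> \<le> t"
    proof
      assume "\<gamma>0 t \<in> N'"
      then obtain z where z: "z \<in> cball 0 \<epsilon>2" "\<gamma>0 t = cinv \<kappa> z" unfolding N'_def by (rule imageE)
      have "cinv \<kappa> z \<notin> \<gamma>0 ` {\<delta>..T1}" using subsetD[OF e2(2) z(1)] by blast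
      moreover have "\<gamma>0 t \<in> \<gamma>0 ` {\<delta>..T1}" by (rule imageI) (use l t in auto)
      ultimately show False using z(2) by simp
    qed
    then show "(t, \<gamma>0 t) \<in> Q" by (auto simp: Q_def)
  qed
  have tr: "transport \<gamma>0 0 T1"
    by (rule transport_curve[OF curve_subset[OF g0(1)] T1(1)]) (use T1 in auto)
  have cm: "\<gamma>0 0 \<in> cdom \<kappa>" "\<gamma>0 T1 \<in> cdom \<kappa>" "cmap \<kappa> (\<gamma>0 0) = 0" "cmap \<kappa> (\<gamma>0 T1) = emb 0 (- \<delta>)"
    using inv(2,3)[OF \<kappa>(2)] inv(2,3)[OF d\<delta>] by (simp_all only: g0(2) g1)
  have "\<exists>W M. open W \<and> cmap \<kappa> (\<gamma>0 0) \<in> W \<and> W \<subseteq> cimg \<kappa> \<and> smooth_on W M \<and> M ` W \<subseteq> cimg \<kappa> \<and>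
       M (cmap \<kappa> (\<gamma>0 0)) = cmap \<kappa> (\<gamma>0 T1) \<and>
       (\<forall>z\<in>W. \<forall>v w. \<omega> \<kappa> (M z) (fD M z v) (fD M z w) = \<omega> \<kappa> z v w) \<and>
       (\<forall>z\<in>W. \<exists>c. curve {0..T1} c \<and> c 0 = cinv \<kappa> z \<and> c T1 = cinv \<kappa> (M z) \<and> (\<forall>t\<in>{0..T1}. (t, c t) \<in> Q))"
    by (rule tr[unfolded transport_def, rule_format, OF \<kappa>(1) \<kappa>(1)]) (intro conjI cm Q gQ)
  then obtain W4 M where W4: "open W4" "0 \<in> W4" "W4 \<subseteq> cimg \<kappa>" "smooth_on W4 M" "M ` W4 \<subseteq> cimg \<kappa>"
    "M 0 = emb 0 (- \<delta>)" "\<forall>z\<in>W4. \<forall>v w. \<omega> \<kappa> (M z) (fD M z v) (fD M z w) = \<omega> \<kappa> z v w"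
    "\<forall>z\<in>W4. \<exists>c. curve {0..T1} c \<and> c 0 = cinv \<kappa> z \<and> c T1 = cinv \<kappa> (M z) \<and> (\<forall>t\<in>{0..T1}. (t, c t) \<in> Q)"
    unfolding cm by (elim exE conjE)
  have cemb: "continuous_on UNIV (\<lambda>p. emb p 0)" by (rule linear_continuous_on[OF bounded_linear_emb])
  define N1 where "N1 = {p. emb p 0 \<in> W4}"
  have N1: "open N1" unfolding N1_def using open_continuous_preimage[OF open_UNIV cemb W4(1)] by simp
  define f where "f = (\<lambda>p. M (emb p 0))"
  have cf: "continuous_on N1 f" unfolding f_def
    by (rule continuous_on_compose2[OF smooth_on_continuous[OF W4(4)] continuous_on_subset[OF cemb]]) (auto simp: N1_def)
  have cpf: "continuous_on N1 (\<lambda>p. pr (f p))" "continuous_on N1 (\<lambda>p. dphi (f p))"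
    by (rule bounded_linear.continuous_on[OF bounded_linear_pr cf] bounded_linear.continuous_on[OF bounded_linear_dphi cf])+
  \<comment> \<open>Continuity of \<open>\<mu>\<close> at 0 places the return point in
    \<open>N'\<close>, which the tube excludes until \<open>T1\<close>. This rules out a premature
    return.\<close>
  obtain \<epsilon>3 where e3: "\<epsilon>3 > 0" "\<And>p. dist p 0 < \<epsilon>3 \<Longrightarrow> dist (\<mu> p) 0 < \<epsilon>2"
    using m0(2)[unfolded continuous_at_eps_delta, rule_format, OF e2(1)] unfolding m0(1) by blast
  \<comment> \<open>The bounds on \<open>dphi\<close> put the transported point shortly before the
    section. Its projection must lie in \<open>N0\<close> for the crossing to count as a
    return.\<close>
  define N2 where "N2 = {p \<in> N1. pr (f p) \<in> N0 \<inter> ball 0 (\<epsilon>0/2)} \<inter> {p \<in> N1. dphi (f p) \<in> {-(3/2) * \<delta><..<- \<delta>/2}} \<inter>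
     V \<inter> ball 0 (\<epsilon>0/2) \<inter> ball 0 \<epsilon>3"
  have N2: "open N2" unfolding N2_def
    by (intro open_Int open_continuous_preimage[OF N1 cpf(1)] open_continuous_preimage[OF N1 cpf(2)] N0 V open_ball) auto
  have "f 0 = emb 0 (- \<delta>)" by (simp add: f_def W4)
  then have zN2: "0 \<in> N2" using W4(2) V e0 e3 \<delta> by (auto simp: N2_def N1_def)
  have "\<mu> p = pr (f p)" if p: "p \<in> N2" for p
  proof -
    define \<pi> where "\<pi> = pr (f p)"
    \<comment> \<open>The time at which the straight continuation reaches
      \<open>\<phi> = 0\<close>.\<close>
    define T2 where "T2 = T1 - dphi (f p)"
    have pp: "p \<in> N1" "p \<in> V" "norm p < \<epsilon>0/2" "dist p 0 < \<epsilon>3" "\<pi> \<in> N0" "norm \<pi> < \<epsilon>0/2"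
      "dphi (f p) > - (3/2) * \<delta>" "dphi (f p) < - \<delta>/2" using p by (auto simp: N2_def \<pi>_def)
    have fp: "f p = emb \<pi> (T1 - T2)" by (simp add: \<pi>_def T2_def)
    have T2: "T1 < T2" "T2 > 0" "T2 - T1 < \<epsilon>0/2" using pp \<delta> T1 unfolding T2_def by linarith+
    obtain T \<gamma> where T: "T > 0" and g: "curve {0..T} \<gamma>" "\<gamma> 0 = cinv \<kappa> (emb p 0)" "\<gamma> T = cinv \<kappa> (emb (\<mu> p) 0)"
      "\<And>t. t \<in> {0<..<T} \<Longrightarrow> \<gamma> t \<notin> section_point \<kappa> ` N0" and \<mu>N: "\<mu> p \<in> N0"
      using ret[OF pp(2)] by (auto simp: section_point_emb)
    have \<mu>i: "emb (\<mu> p) 0 \<in> cimg \<kappa>" using \<mu>N N0 section3_emb by blast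
    obtain c where c: "curve {0..T1} c" "c 0 = cinv \<kappa> (emb p 0)" "c T1 = cinv \<kappa> (f p)" "\<And>t. t \<in> {0..T1} \<Longrightarrow> (t, c t) \<in> Q"
      using W4(8) pp(1) unfolding N1_def f_def by blast
    let ?c2 = "\<lambda>t. cinv \<kappa> (emb \<pi> (t + (- T2)))"
    have c2i: "emb \<pi> (t + (- T2)) \<in> cimg \<kappa>" if "t \<in> {T1..T2}" for t by (rule box) (use that T2 pp in auto)
    have "curve {T1..T2} ?c2" by (rule straight_curve[OF c2i])
    from curve_concat[OF c(1) this _ T1(1)] have cc: "curve {0..T2} (\<lambda>t. if t \<le> T1 then c t else ?c2 t)"
      using T2 by (simp add: c fp)
    let ?c = "\<lambda>t. if t \<le> T1 then c t else ?c2 t"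
    have agree: "\<gamma> t = ?c t" if "0 \<le> t" "t \<le> T" "t \<le> T2" for t
    proof (rule curve_unique[of 0 t \<gamma> ?c 0 t])
      show "curve {0..t} \<gamma>" by (rule curve_subset[OF g(1)]) (use that in auto)
      show "curve {0..t} ?c" by (rule curve_subset[OF cc]) (use that in auto)
    qed (use that T1 c g in auto)
    \<comment> \<open>Otherwise the section would be met at the intermediate time
      \<open>T2\<close>.\<close>
    have "\<not> T2 < T"
    proof
      assume l: "T2 < T"
      then have "\<gamma> T2 = section_point \<kappa> \<pi>" using agree[of T2] T2 by (simp add: section_point_emb)
      then show False using g(4)[of T2] l T2 pp(5) by auto
    qed
    then have TT2: "T \<le> T2" by simp
    then have cT: "?c T = cinv \<kappa> (emb (\<mu> p) 0)" using agree[of T] T g by simp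
    \<comment> \<open>Before time \<open>\<delta>\<close> the curve is still on its initial straight
      line, where \<open>\<phi>\<close> equals the elapsed time and is positive.\<close>
    have "\<not> T < \<delta>"
    proof
      assume l: "T < \<delta>"
      have i: "emb p (t + 0) \<in> cimg \<kappa>" if "t \<in> {0..T}" for t by (rule box) (use that l \<delta> pp in auto)
      have "\<gamma> T = cinv \<kappa> (emb p (T + 0))"
        by (rule curve_unique[OF g(1) straight_curve[OF i], of 0]) (use T g in auto)
      then have "emb p (T + 0) = emb (\<mu> p) 0" using inj[OF _ i \<mu>i, of T] g T by auto
      then show False using T by simp
    qed
    \<comment> \<open>In this range the tube keeps the curve outside \<open>N'\<close>, which
      contains the return point.\<close>
    moreover have "\<not> (\<delta> \<le> T \<and> T \<le> T1)"
    proof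
      assume l: "\<delta> \<le> T \<and> T \<le> T1"
      then have "(T, cinv \<kappa> (emb (\<mu> p) 0)) \<in> Q" using c(4)[of T] cT T by simp
      then have "cinv \<kappa> (emb (\<mu> p) 0) \<notin> N'" using l by (auto simp: Q_def)
      moreover have "emb (\<mu> p) 0 \<in> cball 0 \<epsilon>2" using e3(2)[OF pp(4)] by (simp add: norm_emb_0)
      ultimately show False by (auto simp: N'_def)
    qed
    ultimately have TT1: "T1 < T" by linarith
    \<comment> \<open>On the last straight piece the first three coordinates are constantly
      \<open>\<pi>\<close>.\<close>
    then have "emb \<pi> (T + (- T2)) = emb (\<mu> p) 0" using cT inj[OF _ c2i \<mu>i, of T] TT2 by auto
    then show ?thesis by (simp add: \<pi>_def)
  qed
  moreover have "N2 \<subseteq> section3 \<kappa>" using V N0 by (auto simp: N2_def)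
  moreover have "\<forall>p\<in>N2. emb p 0 \<in> W4" by (auto simp: N2_def N1_def)
  moreover have "\<forall>z\<in>W4. \<exists>a b c. a \<le> b \<and> curve {a..b} c \<and> c a = cinv \<kappa> z \<and> c b = cinv \<kappa> (M z)"
    using W4(8) T1(1) by blast
  ultimately show ?thesis using N2 zN2 W4(1,3-5,7) unfolding f_def
    by (intro exI[of _ N2] exI[of _ W4] exI[of _ M]) auto
qed

text \<open>The transport preserves \<open>dlam\<close>, so vectors tangent to the slices are mapped
  to such vectors, and on them \<open>\<omega>\<close> reduces to \<open>g dx \<and> dy\<close>.
  This form does not involve \<open>\<phi>\<close> and therefore passes to the projection
  \<open>pr\<close>.\<close>

lemma parabolic_return_map:
  assumes \<mu>: "first_return_map U \<A> \<omega> G \<kappa> \<mu>"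
  shows "\<exists>N. N \<subseteq> section3 \<kappa> \<and> parabolic_return N g \<mu>"
proof -
  obtain N W M where N: "open N" "0 \<in> N" "N \<subseteq> section3 \<kappa>"
    and W: "open W" "\<forall>p\<in>N. emb p 0 \<in> W" "W \<subseteq> cimg \<kappa>" and M: "smooth_on W M" "M ` W \<subseteq> cimg \<kappa>"
    and sympl: "\<forall>z\<in>W. \<forall>v w. \<omega> \<kappa> (M z) (fD M z v) (fD M z w) = \<omega> \<kappa> z v w"
    and cur: "\<forall>z\<in>W. \<exists>a b c. a \<le> b \<and> curve {a..b} c \<and> c a = cinv \<kappa> z \<and> c b = cinv \<kappa> (M z)"
    and \<mu>M: "\<forall>p\<in>N. \<mu> p = pr (M (emb p 0))"
    using return_map[OF \<mu>] by (elim exE conjE)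
  note W = W(1) bspec[OF W(2)] W(3) and \<mu>M = bspec[OF \<mu>M] and cur = bspec[OF cur]
  note sympl = sympl[rule_format]
  have Mi: "M z \<in> cimg \<kappa>" "z \<in> cimg \<kappa>" if "z \<in> W" for z using that M(2) W(3) by auto
  have cons: "dlam (M z) = dlam z" "parabolic_H (pr (M z)) = parabolic_H (pr z)" if z: "z \<in> W" for z
  proof -
    obtain a b c where c: "a \<le> b" "curve {a..b} c" "c a = cinv \<kappa> z" "c b = cinv \<kappa> (M z)" using cur[OF z] by blast
    then have "G (cinv \<kappa> (M z)) = G (cinv \<kappa> z)" "Ht (cinv \<kappa> (M z)) = Ht (cinv \<kappa> z)"
      using conserved[OF c(2), of b a] by auto
    then show "dlam (M z) = dlam z" "parabolic_H (pr (M z)) = parabolic_H (pr z)"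
      using G_chart[OF Mi(1)[OF z]] G_chart[OF Mi(2)[OF z]] H_chart[OF Mi(1)[OF z]] H_chart[OF Mi(2)[OF z]] by auto
  qed
  have dM: "(M has_derivative fD M z) (at z)" if "z \<in> W" for z by (rule smooth_on_derivative[OF M(1) that])
  have bld: "bounded_linear dlam" unfolding dlam_def
    by (intro bounded_linear_compose[OF bounded_linear_fst bounded_linear_compose[OF bounded_linear_snd bounded_linear_snd]])
  have dl: "dlam (fD M z v) = dlam v" if z: "z \<in> W" for z v
  proof -
    have 1: "((\<lambda>z. dlam (M z)) has_derivative (\<lambda>v. dlam (fD M z v))) (at z)"
      by (rule bounded_linear.has_derivative[OF bld dM[OF z]])
    have 2: "((\<lambda>z. dlam (M z)) has_derivative dlam) (at z)"
      by (rule has_derivative_transform_within_open[OF bounded_linear_imp_has_derivative[OF bld] W(1) z cons(1)[symmetric]])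
    from fun_cong[OF has_derivative_unique[OF 1 2]] show ?thesis .
  qed
  have d\<mu>: "fD \<mu> p v = pr (fD M (emb p 0) (emb v 0))" if p: "p \<in> N" for p v
  proof -
    have "((\<lambda>p. M (emb p 0)) has_derivative (\<lambda>v. fD M (emb p 0) (emb v 0))) (at p)"
      by (rule has_derivative_compose[OF bounded_linear_imp_has_derivative[OF bounded_linear_emb] dM[OF W(2)[OF p]]])
    then have "((\<lambda>p. pr (M (emb p 0))) has_derivative (\<lambda>v. pr (fD M (emb p 0) (emb v 0)))) (at p)"
      by (rule bounded_linear.has_derivative[OF bounded_linear_pr])
    then have "(\<mu> has_derivative (\<lambda>v. pr (fD M (emb p 0) (emb v 0)))) (at p)"
      by (rule has_derivative_transform_within_open[OF _ N(1) p \<mu>M[symmetric]])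
    from fD_eqI[OF this] show ?thesis by simp
  qed
  have "parabolic_return N g \<mu>"
  proof
    show "open N" "0 \<in> N" by (rule N)+
    have "N \<subseteq> pr ` cimg \<kappa>"
    proof
      fix p assume "p \<in> N"
      then have "emb p 0 \<in> cimg \<kappa>" using W by blast
      then show "p \<in> pr ` cimg \<kappa>" by (metis imageI pr_emb(1))
    qed
    then show "smooth_on N g" by (rule smooth_on_subset[OF smooth_g])
    show "g p \<noteq> 0" if "p \<in> N" for p using g_nonzero[of "emb p 0"] Mi(2)[OF W(2)[OF that]] by simp
    have "smooth_on N (\<lambda>p. emb p 0)" by (intro smooth_onI Ck_on_linear N bounded_linear_emb)
    then have smM: "smooth_on N (\<lambda>p. M (emb p 0))" by (rule smooth_on_compose[OF N(1) W(1) _ M(1)]) (use W(2) in blast)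
    have "smooth_on N (\<lambda>p. pr (M (emb p 0)))"
      by (rule smooth_onI) (rule bounded_linear.Ck_on_compose[OF bounded_linear_pr N(1) smooth_onD[OF smM]])
    moreover have "smooth_on N \<mu> = smooth_on N (\<lambda>p. pr (M (emb p 0)))" by (rule smooth_on_cong[OF N(1) \<mu>M])
    ultimately show "smooth_on N \<mu>" by simp
    show "\<mu> 0 = 0" using \<mu> by (simp add: first_return_map_def)
    fix p assume p: "p \<in> N"
    note z = W(2)[OF p]
    show "parabolic_H (\<mu> p) = parabolic_H p" using cons(2)[OF z] \<mu>M[OF p] by simp
    show "snd (snd (\<mu> p)) = snd (snd p)" using cons(1)[OF z] \<mu>M[OF p] by (simp add: pr_def dlam_def emb_def)
    fix a b c d :: real
    have "\<omega> \<kappa> (M (emb p 0)) (fD M (emb p 0) (emb (a, b, 0) 0)) (fD M (emb p 0) (emb (c, d, 0) 0)) =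
        \<omega> \<kappa> (emb p 0) (emb (a, b, 0) 0) (emb (c, d, 0) 0)" by (rule sympl[OF z])
    moreover have "dlam (emb (a, b, 0) 0) = 0" "dlam (emb (c, d, 0) 0) = 0" by (simp_all add: dlam_def emb_def)
    ultimately have "g (\<mu> p) * wedge dx dy (fD M (emb p 0) (emb (a, b, 0) 0)) (fD M (emb p 0) (emb (c, d, 0) 0)) =
        g p * wedge dx dy (emb (a, b, 0) 0) (emb (c, d, 0) 0)"
      unfolding \<omega>_chart[OF Mi(1)[OF z]] \<omega>_chart[OF Mi(2)[OF z]] by (simp add: wedge_def dl[OF z] \<mu>M[OF p])
    then show "g (\<mu> p) *
       (fst (fD \<mu> p (a, b, 0)) * fst (snd (fD \<mu> p (c, d, 0))) - fst (fD \<mu> p (c, d, 0)) * fst (snd (fD \<mu> p (a, b, 0))))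
       = g p * (a * d - c * b)"
      unfolding d\<mu>[OF p] by (simp add: wedge_def dx_def dy_def pr_def emb_def)
  qed
  then show ?thesis using N(3) by blast
qed

end

theorem theorem2p1:
  fixes U :: "'m::{t2_space,second_countable_topology} set"
    and \<A> :: "'m chart set" and \<omega> :: "'m two_form"
    and Ht G :: "'m \<Rightarrow> real" and \<beta> :: "'m set" and P :: 'm
    and \<kappa> :: "'m chart" and V :: "(real \<times> real) set" and h :: "real \<times> real \<Rightarrow> real"
    and g A B :: "R3 \<Rightarrow> real" and \<mu> :: "R3 \<Rightarrow> R3"
  assumes "integrable_system U \<A> \<omega> Ht G"
    and "parabolic_orbit U \<A> \<omega> Ht G \<beta>"
    and "\<forall>q\<in>\<beta>. nonzero_differential \<A> G q"
    and "P \<in> \<beta>"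
    and "parabolic_coordinates \<A> \<omega> Ht G \<beta> P \<kappa> V h g A B"
    and "first_return_map U \<A> \<omega> G \<kappa> \<mu>"
  shows "\<exists>K D W. open D \<and> D \<subseteq> section3 \<kappa> \<and> smooth_on D K \<and>
           open W \<and> 0 \<in> W \<and> W \<subseteq> D \<and>
           (\<forall>p\<in>W. time_one_image (slice_ham_field g K) D p (\<mu> p))"
proof -
  have sys: "smooth_4manifold U \<A>" "symplectic_form \<A> \<omega>" "smooth_fun \<A> Ht" "smooth_fun \<A> G" "poisson_commute \<A> \<omega> Ht G"
    using assms(1) unfolding integrable_system_def by blast+
  have pre: "(\<lambda>(x, y, l, \<phi>). (x, y, l)) = pr" by (auto simp: pr_def)
  have co: "\<kappa> \<in> \<A>" "P \<in> cdom \<kappa>" "cmap \<kappa> P = (0, 0, 0, 0)" "smooth_on (pr ` cimg \<kappa>) g"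
    and nf: "\<And>x y l \<phi>. (x, y, l, \<phi>) \<in> cimg \<kappa> \<Longrightarrow>
        (let q = cinv \<kappa> (x, y, l, \<phi>) in h (Ht q, G q) = x^2 - y^3 + l * y \<and> G q = l) \<and>
        (\<forall>v w. \<omega> \<kappa> (x, y, l, \<phi>) v w = g (x, y, l) * wedge dx dy v w +
           wedge dlam (\<lambda>u. dphi u + A (x, y, l) * dx u + B (x, y, l) * dy u) v w)"
    using assms(5) unfolding parabolic_coordinates_def pre Let_def by blast+
  interpret parabolic_chart U \<A> \<omega> G Ht \<kappa> h g A B
  proof
    show "smooth_4manifold U \<A>" "symplectic_form \<A> \<omega>" "smooth_fun \<A> Ht" "smooth_fun \<A> G" "poisson_commute \<A> \<omega> Ht G"
      by (rule sys)+
    show "\<kappa> \<in> \<A>" "smooth_on (pr ` cimg \<kappa>) g" by (rule co)+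
    show "0 \<in> cimg \<kappa>" using co(2,3) by (metis imageI zero_prod_def)
    fix z :: R4 assume z: "z \<in> cimg \<kappa>"
    obtain x y l \<phi> where ze: "z = (x, y, l, \<phi>)" by (metis surj_pair)
    note n = nf[OF z[unfolded ze], unfolded Let_def]
    show "h (Ht (cinv \<kappa> z), G (cinv \<kappa> z)) = parabolic_H (pr z)"
      unfolding ze parabolic_H_def pr_def fst_conv snd_conv prod.case by (rule conjunct1[OF conjunct1[OF n]])
    show "G (cinv \<kappa> z) = dlam z"
      unfolding ze dlam_def fst_conv snd_conv by (rule conjunct2[OF conjunct1[OF n]])
    fix v w
    show "\<omega> \<kappa> z v w = g (pr z) * wedge dx dy v w +
       wedge dlam (\<lambda>u. dphi u + A (pr z) * dx u + B (pr z) * dy u) v w"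
      unfolding ze pr_def fst_conv snd_conv by (rule conjunct2[OF n, rule_format])
  qed
  obtain N where N: "N \<subseteq> section3 \<kappa>" "parabolic_return N g \<mu>"
    using parabolic_return_map[OF assms(6)] by blast
  from parabolic_return.time_one_map[OF N(2)] N(1) show ?thesis by (meson order_trans)
qed

end
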